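(* Let $k\ge3$. The spectral dimension $d_S$ of $K^{(k)}$ with the harmonic structure $(D,\{r,\dots,r\})$, where $r=\frac{k(k-2)}{k^2-k-1}$ and $D$ is the $k\times k$ matrix with diagonal entries $-(k-1)$ and off-diagonal entries $1$, and with the standard Bernoulli measure, is $$d_S=\frac{2\log k}{\log(k^2-k-1)-\log(k-2)}.$$
   Context: Let $\mathsf{X}_k=\{0,\dots,k-1\}$. Let $p_0,\dots,p_{k-1}$ be the vertices of a regular simplex in $\mathbb{R}^{k-1}$ (with $k$ vertices), and let $q_i=\frac1{k-1}\sum_{j\neq i}p_j$. For $i\in\mathsf{X}_k$ let $F_i:\mathbb{R}^{k-1}\to\mathbb{R}^{k-1}$ be the unique affine map with $F_i(p_i)=p_i$ and $F_i(p_j)=q_j$ for $j\ne i$; each $F_i$ is a contraction. $K^{(k)}$ is the unique nonempty compact set with $K^{(k)}=\bigcup_{i\in\mathsf{X}_k}F_i(K^{(k)})$. Set $V_0=\{p_i: i\in\mathsf{X}_k\}$, $V_{m+1}=\bigcup_{i}F_i(V_m)$. The pair $(D,\{r,\dots,r\})$ determines the energies $\mathcal{E}_0(u)=-u^TDu=\sum_{i<j}(u(p_i)-u(p_j))^2$ on functions on $V_0$ and $\mathcal{E}_m(u)=r^{-1}\sum_{i\in\mathsf{X}_k}\mathcal{E}_{m-1}(u\circ F_i)$ on functions on $V_m$, $m\ge1$; for each $u$ on $V_{m-1}$ the minimum of $\mathcal{E}_m$ over extensions of $u$ to $V_m$ equals $\mathcal{E}_{m-1}(u)$. For $u\in C(K^{(k)})$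 set $\mathcal{E}(u)=\lim_{m\to\infty}\mathcal{E}_m(u|_{V_m})\in[0,\infty]$ (a nondecreasing limit) and $\mathcal{F}=\{u\in C(K^{(k)}):\mathcal{E}(u)<\infty\}$. The standard Bernoulli measure $\mu$ is the unique Borel probability measure on $K^{(k)}$ with $\mu=\frac1k\sum_{i\in\mathsf{X}_k}\mu\circ F_i^{-1}$. The Laplacian is the nonnegative self-adjoint operator on $L^2(K^{(k)},\mu)$ associated with the closed quadratic form $(\mathcal{E},\mathcal{F})$; it has discrete spectrum. Let $\rho(x)$ be the number of its eigenvalues, counted with multiplicity, that are at most $x$. The spectral dimension is the number $d_S$ for which $0<\liminf_{x\to\infty}\rho(x)x^{-d_S/2}\le\limsup_{x\to\infty}\rho(x)x^{-d_S/2}<\infty$. *)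

theory Defs
  imports "HOL-Probability.Probability"
begin

text \<open>The index set \<open>{0,\<dots>,k-1}\<close> is \<open>{..<k}\<close>; families of points, maps and matrix entries
  are functions on \<^typ>\<open>nat\<close> of which only the values below \<open>k\<close> matter.\<close>

definition regular_simplex_vertices :: "nat \<Rightarrow> (nat \<Rightarrow> 'a::euclidean_space) \<Rightarrow> bool" where
  "regular_simplex_vertices k p \<longleftrightarrow>
     inj_on p {..<k} \<and> \<not> affine_dependent (p ` {..<k}) \<and>
     (\<exists>s. \<forall>i<k. \<forall>j<k. i \<noteq> j \<longrightarrow> dist (p i) (p j) = s)"

definition opposite_barycenter :: "nat \<Rightarrow> (nat \<Rightarrow> 'a::real_vector) \<Rightarrow> nat \<Rightarrow> 'a" where
  "opposite_barycenter k p i = (1 / (real k - 1)) *\<^sub>R (\<Sum>j\<in>{..<k} - {i}. p j)"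

definition affine_map :: "('a::real_vector \<Rightarrow> 'a) \<Rightarrow> bool" where
  "affine_map f \<longleftrightarrow> (\<exists>g c. linear g \<and> (\<forall>x. f x = g x + c))"

definition cell_maps ::
    "nat \<Rightarrow> (nat \<Rightarrow> 'a::real_vector) \<Rightarrow> (nat \<Rightarrow> 'a \<Rightarrow> 'a) \<Rightarrow> bool" where
  "cell_maps k p F \<longleftrightarrow>
     (\<forall>i<k. affine_map (F i) \<and> F i (p i) = p i \<and>
        (\<forall>j<k. j \<noteq> i \<longrightarrow> F i (p j) = opposite_barycenter k p j))"

definition attractor :: "nat \<Rightarrow> (nat \<Rightarrow> 'a \<Rightarrow> 'a) \<Rightarrow> 'a::topological_space set \<Rightarrow> bool" where
  "attractor k F K \<longleftrightarrow> compact K \<and> K \<noteq> {} \<and> K = (\<Union>i<k. F i ` K)"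

definition standard_bernoulli_measure ::
    "nat \<Rightarrow> (nat \<Rightarrow> 'a \<Rightarrow> 'a) \<Rightarrow> 'a::topological_space set \<Rightarrow> 'a measure \<Rightarrow> bool" where
  "standard_bernoulli_measure k F K \<mu> \<longleftrightarrow>
     prob_space \<mu> \<and> space \<mu> = K \<and> sets \<mu> = sets (restrict_space borel K) \<and>
     (\<forall>A\<in>sets \<mu>. measure \<mu> A = (1 / real k) * (\<Sum>i<k. measure \<mu> (F i -` A \<inter> K)))"

definition simplex_matrix :: "nat \<Rightarrow> nat \<Rightarrow> nat \<Rightarrow> real" where
  "simplex_matrix k i j = (if i = j then - (real k - 1) else 1)"

text \<open>The level \<open>m\<close> energy takes a function on the whole space but depends only on its
  restriction to \<open>V\<^sub>m\<close>, where \<open>V\<^sub>0 = p ` {..<k}\<close> and \<open>V\<^sub>m\<^sub>+\<^sub>1 = (\<Union>i<k. F i ` V\<^sub>m)\<close>; these sets are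
  contained in the attractor.\<close>

fun level_energy ::
    "nat \<Rightarrow> (nat \<Rightarrow> 'a) \<Rightarrow> (nat \<Rightarrow> 'a \<Rightarrow> 'a) \<Rightarrow> (nat \<Rightarrow> nat \<Rightarrow> real) \<Rightarrow> real \<Rightarrow>
     nat \<Rightarrow> ('a \<Rightarrow> real) \<Rightarrow> real" where
  "level_energy k p F D r 0 u = - (\<Sum>i<k. \<Sum>j<k. u (p i) * D i j * u (p j))"
| "level_energy k p F D r (Suc m) u = inverse r * (\<Sum>i<k. level_energy k p F D r m (u \<circ> F i))"

definition energy ::
    "nat \<Rightarrow> (nat \<Rightarrow> 'a) \<Rightarrow> (nat \<Rightarrow> 'a \<Rightarrow> 'a) \<Rightarrow> (nat \<Rightarrow> nat \<Rightarrow> real) \<Rightarrow> real \<Rightarrow>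
     ('a \<Rightarrow> real) \<Rightarrow> ereal" where
  "energy k p F D r u = lim (\<lambda>m. ereal (level_energy k p F D r m u))"

definition form_domain ::
    "'a::topological_space set \<Rightarrow> (('a \<Rightarrow> real) \<Rightarrow> ereal) \<Rightarrow> ('a \<Rightarrow> real) set" where
  "form_domain K Q = {u. continuous_on K u \<and> Q u < \<infinity>}"

definition polarization ::
    "(('a \<Rightarrow> real) \<Rightarrow> ereal) \<Rightarrow> ('a \<Rightarrow> real) \<Rightarrow> ('a \<Rightarrow> real) \<Rightarrow> real" where
  "polarization Q u v =
     (real_of_ereal (Q (\<lambda>x. u x + v x)) - real_of_ereal (Q (\<lambda>x. u x - v x))) / 4"

definition L2_functions :: "'a measure \<Rightarrow> ('a \<Rightarrow> real) set" where
  "L2_functions M = {f \<in> borel_measurable M. integrable M (\<lambda>x. (f x)\<^sup>2)}"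

text \<open>The graph of the self-adjoint operator \<open>A\<close> on \<open>L\<^sup>2(M)\<close> associated with a form \<open>Q\<close> on the
  domain \<open>W\<close>: \<open>u\<close> lies in the domain of \<open>A\<close> and \<open>A u = f\<close> iff \<open>u\<close> lies in \<open>W\<close> and
  \<open>Q(u,v) = \<langle>f,v\<rangle>\<close> for all \<open>v\<close> in \<open>W\<close>. Elements of \<open>L\<^sup>2(M)\<close> are represented by functions, so
  \<open>u\<close> lies in \<open>W\<close> iff it agrees almost everywhere with some \<open>w \<in> W\<close>.\<close>

definition form_operator ::
    "'a measure \<Rightarrow> ('a \<Rightarrow> real) set \<Rightarrow> (('a \<Rightarrow> real) \<Rightarrow> ereal) \<Rightarrow>
     (('a \<Rightarrow> real) \<times> ('a \<Rightarrow> real)) set" where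
  "form_operator M W Q =
     {(u, f). u \<in> L2_functions M \<and> f \<in> L2_functions M \<and>
        (\<exists>w\<in>W. (AE x in M. u x = w x) \<and>
           (\<forall>v\<in>W. polarization Q w v = (LINT x|M. f x * v x)))}"

definition L2_independent :: "'a measure \<Rightarrow> nat \<Rightarrow> (nat \<Rightarrow> 'a \<Rightarrow> real) \<Rightarrow> bool" where
  "L2_independent M n u \<longleftrightarrow>
     (\<forall>c. (AE x in M. (\<Sum>i<n. c i * u i x) = 0) \<longrightarrow> (\<forall>i<n. c i = (0::real)))"

text \<open>The multiplicity of \<open>l\<close> is the dimension of its eigenspace in \<open>L\<^sup>2(M)\<close>; it is \<open>0\<close> iff \<open>l\<close> is not
  an eigenvalue.\<close>

definition eigen_multiplicity ::
    "'a measure \<Rightarrow> (('a \<Rightarrow> real) \<times> ('a \<Rightarrow> real)) set \<Rightarrow> real \<Rightarrow> enat" where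
  "eigen_multiplicity M A l =
     Sup {enat n | n. \<exists>u. L2_independent M n u \<and> (\<forall>i<n. (u i, \<lambda>x. l * u i x) \<in> A)}"

definition eigenvalue_count ::
    "'a measure \<Rightarrow> (('a \<Rightarrow> real) \<times> ('a \<Rightarrow> real)) set \<Rightarrow> real \<Rightarrow> ennreal" where
  "eigenvalue_count M A x = (\<Sum>\<^sub>\<infinity>l\<in>{..x}. ennreal_of_enat (eigen_multiplicity M A l))"

definition is_spectral_dimension :: "(real \<Rightarrow> ennreal) \<Rightarrow> real \<Rightarrow> bool" where
  "is_spectral_dimension \<rho> d \<longleftrightarrow>
     0 < Liminf at_top (\<lambda>x. \<rho> x * ennreal (x powr (- d / 2))) \<and>
     Liminf at_top (\<lambda>x. \<rho> x * ennreal (x powr (- d / 2)))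
       \<le> Limsup at_top (\<lambda>x. \<rho> x * ennreal (x powr (- d / 2))) \<and>
     Limsup at_top (\<lambda>x. \<rho> x * ennreal (x powr (- d / 2))) < \<infinity>"

end

theory Submission
  imports Defs "HOL-Complex_Analysis.Great_Picard" "HOL-Real_Asymp.Real_Asymp"
begin

text \<open>
  Write \<open>E\<^sub>m\<close> for the level \<open>m\<close> energy and \<open>b = k / r = (k\<^sup>2 - k - 1) / (k - 2)\<close>. Copying
  a function into a cell of level \<open>m\<close> divides its integral by \<open>k\<^sup>m\<close> and its energy by \<open>r\<^sup>m\<close>, so its Rayleigh
  quotient is multiplied by \<open>b\<^sup>m\<close>; there are \<open>k\<^sup>m\<close> such cells. There are positive constants
  \<open>R\<close> and \<open>c\<close> such that at least \<open>k\<^sup>m\<close> eigenvalues are at most \<open>R b\<^sup>m\<close>, and at most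
  \<open>k\<^sup>m\<close> eigenvalues are at most \<open>x\<close> when \<open>c x < b\<^sup>m\<close>. Since \<open>k\<^sup>m = (b\<^sup>m)\<^sup>s\<close> with \<open>s = log k / log b\<close>,
  the counting function lies between two multiples of \<open>x\<^sup>s\<close>, and \<open>2 s\<close> is the only spectral
  dimension (\<open>spectral_dimension_iff\<close>).

  Geometry enters through one fact: in barycentric coordinates two distinct cells meet only in common images
  of vertices (\<open>cells_meet\<close>). Hence continuous functions on the cells that agree at these points
  can be glued. That fact and a few topological properties of the maps \<open>F i\<close> make up the locale
  \<open>glued_cells\<close>, in which the analysis takes place.

  The value of \<open>r\<close> is the one for which the minimum of \<open>E\<^sub>1\<close> over all extensions of a function on the
  vertices is \<open>E\<^sub>0\<close>; completing a square makes this explicit (\<open>cell_form_sum\<close>). It follows that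
  \<open>E\<^sub>m u\<close> increases with \<open>m\<close>, and, as \<open>r < 1\<close>, that a function of finite energy oscillates
  by at most a constant times the square root of its energy (\<open>oscillation_bound\<close>).

  Few small eigenvalues: if more than \<open>k\<^sup>m\<close> independent eigenfunctions have eigenvalue at most \<open>x\<close>,
  some combination \<open>u\<close> of them is nonzero and vanishes at one chosen point of each cell of level \<open>m\<close>. The
  oscillation bound in every cell gives \<open>b\<^sup>m \<parallel>u\<parallel>\<^sup>2 \<le> c E(u)\<close>, while orthogonality of the eigenspaces gives
  \<open>E(u) \<le> x \<parallel>u\<parallel>\<^sup>2\<close> (\<open>eigenfunction_count_bound\<close>).

  Many small eigenvalues: harmonic functions, obtained by iterating the minimising extension, are glued
  to a nonzero function of finite energy that vanishes at all vertices. Copies of it in the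
  cells of level \<open>m\<close> span a space of dimension \<open>k\<^sup>m\<close> on which \<open>E(u) = R b\<^sup>m \<parallel>u\<parallel>\<^sup>2\<close>. Eigenfunctions are then
  produced one after the other, each as a minimiser of the energy on the unit sphere of the
  orthogonal complement of those already found (\<open>orthonormal_eigenfunctions\<close>); minimisers exist because sets
  of bounded energy are equicontinuous, so that the theorem of Arzela and Ascoli applies.
\<close>

section \<open>Linear systems and words\<close>

text \<open>Gaussian elimination: an equation with a nonzero coefficient is solved for one unknown and substituted into the others.\<close>

lemma homogeneous_system_nontrivial_solution:
  fixes f :: "'j \<Rightarrow> 'i \<Rightarrow> real"
  assumes "finite J" "finite I" "card J < card I"
  shows "\<exists>c. (\<exists>i\<in>I. c i \<noteq> 0) \<and> (\<forall>j\<in>J. (\<Sum>i\<in>I. c i * f j i) = 0)"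
  using assms
proof (induction J arbitrary: I f rule: finite_induct)
  case empty
  then have "I \<noteq> {}" by auto
  then show ?case by (intro exI[of _ "\<lambda>_. 1"]) auto
next
  case (insert j0 J)
  show ?case
  proof (cases "\<forall>i\<in>I. f j0 i = 0")
    case True
    have "card J < card I" using insert by simp
    then obtain c where "\<exists>i\<in>I. c i \<noteq> 0" "\<forall>j\<in>J. (\<Sum>i\<in>I. c i * f j i) = 0"
      using insert.IH[of I f] insert.prems by blast
    with True show ?thesis by (intro exI[of _ c]) auto
  next
    case False
    then obtain i0 where i0: "i0 \<in> I" "f j0 i0 \<noteq> 0" by blast
    define g where "g j i = f j i - f j i0 * f j0 i / f j0 i0" for j i
    have "card J < card (I - {i0})" using insert i0 by simp
    then obtain c where c: "\<exists>i\<in>I-{i0}. c i \<noteq> 0" "\<forall>j\<in>J. (\<Sum>i\<in>I-{i0}. c i * g j i) = 0"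
      using insert.IH[of "I - {i0}" g] insert.prems by blast
    define s where "s = (\<Sum>i\<in>I-{i0}. c i * f j0 i)"
    define c' where "c' i = (if i = i0 then - s / f j0 i0 else c i)" for i
    have split: "(\<Sum>i\<in>I. c' i * f j i) = - s / f j0 i0 * f j i0 + (\<Sum>i\<in>I-{i0}. c i * f j i)" for j
    proof -
      have "(\<Sum>i\<in>I. c' i * f j i) = c' i0 * f j i0 + (\<Sum>i\<in>I-{i0}. c' i * f j i)"
        using i0 insert.prems by (simp add: sum.remove)
      also have "(\<Sum>i\<in>I-{i0}. c' i * f j i) = (\<Sum>i\<in>I-{i0}. c i * f j i)"
        by (rule sum.cong) (auto simp: c'_def)
      finally show ?thesis by (simp add: c'_def)
    qed
    have "(\<Sum>i\<in>I. c' i * f j i) = 0" if "j \<in> insert j0 J" for j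
    proof (cases "j = j0")
      case True
      then show ?thesis using i0 by (simp add: split s_def)
    next
      case False
      then have "0 = (\<Sum>i\<in>I-{i0}. c i * g j i)" using that c by simp
      also have "\<dots> = (\<Sum>i\<in>I-{i0}. c i * f j i) - (\<Sum>i\<in>I-{i0}. f j i0 / f j0 i0 * (c i * f j0 i))"
        by (simp add: g_def algebra_simps sum_subtractf)
      also have "(\<Sum>i\<in>I-{i0}. f j i0 / f j0 i0 * (c i * f j0 i)) = f j i0 / f j0 i0 * s"
        by (simp add: s_def sum_distrib_left)
      finally show ?thesis by (simp add: split)
    qed
    moreover have "\<exists>i\<in>I. c' i \<noteq> 0"
      using c by (auto simp: c'_def)
    ultimately show ?thesis by blast
  qed
qed

definition words :: "nat \<Rightarrow> nat \<Rightarrow> nat list set" where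
  "words k m = {w. length w = m \<and> set w \<subseteq> {..<k}}"

lemma words_0 [simp]: "words k 0 = {[]}"
  by (auto simp: words_def)

lemma words_Suc: "words k (Suc m) = (\<Union>i<k. (#) i ` words k m)"
  by (auto simp: words_def length_Suc_conv)

lemma finite_words [simp]: "finite (words k m)"
  by (induction m) (auto simp: words_Suc)

lemma sum_words_Suc:
  fixes g :: "nat list \<Rightarrow> 'b::comm_monoid_add"
  shows "(\<Sum>w\<in>words k (Suc m). g w) = (\<Sum>i<k. \<Sum>w\<in>words k m. g (i # w))"
  unfolding words_Suc
  by (subst sum.UNION_disjoint) (auto simp: sum.reindex)

lemma card_words: "card (words k m) = k ^ m"
proof (induction m)
  case (Suc m)
  have "card (words k (Suc m)) = (\<Sum>i<k. \<Sum>w\<in>words k m. 1)"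
    unfolding card_eq_sum sum_words_Suc ..
  then show ?case using Suc by simp
qed simp

fun cell :: "(nat \<Rightarrow> 'a \<Rightarrow> 'a) \<Rightarrow> nat list \<Rightarrow> 'a \<Rightarrow> 'a" where
  "cell F [] = id"
| "cell F (i # w) = F i \<circ> cell F w"

section \<open>Barycentric coordinates and the position of the cells\<close>

text \<open>The affinely independent vertices span the whole space, so these coordinates exist and are unique; the choice
  operator returns them.\<close>

definition bary :: "nat \<Rightarrow> (nat \<Rightarrow> 'a::real_vector) \<Rightarrow> 'a \<Rightarrow> nat \<Rightarrow> real" where
  "bary k p x = (SOME u. (\<Sum>j<k. u j) = 1 \<and> (\<Sum>j<k. u j *\<^sub>R p j) = x)"

locale simplex_attractor =
  fixes k :: nat and p :: "nat \<Rightarrow> 'a::euclidean_space" and F :: "nat \<Rightarrow> 'a \<Rightarrow> 'a" and K :: "'a set"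
  assumes k3: "3 \<le> k"
    and dim: "DIM('a) = k - 1"
    and simplex: "regular_simplex_vertices k p"
    and maps: "cell_maps k p F"
    and attr: "attractor k F K"
begin

abbreviation \<beta> :: "'a \<Rightarrow> nat \<Rightarrow> real" where "\<beta> \<equiv> bary k p"

lemma inj_p: "inj_on p {..<k}" and indep: "\<not> affine_dependent (p ` {..<k})"
  using simplex by (auto simp: regular_simplex_vertices_def)

lemma null_combination:
  assumes "(\<Sum>j<k. u j) = 0" "(\<Sum>j<k. u j *\<^sub>R p j) = 0" "j < k"
  shows "u j = 0"
proof (rule ccontr)
  assume nz: "u j \<noteq> 0"
  define U where "U v = u (the_inv_into {..<k} p v)" for v
  have U: "U (p i) = u i" if "i < k" for i
    using that inj_p by (simp add: U_def the_inv_into_f_f)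
  have "sum U (p ` {..<k}) = 0" "(\<Sum>v\<in>p ` {..<k}. U v *\<^sub>R v) = 0"
    using assms inj_p by (simp_all add: sum.reindex U)
  moreover have "\<exists>v\<in>p ` {..<k}. U v \<noteq> 0"
    using nz assms(3) U by auto
  ultimately show False
    using indep affine_dependent_explicit_finite[of "p ` {..<k}"] by blast
qed

lemma bary_exists: "\<exists>u. (\<Sum>j<k. u j) = 1 \<and> (\<Sum>j<k. u j *\<^sub>R p j) = x"
proof -
  have "int (card (p ` {..<k})) = aff_dim (p ` {..<k}) + 1"
    using aff_dim_affine_independent[OF indep] by simp
  then have "aff_dim (p ` {..<k}) = DIM('a)"
    using dim k3 card_image[OF inj_p] by auto
  then have "x \<in> affine hull (p ` {..<k})"
    by (simp add: aff_dim_eq_full)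
  then obtain U where "sum U (p ` {..<k}) = 1" "(\<Sum>v\<in>p ` {..<k}. U v *\<^sub>R v) = x"
    by (auto simp: affine_hull_finite)
  then show ?thesis
    using inj_p by (intro exI[of _ "U \<circ> p"]) (simp add: sum.reindex)
qed

lemma bary_sum: "(\<Sum>j<k. \<beta> x j) = 1" and bary_combination: "(\<Sum>j<k. \<beta> x j *\<^sub>R p j) = x"
  using someI_ex[OF bary_exists[of x]] by (auto simp: bary_def)

lemma bary_unique:
  assumes "(\<Sum>j<k. u j) = 1" "(\<Sum>j<k. u j *\<^sub>R p j) = x" "j < k"
  shows "\<beta> x j = u j"
proof -
  have "\<beta> x j - u j = 0"
    by (rule null_combination)
      (use assms in \<open>simp_all add: sum_subtractf bary_sum scaleR_left_diff_distrib bary_combination\<close>)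
  then show ?thesis by simp
qed

lemma bary_vertex:
  assumes "i < k" "j < k"
  shows "\<beta> (p i) j = (if j = i then 1 else 0)"
  using assms by (intro bary_unique) (simp_all add: if_distrib [of "\<lambda>c. c *\<^sub>R _"] cong: if_cong)

lemma bary_eqI:
  assumes "\<And>j. j < k \<Longrightarrow> \<beta> x j = \<beta> y j"
  shows "x = y"
proof -
  have "(\<Sum>j<k. \<beta> x j *\<^sub>R p j) = (\<Sum>j<k. \<beta> y j *\<^sub>R p j)"
    by (rule sum.cong) (simp_all add: assms)
  then show ?thesis by (simp only: bary_combination)
qed

lemma continuous_on_bary:
  assumes "j < k"
  shows "continuous_on A (\<lambda>x. \<beta> x j)"
proof -
  have "linear (\<lambda>x. \<beta> x j - \<beta> 0 j)"
  proof (rule linearI)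
    fix x y :: 'a
    have "\<beta> (x + y) j = \<beta> x j + \<beta> y j - \<beta> 0 j"
      by (rule bary_unique)
        (use assms in \<open>simp_all add: algebra_simps sum.distrib sum_subtractf bary_sum bary_combination\<close>)
    then show "\<beta> (x + y) j - \<beta> 0 j = (\<beta> x j - \<beta> 0 j) + (\<beta> y j - \<beta> 0 j)" by simp
  next
    fix c and x :: 'a
    have "\<beta> (c *\<^sub>R x) j = c * \<beta> x j + (1 - c) * \<beta> 0 j"
    proof (rule bary_unique)
      show "(\<Sum>j<k. c * \<beta> x j + (1 - c) * \<beta> 0 j) = 1"
        by (simp add: sum.distrib bary_sum flip: sum_distrib_left)
      have "(\<Sum>j<k. (c * \<beta> x j + (1 - c) * \<beta> 0 j) *\<^sub>R p j)
        = c *\<^sub>R (\<Sum>j<k. \<beta> x j *\<^sub>R p j) + (1 - c) *\<^sub>R (\<Sum>j<k. \<beta> 0 j *\<^sub>R p j)"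
        by (simp only: scaleR_left_distrib sum.distrib scaleR_sum_right scaleR_scaleR)
      then show "(\<Sum>j<k. (c * \<beta> x j + (1 - c) * \<beta> 0 j) *\<^sub>R p j) = c *\<^sub>R x"
        by (simp add: bary_combination)
    qed (use assms in simp)
    then show "\<beta> (c *\<^sub>R x) j - \<beta> 0 j = c *\<^sub>R (\<beta> x j - \<beta> 0 j)" by (simp add: algebra_simps)
  qed
  then have "continuous_on A (\<lambda>x. (\<beta> x j - \<beta> 0 j) + \<beta> 0 j)"
    by (intro continuous_intros linear_continuous_on) (simp add: linear_conv_bounded_linear)
  then show ?thesis by simp
qed

lemma cell_map_bary:
  assumes i: "i < k" and l: "l < k"
  shows "\<beta> (F i x) l =
    (1 - \<beta> x i - \<beta> x l) / (real k - 1) + (if l = i then real k * \<beta> x i / (real k - 1) else 0)"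
proof -
  define P where "P = (\<Sum>j<k. p j)"
  have kpos: "real k - 1 > 0" using k3 by simp
  have aff: "affine_map (F i)" and fixp: "F i (p i) = p i"
    and Fp: "\<And>j. j < k \<Longrightarrow> j \<noteq> i \<Longrightarrow> F i (p j) = opposite_barycenter k p j"
    using maps i by (auto simp: cell_maps_def)
  obtain g c where g: "linear g" "\<And>x. F i x = g x + c"
    using aff by (auto simp: affine_map_def)
  have bc: "opposite_barycenter k p j = (1 / (real k - 1)) *\<^sub>R (P - p j)" if "j < k" for j
    using that by (simp add: opposite_barycenter_def P_def sum_diff1)
  have "F i x = (\<Sum>j<k. \<beta> x j *\<^sub>R F i (p j))"
  proof -
    have "F i x = g (\<Sum>j<k. \<beta> x j *\<^sub>R p j) + (\<Sum>j<k. \<beta> x j) *\<^sub>R c"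
      by (simp add: g bary_sum bary_combination)
    also have "\<dots> = (\<Sum>j<k. \<beta> x j *\<^sub>R F i (p j))"
      by (simp add: g linear_sum linear_scale scaleR_right_distrib sum.distrib scaleR_sum_left)
    finally show ?thesis .
  qed
  also have "\<dots> = \<beta> x i *\<^sub>R p i + (\<Sum>j\<in>{..<k}-{i}. \<beta> x j *\<^sub>R F i (p j))"
    using i by (simp add: sum.remove fixp)
  also have "(\<Sum>j\<in>{..<k}-{i}. \<beta> x j *\<^sub>R F i (p j))
      = (1 / (real k - 1)) *\<^sub>R ((\<Sum>j\<in>{..<k}-{i}. \<beta> x j) *\<^sub>R P - (\<Sum>j\<in>{..<k}-{i}. \<beta> x j *\<^sub>R p j))"
    by (simp add: Fp bc scaleR_sum_left scaleR_sum_right scaleR_right_diff_distrib sum_subtractf mult.commute)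
  also have "(\<Sum>j\<in>{..<k}-{i}. \<beta> x j) = 1 - \<beta> x i"
    using i by (simp add: sum_diff1 bary_sum)
  also have "(\<Sum>j\<in>{..<k}-{i}. \<beta> x j *\<^sub>R p j) = x - \<beta> x i *\<^sub>R p i"
    using i by (simp add: sum_diff1 bary_combination)
  finally have Fx: "F i x = \<beta> x i *\<^sub>R p i
      + (1 / (real k - 1)) *\<^sub>R ((1 - \<beta> x i) *\<^sub>R P - (x - \<beta> x i *\<^sub>R p i))" .
  show ?thesis
  proof (rule bary_unique)
    have "(\<Sum>j<k. (1 - \<beta> x i - \<beta> x j) / (real k - 1)) = (real k * (1 - \<beta> x i) - 1) / (real k - 1)"
      by (simp add: sum_subtractf bary_sum flip: sum_divide_distrib)
    then have "(\<Sum>j<k. (1 - \<beta> x i - \<beta> x j) / (real k - 1)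
        + (if j = i then real k * \<beta> x i / (real k - 1) else 0))
      = (real k * (1 - \<beta> x i) - 1) / (real k - 1) + real k * \<beta> x i / (real k - 1)"
      using i by (simp only: sum.distrib) simp
    also have "\<dots> = ((real k * (1 - \<beta> x i) - 1) + real k * \<beta> x i) / (real k - 1)"
      by (rule add_divide_distrib[symmetric])
    also have "\<dots> = 1" using kpos by (simp add: algebra_simps)
    finally show "(\<Sum>j<k. (1 - \<beta> x i - \<beta> x j) / (real k - 1)
        + (if j = i then real k * \<beta> x i / (real k - 1) else 0)) = 1" .
    have "(\<Sum>j<k. ((1 - \<beta> x i - \<beta> x j) / (real k - 1)
        + (if j = i then real k * \<beta> x i / (real k - 1) else 0)) *\<^sub>R p j)
      = (\<Sum>j<k. ((1 - \<beta> x i) / (real k - 1)) *\<^sub>R p j) - (\<Sum>j<k. (1 / (real k - 1)) *\<^sub>R (\<beta> x j *\<^sub>R p j))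
        + (\<Sum>j<k. (if j = i then (real k * \<beta> x i / (real k - 1)) *\<^sub>R p j else 0))"
      by (simp only: sum.distrib[symmetric] sum_subtractf[symmetric])
        (rule sum.cong, auto simp: diff_divide_distrib scaleR_left_diff_distrib scaleR_left_distrib)
    also have "\<dots> = ((1 - \<beta> x i) / (real k - 1)) *\<^sub>R P - (1 / (real k - 1)) *\<^sub>R x
        + (real k * \<beta> x i / (real k - 1)) *\<^sub>R p i"
      using i by (simp add: P_def bary_combination scaleR_sum_right[symmetric] del: scaleR_scaleR)
    also have "\<dots> = F i x"
    proof -
      have "real k * \<beta> x i / (real k - 1) = \<beta> x i + \<beta> x i / (real k - 1)"
        using kpos by (simp add: field_simps)
      then show ?thesis
        by (simp add: Fx scaleR_right_diff_distrib scaleR_left_distrib)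
    qed
    finally show "(\<Sum>j<k. ((1 - \<beta> x i - \<beta> x j) / (real k - 1)
        + (if j = i then real k * \<beta> x i / (real k - 1) else 0)) *\<^sub>R p j) = F i x" .
  qed (rule l)
qed

lemma cell_map_bary_self: "i < k \<Longrightarrow> \<beta> (F i x) i = (1 + (real k - 2) * \<beta> x i) / (real k - 1)"
  by (simp add: cell_map_bary add_divide_distrib[symmetric] algebra_simps)

lemma cell_map_bary_other:
  "i < k \<Longrightarrow> l < k \<Longrightarrow> l \<noteq> i \<Longrightarrow> \<beta> (F i x) l = (1 - \<beta> x i - \<beta> x l) / (real k - 1)"
  by (simp add: cell_map_bary)

lemma K_compact: "compact K" and K_nonempty: "K \<noteq> {}" and K_cover: "K = (\<Union>i<k. F i ` K)"
  using attr by (auto simp: attractor_def)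

lemma F_in_K: "i < k \<Longrightarrow> x \<in> K \<Longrightarrow> F i x \<in> K"
  using K_cover by blast

lemma continuous_on_F: "i < k \<Longrightarrow> continuous_on A (F i)"
proof -
  assume "i < k"
  then have "affine_map (F i)" using maps by (auto simp: cell_maps_def)
  then obtain g c where g: "linear g" "F i = (\<lambda>x. g x + c)"
    by (auto simp: affine_map_def)
  then have "continuous_on A g"
    by (simp add: linear_continuous_on linear_conv_bounded_linear)
  then show ?thesis by (auto simp: g intro!: continuous_intros)
qed

text \<open>The attractor lies in the simplex. Let \<open>m\<close> be the least coordinate of all points of \<open>K\<close>, attained at
  \<open>F i y\<close> with \<open>y \<in> K\<close>. The formulas for the coordinates of \<open>F i y\<close> and \<open>m \<le> \<beta> y j\<close> give \<open>(k - 1) m \<ge> (k - 2) m\<close>,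
  hence \<open>m \<ge> 0\<close>.\<close>

lemma bary_nonneg:
  assumes x: "x \<in> K" and j: "j < k"
  shows "0 \<le> \<beta> x j"
proof (rule ccontr)
  assume neg: "\<not> 0 \<le> \<beta> x j"
  have kpos: "real k - 1 > 0" "real k \<ge> 3" using k3 by simp_all
  have "\<exists>z\<in>K. \<forall>y\<in>K. \<beta> z l \<le> \<beta> y l" if "l < k" for l
    using that by (intro continuous_attains_inf K_compact K_nonempty continuous_on_bary)
  then obtain z where z: "\<And>l. l < k \<Longrightarrow> z l \<in> K" "\<And>l y. l < k \<Longrightarrow> y \<in> K \<Longrightarrow> \<beta> (z l) l \<le> \<beta> y l"
    by metis
  (* an index whose coordinate attains the overall minimum *)
  define l where "l = arg_min_on (\<lambda>l. \<beta> (z l) l) {..<k}"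
  have l: "l < k" "\<And>m. m < k \<Longrightarrow> \<beta> (z l) l \<le> \<beta> (z m) m"
    using arg_min_if_finite[of "{..<k}" "\<lambda>l. \<beta> (z l) l"] k3 unfolding l_def
    by (auto simp: not_less[symmetric] lessThan_empty_iff)
  define m where "m = \<beta> (z l) l"
  have least: "m \<le> \<beta> y i" if "i < k" "y \<in> K" for i y
    using l(2)[OF that(1)] z(2)[OF that] by (simp add: m_def)
  have m: "m < 0" using least[OF j x] neg by simp
  obtain i y where iy: "i < k" "y \<in> K" "z l = F i y"
    using z(1)[OF l(1)] K_cover by blast
  show False
  proof (cases "l = i")
    case True
    then have "m = (1 + (real k - 2) * \<beta> y i) / (real k - 1)"
      using iy l(1) by (simp add: m_def cell_map_bary_self)
    moreover have "(real k - 2) * \<beta> y i \<ge> (real k - 2) * m"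
      using least iy kpos by (intro mult_left_mono) auto
    ultimately have "(real k - 1) * m \<ge> 1 + (real k - 2) * m" using kpos by simp
    then show False using m by (simp add: algebra_simps)
  next
    case False
    have "1 = (\<Sum>j\<in>{..<k} - {i} - {l}. \<beta> y j) + \<beta> y i + \<beta> y l"
      using bary_sum[of y] iy l(1) False by (simp add: sum_diff1)
    moreover have "(\<Sum>j\<in>{..<k} - {i} - {l}. \<beta> y j) \<ge> of_nat (card ({..<k} - {i} - {l})) * m"
      using least iy by (intro sum_bounded_below) auto
    moreover have "real (card ({..<k} - {i} - {l})) = real k - 2"
      using iy l(1) False k3 by simp
    ultimately have "1 - \<beta> y i - \<beta> y l \<ge> (real k - 2) * m" by simp
    moreover have "m = (1 - \<beta> y i - \<beta> y l) / (real k - 1)"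
      using iy l(1) False by (simp add: m_def cell_map_bary)
    ultimately have "(real k - 1) * m \<ge> (real k - 2) * m" using kpos by simp
    then show False using m by (simp add: algebra_simps)
  qed
qed

lemma eq_vertexI:
  assumes x: "x \<in> K" and j: "j < k" "\<beta> x j = 1"
  shows "x = p j"
proof (rule bary_eqI)
  fix l assume l: "l < k"
  have "(\<Sum>i\<in>{..<k}-{j}. \<beta> x i) = 0"
    using bary_sum[of x] j by (simp add: sum_diff1)
  then have "\<forall>i\<in>{..<k}-{j}. \<beta> x i = 0"
    using x bary_nonneg by (subst (asm) sum_nonneg_eq_0_iff) auto
  then show "\<beta> x l = \<beta> (p j) l"
    using l j by (auto simp: bary_vertex)
qed

text \<open>The attractor touches a face of codimension two only in vertices. If \<open>y = F s z\<close>, then \<open>\<beta> y s > 0\<close>, so \<open>s\<close> is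
  neither \<open>i\<close> nor \<open>l\<close>; the two vanishing coordinates read \<open>\<beta> z s + \<beta> z i = 1\<close> and \<open>\<beta> z s + \<beta> z l = 1\<close>,
  which leaves only \<open>z = p s\<close>.\<close>

lemma two_zero_coordinates:
  assumes y: "y \<in> K" and il: "i < k" "l < k" "i \<noteq> l" "\<beta> y i = 0" "\<beta> y l = 0"
  shows "\<exists>j<k. j \<noteq> i \<and> j \<noteq> l \<and> y = p j"
proof -
  have kpos: "real k - 1 > 0" "real k \<ge> 3" using k3 by simp_all
  obtain s z where s: "s < k" "z \<in> K" "y = F s z" using y K_cover by blast
  have "\<beta> y s > 0"
  proof -
    have "\<beta> y s = (1 + (real k - 2) * \<beta> z s) / (real k - 1)"
      using s by (simp add: cell_map_bary_self)
    moreover have "(real k - 2) * \<beta> z s \<ge> 0" using bary_nonneg s kpos by simp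
    ultimately show ?thesis using kpos by simp
  qed
  then have ne: "s \<noteq> i" "s \<noteq> l" using il by auto
  have "\<beta> z s + \<beta> z i = 1" "\<beta> z s + \<beta> z l = 1"
    using il s ne kpos by (auto simp: cell_map_bary)
  moreover have "\<beta> z s + \<beta> z i + \<beta> z l \<le> 1"
    using sum_mono2[of "{..<k}" "{s,i,l}" "\<beta> z"] il s ne bary_nonneg bary_sum[of z] by auto
  moreover have "\<beta> z i \<ge> 0" "\<beta> z l \<ge> 0" using bary_nonneg s il by auto
  ultimately have "\<beta> z s = 1" by linarith
  then have "z = p s" using s eq_vertexI by blast
  then have "y = p s" using s maps by (auto simp: cell_maps_def)
  then show ?thesis using s ne by blast
qed

text \<open>Comparing coordinates \<open>i\<close> and \<open>l\<close> on both sides forces these coordinates of \<open>y\<close> and \<open>z\<close> to vanish; the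
  remaining coordinates then agree, and the previous lemma applies.\<close>

lemma cells_meet:
  assumes "i < k" "l < k" "i \<noteq> l" "y \<in> K" "z \<in> K" "F i y = F l z"
  shows "\<exists>j<k. j \<noteq> i \<and> j \<noteq> l \<and> y = p j \<and> z = p j"
proof -
  have kpos: "real k - 1 > 0" "real k \<ge> 3" using k3 by simp_all
  have eq: "\<beta> (F i y) m = \<beta> (F l z) m" for m using assms by simp
  have nn: "\<beta> y i \<ge> 0" "\<beta> y l \<ge> 0" "\<beta> z i \<ge> 0" "\<beta> z l \<ge> 0"
    using assms bary_nonneg by auto
  have 1: "1 - \<beta> z l - \<beta> z i = 1 + (real k - 2) * \<beta> y i"
    using eq[of i] assms(1-3) kpos by (simp add: cell_map_bary_self cell_map_bary_other)
  have 2: "1 - \<beta> y i - \<beta> y l = 1 + (real k - 2) * \<beta> z l"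
    using eq[of l] assms(1-3) kpos by (simp add: cell_map_bary_self cell_map_bary_other)
  have "(real k - 2) * \<beta> y i \<ge> 0" "(real k - 2) * \<beta> z l \<ge> 0"
    using nn kpos by auto
  with 1 2 nn have z: "\<beta> y i = 0" "\<beta> y l = 0" "\<beta> z i = 0" "\<beta> z l = 0"
    by linarith+
  have "y = z"
  proof (rule bary_eqI)
    fix j assume j: "j < k"
    show "\<beta> y j = \<beta> z j"
      using eq[of j] assms(1-3) j kpos z by (cases "j = i \<or> j = l") (auto simp: cell_map_bary)
  qed
  then show ?thesis
    using two_zero_coordinates[of y i l] assms z by auto
qed

lemma inj_on_F:
  assumes i: "i < k"
  shows "inj_on (F i) K"
proof (rule inj_onI)
  fix x y assume "x \<in> K" "y \<in> K" "F i x = F i y"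
  then have eq: "\<beta> (F i x) m = \<beta> (F i y) m" for m by simp
  have kpos: "real k - 1 > 0" "real k \<ge> 3" using k3 by simp_all
  have "(real k - 2) * \<beta> x i = (real k - 2) * \<beta> y i"
    using eq[of i] i kpos by (simp add: cell_map_bary_self)
  then have xi: "\<beta> x i = \<beta> y i" using kpos by simp
  show "x = y"
  proof (rule bary_eqI)
    fix j assume j: "j < k"
    show "\<beta> x j = \<beta> y j"
      using eq[of j] i j kpos xi by (cases "j = i") (simp_all add: cell_map_bary_other)
  qed
qed

definition bary_gap :: "'a \<Rightarrow> 'a \<Rightarrow> real" where
  "bary_gap x y = (\<Sum>j<k. (\<beta> x j - \<beta> y j)\<^sup>2)"

text \<open>With \<open>z = \<beta> x - \<beta> y\<close>, whose entries sum to \<open>0\<close>, the coordinates of \<open>F i x\<close> and \<open>F i y\<close> have squared distance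
  \<open>((k\<^sup>2 - 3 k) (z i)\<^sup>2 + (\<Sum>j. (z j)\<^sup>2)) / (k - 1)\<^sup>2\<close>; bounding \<open>(z i)\<^sup>2\<close> by \<open>\<Sum>j. (z j)\<^sup>2\<close> gives the ratio.\<close>

definition contraction_ratio :: real where
  "contraction_ratio = ((real k)\<^sup>2 - 3 * real k + 1) / (real k - 1)\<^sup>2"

lemma contraction_ratio: "0 \<le> contraction_ratio" "contraction_ratio < 1"
proof -
  have k: "real k \<ge> 3" using k3 by simp
  then have "real k * real k \<ge> 3 * real k" by (intro mult_right_mono) auto
  then show "0 \<le> contraction_ratio"
    by (simp add: contraction_ratio_def power2_eq_square)
  show "contraction_ratio < 1"
    using k by (simp add: contraction_ratio_def divide_less_eq) (simp add: power2_eq_square algebra_simps)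
qed

lemma bary_gap_F:
  assumes i: "i < k"
  shows "bary_gap (F i x) (F i y) \<le> contraction_ratio * bary_gap x y"
proof -
  define z where "z j = \<beta> x j - \<beta> y j" for j
  have k: "real k \<ge> 3" "real k - 1 > 0" using k3 by simp_all
  have z0: "(\<Sum>j<k. z j) = 0" by (simp add: z_def sum_subtractf bary_sum)
  have d: "\<beta> (F i x) j - \<beta> (F i y) j = (- z i - z j + (if j = i then real k * z i else 0)) / (real k - 1)"
    if "j < k" for j
    using i that by (auto simp: cell_map_bary z_def diff_divide_distrib add_divide_distrib algebra_simps)
  have "bary_gap (F i x) (F i y)
      = (\<Sum>j<k. (- z i - z j + (if j = i then real k * z i else 0))\<^sup>2) / (real k - 1)\<^sup>2"
    by (simp add: bary_gap_def d power_divide sum_divide_distrib)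
  also have "(\<Sum>j<k. (- z i - z j + (if j = i then real k * z i else 0))\<^sup>2)
      = (\<Sum>j<k. (z i)\<^sup>2 + 2 * z i * z j + (z j)\<^sup>2 + (if j = i then ((real k)\<^sup>2 - 4 * real k) * (z i)\<^sup>2 else 0))"
    by (rule sum.cong) (auto simp: power2_eq_square algebra_simps)
  also have "\<dots> = ((real k)\<^sup>2 - 3 * real k) * (z i)\<^sup>2 + (\<Sum>j<k. (z j)\<^sup>2)"
    using i z0 by (simp add: sum.distrib flip: sum_distrib_left) (simp add: algebra_simps)
  also have "\<dots> \<le> ((real k)\<^sup>2 - 3 * real k) * (\<Sum>j<k. (z j)\<^sup>2) + (\<Sum>j<k. (z j)\<^sup>2)"
  proof -
    have "(z i)\<^sup>2 \<le> (\<Sum>j<k. (z j)\<^sup>2)"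
      using i by (intro member_le_sum) auto
    moreover have "0 \<le> (real k)\<^sup>2 - 3 * real k" using k by (simp add: power2_eq_square)
    ultimately show ?thesis by (simp add: mult_left_mono)
  qed
  finally show ?thesis
    using k by (simp add: contraction_ratio_def bary_gap_def z_def divide_right_mono distrib_right)
qed

lemma bary_gap_cell:
  "w \<in> words k n \<Longrightarrow> bary_gap (cell F w x) (cell F w y) \<le> contraction_ratio ^ n * bary_gap x y"
proof (induction n arbitrary: w)
  case (Suc n)
  then obtain i v where w: "w = i # v" "i < k" "v \<in> words k n" by (auto simp: words_Suc)
  have "bary_gap (cell F w x) (cell F w y) \<le> contraction_ratio * bary_gap (cell F v x) (cell F v y)"
    using w by (simp add: bary_gap_F)
  also have "\<dots> \<le> contraction_ratio * (contraction_ratio ^ n * bary_gap x y)"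
    using Suc.IH[OF w(3)] contraction_ratio by (intro mult_left_mono)
  finally show ?case by simp
qed simp

lemma dist_le_bary_gap: "dist x y \<le> (\<Sum>j<k. norm (p j)) * sqrt (bary_gap x y)"
proof -
  have "x - y = (\<Sum>j<k. (\<beta> x j - \<beta> y j) *\<^sub>R p j)"
    by (simp add: scaleR_left_diff_distrib sum_subtractf bary_combination)
  then have "dist x y \<le> (\<Sum>j<k. norm ((\<beta> x j - \<beta> y j) *\<^sub>R p j))"
    by (simp only: dist_norm norm_sum)
  also have "\<dots> \<le> (\<Sum>j<k. norm (p j) * sqrt (bary_gap x y))"
  proof (rule sum_mono)
    fix j assume "j \<in> {..<k}"
    then have "(\<beta> x j - \<beta> y j)\<^sup>2 \<le> bary_gap x y"
      unfolding bary_gap_def by (intro member_le_sum) auto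
    then have "\<bar>\<beta> x j - \<beta> y j\<bar> \<le> sqrt (bary_gap x y)"
      using real_le_rsqrt by fastforce
    then show "norm ((\<beta> x j - \<beta> y j) *\<^sub>R p j) \<le> norm (p j) * sqrt (bary_gap x y)"
      by (simp add: mult.commute mult_left_mono)
  qed
  finally show ?thesis by (simp add: sum_distrib_right)
qed

text \<open>The extra point \<open>z\<close> allows the lemma to be applied to a vertex before the vertices are known to lie
  in \<open>K\<close>.\<close>

lemma cells_shrink:
  assumes e: "0 < (e::real)"
  shows "\<exists>n. \<forall>w\<in>words k n. \<forall>x y. x \<in> insert z K \<longrightarrow> y \<in> insert z K \<longrightarrow> dist (cell F w x) (cell F w y) < e"
proof -
  have "compact ((insert z K) \<times> (insert z K))" using K_compact by (intro compact_Times) auto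
  moreover have "continuous_on ((insert z K) \<times> (insert z K)) (\<lambda>q. bary_gap (fst q) (snd q))"
    unfolding bary_gap_def
    by (intro continuous_intros continuous_on_compose2[OF continuous_on_bary[of _ UNIV]]) auto
  ultimately have "bounded ((\<lambda>q. bary_gap (fst q) (snd q)) ` ((insert z K) \<times> (insert z K)))"
    by (intro compact_imp_bounded compact_continuous_image)
  then obtain M where "\<forall>q\<in>insert z K \<times> insert z K. \<bar>bary_gap (fst q) (snd q)\<bar> \<le> M"
    by (auto simp: bounded_iff)
  then have M: "bary_gap x y \<le> M" if "x \<in> insert z K" "y \<in> insert z K" for x y
    using that by force
  define C where "C = (\<Sum>j<k. norm (p j))"
  have "C \<ge> 0" by (simp add: C_def sum_nonneg)
  have "(\<lambda>n. C * sqrt (contraction_ratio ^ n * M)) \<longlonglongrightarrow> C * sqrt (0 * M)"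
    using contraction_ratio by (intro tendsto_intros LIMSEQ_realpow_zero)
  then have "eventually (\<lambda>n. C * sqrt (contraction_ratio ^ n * M) < e) sequentially"
    using e by (auto intro: order_tendstoD)
  then obtain n where n: "C * sqrt (contraction_ratio ^ n * M) < e"
    by (auto simp: eventually_sequentially)
  have "dist (cell F w x) (cell F w y) < e"
    if "w \<in> words k n" "x \<in> insert z K" "y \<in> insert z K" for w x y
  proof -
    have "bary_gap (cell F w x) (cell F w y) \<le> contraction_ratio ^ n * M"
      using bary_gap_cell[OF that(1), of x y] M[OF that(2,3)] contraction_ratio
      by (meson mult_left_mono order_trans zero_le_power)
    then have "dist (cell F w x) (cell F w y) \<le> C * sqrt (contraction_ratio ^ n * M)"
      using dist_le_bary_gap[of "cell F w x" "cell F w y"] \<open>C \<ge> 0\<close>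
      unfolding C_def[symmetric] by (meson mult_left_mono order_trans real_sqrt_le_mono)
    with n show ?thesis by simp
  qed
  then show ?thesis by blast
qed

lemma cell_replicate_fixed: "i < k \<Longrightarrow> cell F (replicate n i) (p i) = p i"
  using maps by (induction n) (auto simp: cell_maps_def)

lemma cell_in_K: "w \<in> words k n \<Longrightarrow> x \<in> K \<Longrightarrow> cell F w x \<in> K"
  by (induction w arbitrary: n) (auto simp: words_def F_in_K)

text \<open>A vertex is the limit of the iterates under \<open>F i\<close> of an arbitrary point of \<open>K\<close>.\<close>

lemma vertex_in_K:
  assumes i: "i < k"
  shows "p i \<in> K"
proof -
  obtain x where x: "x \<in> K" using K_nonempty by blast
  have "\<exists>y\<in>K. dist y (p i) < e" if e: "0 < e" for e
  proof -
    obtain n where n: "\<forall>w\<in>words k n. \<forall>x y. x \<in> insert (p i) K \<longrightarrow> y \<in> insert (p i) K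
        \<longrightarrow> dist (cell F w x) (cell F w y) < e"
      using cells_shrink[OF e] by blast
    have w: "replicate n i \<in> words k n" using i by (auto simp: words_def)
    then have "dist (cell F (replicate n i) x) (cell F (replicate n i) (p i)) < e"
      using n x by blast
    then show ?thesis
      using cell_in_K[OF w x] i by (auto simp: cell_replicate_fixed)
  qed
  then show ?thesis
    using closed_approachable[OF compact_imp_closed[OF K_compact]] by blast
qed

end

section \<open>One refinement step of the energy\<close>

definition resistance_ratio :: "nat \<Rightarrow> real" where
  "resistance_ratio k = real k * (real k - 2) / ((real k)\<^sup>2 - real k - 1)"

definition simplex_form :: "nat \<Rightarrow> (nat \<Rightarrow> real) \<Rightarrow> real" where
  "simplex_form k a = real k * (\<Sum>i<k. (a i)\<^sup>2) - (\<Sum>i<k. a i)\<^sup>2"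

text \<open>The form is invariant under adding constants, so \<open>a j\<close> may be subtracted from all entries; then only \<open>k - 1\<close>
  entries are nonzero and the Cauchy-Schwarz inequality leaves \<open>\<Sum>l. (a l - a j)\<^sup>2\<close>.\<close>

lemma simplex_form_ge_gap:
  assumes "i < k" "j < k"
  shows "(a i - a j)\<^sup>2 \<le> simplex_form k a"
proof -
  define b where "b l = a l - a j" for l
  define c where "c = a j"
  have "(\<Sum>l<k. (b l)\<^sup>2) = (\<Sum>l<k. (a l)\<^sup>2 - 2 * c * a l + c\<^sup>2)"
    by (rule sum.cong) (auto simp: b_def c_def power2_eq_square algebra_simps)
  also have "\<dots> = (\<Sum>l<k. (a l)\<^sup>2) - 2 * c * (\<Sum>l<k. a l) + real k * c\<^sup>2"
    by (simp add: sum.distrib sum_subtractf flip: sum_distrib_left)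
  finally have "(\<Sum>l<k. (b l)\<^sup>2) = \<dots>" .
  moreover have "(\<Sum>l<k. b l) = (\<Sum>l<k. a l) - real k * c"
    by (simp add: b_def c_def sum_subtractf)
  ultimately have "simplex_form k a = simplex_form k b"
    unfolding simplex_form_def by algebra
  moreover have "(\<Sum>l<k. b l)\<^sup>2 \<le> (real k - 1) * (\<Sum>l<k. (b l)\<^sup>2)"
  proof -
    have "(\<Sum>l<k. b l)\<^sup>2 = (\<Sum>l\<in>{..<k}-{j}. b l)\<^sup>2"
      using assms by (simp add: sum_diff1 b_def)
    also have "\<dots> \<le> (\<Sum>l\<in>{..<k}-{j}. (b l)\<^sup>2) * card ({..<k}-{j})"
      by (rule sum_squared_le_sum_of_squares)
    also have "\<dots> = (real k - 1) * (\<Sum>l<k. (b l)\<^sup>2)"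
      using assms by (simp add: sum_diff1 b_def of_nat_diff)
    finally show ?thesis .
  qed
  moreover have "(b i)\<^sup>2 \<le> (\<Sum>l<k. (b l)\<^sup>2)"
    using assms by (intro member_le_sum) auto
  ultimately show ?thesis by (simp add: simplex_form_def b_def algebra_simps)
qed

lemma simplex_form_nonneg: "0 < k \<Longrightarrow> 0 \<le> simplex_form k a"
  using simplex_form_ge_gap[of 0 k 0 a] by simp

lemma resistance_denominator_pos: "3 \<le> k \<Longrightarrow> 0 < (real k)\<^sup>2 - real k - 1"
proof -
  assume "3 \<le> k"
  then have "real k \<ge> 3" by simp
  then have "real k * real k \<ge> 3 * real k" by (intro mult_right_mono) auto
  with \<open>real k \<ge> 3\<close> show ?thesis unfolding power2_eq_square by linarith
qed

lemma resistance_ratio_mult: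
  "3 \<le> k \<Longrightarrow> ((real k)\<^sup>2 - real k - 1) * resistance_ratio k = real k * (real k - 2)"
  using resistance_denominator_pos[of k] by (simp add: resistance_ratio_def)

lemma resistance_ratio_bounds:
  assumes "3 \<le> k"
  shows "0 < resistance_ratio k" "resistance_ratio k < 1"
  using resistance_denominator_pos[OF assms] assms
  by (simp_all add: resistance_ratio_def divide_less_eq) (simp add: power2_eq_square algebra_simps)

text \<open>The one-step energy as a function of the new values \<open>Q\<close> is \<open>r\<close> times the old energy plus a form in the
  deviations \<open>d\<close> of \<open>Q\<close> from the critical point \<open>Q j = ((k - 1) S - P j) / N\<close>. The second equation turns the
  negative term into a multiple of \<open>(\<Sum>j. d j)\<^sup>2\<close>.\<close>

lemma cell_form_sum:
  fixes P Q :: "nat \<Rightarrow> real"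
  assumes k: "3 \<le> k"
  defines "N \<equiv> (real k)\<^sup>2 - real k - 1" and "S \<equiv> \<Sum>i<k. P i"
  defines "d \<equiv> \<lambda>j. N * Q j - (real k - 1) * S + P j"
  shows "N * ((\<Sum>i<k. simplex_form k (\<lambda>j. if j = i then P j else Q j)) - resistance_ratio k * simplex_form k P)
    = (\<Sum>j<k. (d j)\<^sup>2) - (real k - 2) * N * ((\<Sum>j<k. Q j) - S)\<^sup>2"
    and "(\<Sum>j<k. d j) = N * ((\<Sum>j<k. Q j) - S)"
proof -
  define T P2 Q2 X where "T = (\<Sum>j<k. Q j)" and "P2 = (\<Sum>j<k. (P j)\<^sup>2)"
    and "Q2 = (\<Sum>j<k. (Q j)\<^sup>2)" and "X = (\<Sum>j<k. P j * Q j)"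
  have cell_form: "simplex_form k (\<lambda>j. if j = i then P j else Q j)
      = real k * (Q2 + (P i)\<^sup>2 - (Q i)\<^sup>2)
        - (T\<^sup>2 + (P i)\<^sup>2 + (Q i)\<^sup>2 + 2 * T * P i - 2 * T * Q i - 2 * (P i * Q i))" if "i < k" for i
  proof -
    have "(\<Sum>j<k. if j = i then P j else Q j) = T + P i - Q i"
      using that by (simp add: T_def sum.remove[of "{..<k}" i])
    moreover have "(\<Sum>j<k. (if j = i then P j else Q j)\<^sup>2) = Q2 + (P i)\<^sup>2 - (Q i)\<^sup>2"
      using that by (simp add: Q2_def sum.remove[of "{..<k}" i])
    ultimately show ?thesis
      unfolding simplex_form_def by (simp only:) (simp add: power2_eq_square algebra_simps)
  qed
  have sum: "(\<Sum>i<k. simplex_form k (\<lambda>j. if j = i then P j else Q j))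
      = real k * (real k * Q2 + P2 - Q2) - (real k * T\<^sup>2 + P2 + Q2 + 2 * T * S - 2 * T * T - 2 * X)"
    by (simp add: cell_form sum.distrib sum_subtractf flip: sum_distrib_left)
      (simp add: P2_def Q2_def X_def T_def S_def)
  have "(\<Sum>j<k. (d j)\<^sup>2) = (\<Sum>j<k. N\<^sup>2 * (Q j)\<^sup>2 + (P j)\<^sup>2 + ((real k - 1) * S)\<^sup>2 + 2 * N * (P j * Q j)
      - 2 * N * (real k - 1) * S * Q j - 2 * (real k - 1) * S * P j)"
    by (rule sum.cong) (auto simp: d_def power2_eq_square algebra_simps)
  also have "\<dots> = N\<^sup>2 * Q2 + P2 + real k * ((real k - 1) * S)\<^sup>2 + 2 * N * X
      - 2 * N * (real k - 1) * S * T - 2 * (real k - 1) * S * S"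
    by (simp add: sum.distrib sum_subtractf flip: sum_distrib_left)
      (simp add: P2_def Q2_def X_def T_def S_def)
  finally have dd: "(\<Sum>j<k. (d j)\<^sup>2) = \<dots>" .
  have Nr: "N * (resistance_ratio k * z) = real k * (real k - 2) * z" for z
    using resistance_ratio_mult[OF k] by (simp add: N_def)
  show "N * ((\<Sum>i<k. simplex_form k (\<lambda>j. if j = i then P j else Q j)) - resistance_ratio k * simplex_form k P)
    = (\<Sum>j<k. (d j)\<^sup>2) - (real k - 2) * N * ((\<Sum>j<k. Q j) - S)\<^sup>2"
    unfolding dd sum T_def[symmetric] right_diff_distrib Nr
    unfolding simplex_form_def P2_def[symmetric] S_def[symmetric] N_def
    by algebra
  have "(\<Sum>j<k. d j) = N * T - real k * ((real k - 1) * S) + S"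
    unfolding d_def by (simp add: sum.distrib sum_subtractf flip: sum_distrib_left) (simp add: T_def S_def)
  also have "\<dots> = N * (T - S)" by (simp add: N_def power2_eq_square algebra_simps)
  finally show "(\<Sum>j<k. d j) = N * ((\<Sum>j<k. Q j) - S)" by (simp add: T_def)
qed

text \<open>The form in the deviations is nonnegative: \<open>(\<Sum>j. d j)\<^sup>2 \<le> k (\<Sum>j. (d j)\<^sup>2)\<close>, and \<open>k (k - 2) \<le> N\<close>.\<close>

lemma cell_form_sum_ge:
  fixes P Q :: "nat \<Rightarrow> real"
  assumes k: "3 \<le> k"
  shows "resistance_ratio k * simplex_form k P \<le> (\<Sum>i<k. simplex_form k (\<lambda>j. if j = i then P j else Q j))"
proof -
  define N where "N = (real k)\<^sup>2 - real k - 1"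
  have N: "N > 0" using resistance_denominator_pos[OF k] by (simp add: N_def)
  define S where "S = (\<Sum>i<k. P i)"
  define d where "d j = N * Q j - (real k - 1) * S + P j" for j
  define D where "D = (\<Sum>j<k. Q j) - S"
  note id = cell_form_sum[OF k, where P = P and Q = Q, folded N_def, folded S_def, folded d_def D_def]
  have "(N * D)\<^sup>2 \<le> (\<Sum>j<k. (d j)\<^sup>2) * real k"
    using sum_squared_le_sum_of_squares[of d "{..<k}"] by (simp add: id(2))
  then have "(real k - 2) * (N * D)\<^sup>2 \<le> (real k - 2) * ((\<Sum>j<k. (d j)\<^sup>2) * real k)"
    using k by (intro mult_left_mono) auto
  also have "\<dots> = real k * (real k - 2) * (\<Sum>j<k. (d j)\<^sup>2)"
    by simp
  also have "\<dots> \<le> N * (\<Sum>j<k. (d j)\<^sup>2)"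
    using k by (intro mult_right_mono sum_nonneg) (auto simp: N_def power2_eq_square algebra_simps)
  finally have "N * ((\<Sum>j<k. (d j)\<^sup>2) - (real k - 2) * N * D\<^sup>2) \<ge> 0"
    by (simp add: power2_eq_square algebra_simps)
  then have "(\<Sum>j<k. (d j)\<^sup>2) - (real k - 2) * N * D\<^sup>2 \<ge> 0"
    using N by (simp add: zero_le_mult_iff)
  then have "N * ((\<Sum>i<k. simplex_form k (\<lambda>j. if j = i then P j else Q j)) - resistance_ratio k * simplex_form k P) \<ge> 0"
    using id(1) by simp
  then show ?thesis using N by (simp add: zero_le_mult_iff)
qed

text \<open>The vertex values in cell \<open>i\<close> of the energy minimising extension of the values \<open>a\<close>.\<close>

definition harmonic_step :: "nat \<Rightarrow> (nat \<Rightarrow> real) \<Rightarrow> nat \<Rightarrow> nat \<Rightarrow> real" where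
  "harmonic_step k a i j = (if j = i then a i
     else ((real k - 1) * (\<Sum>l<k. a l) - a j) / ((real k)\<^sup>2 - real k - 1))"

lemma cell_form_sum_harmonic:
  assumes k: "3 \<le> k"
  shows "(\<Sum>i<k. simplex_form k (harmonic_step k a i)) = resistance_ratio k * simplex_form k a"
proof -
  define N where "N = (real k)\<^sup>2 - real k - 1"
  have N: "N > 0" using resistance_denominator_pos[OF k] by (simp add: N_def)
  define S where "S = (\<Sum>i<k. a i)"
  define Q where "Q j = ((real k - 1) * S - a j) / N" for j
  have step: "harmonic_step k a i = (\<lambda>j. if j = i then a j else Q j)" for i
    by (rule ext) (simp add: harmonic_step_def Q_def S_def N_def)
  have d: "N * Q j - (real k - 1) * S + a j = 0" for j
    using N by (simp add: Q_def)
  note id = cell_form_sum[OF k, where P = a and Q = Q, folded N_def, folded S_def, unfolded d]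
  have "(\<Sum>j<k. Q j) - S = 0" using id(2) N by simp
  then have "N * ((\<Sum>i<k. simplex_form k (\<lambda>j. if j = i then a j else Q j)) - resistance_ratio k * simplex_form k a) = 0"
    unfolding id(1) by simp
  then show ?thesis using N by (simp add: step)
qed

section \<open>Functions of finite energy\<close>

text \<open>All that the analysis needs from the geometry. The assumption \<open>peak\<close> serves to start the construction of
  harmonic functions from a continuous function with prescribed vertex values.\<close>

locale glued_cells =
  fixes k :: nat and p :: "nat \<Rightarrow> 'a::euclidean_space" and F :: "nat \<Rightarrow> 'a \<Rightarrow> 'a" and K :: "'a set"
  assumes k3: "3 \<le> k"
    and K_compact: "compact K"
    and K_cover: "K = (\<Union>i<k. F i ` K)"
    and F_continuous: "i < k \<Longrightarrow> continuous_on K (F i)"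
    and F_inj: "i < k \<Longrightarrow> inj_on (F i) K"
    and vertex_in_K: "i < k \<Longrightarrow> p i \<in> K"
    and F_fixed: "i < k \<Longrightarrow> F i (p i) = p i"
    and F_shared: "\<lbrakk>i < k; l < k; j < k; j \<noteq> i; j \<noteq> l\<rbrakk> \<Longrightarrow> F i (p j) = F l (p j)"
    and F_meet: "\<lbrakk>i < k; l < k; i \<noteq> l; y \<in> K; z \<in> K; F i y = F l z\<rbrakk>
      \<Longrightarrow> \<exists>j<k. j \<noteq> i \<and> j \<noteq> l \<and> y = p j \<and> z = p j"
    and cells_shrink: "0 < e \<Longrightarrow> \<exists>n. \<forall>w\<in>words k n. \<forall>x\<in>K. \<forall>y\<in>K. dist (cell F w x) (cell F w y) < e"
    and peak: "j < k \<Longrightarrow> \<exists>b::'a \<Rightarrow> real. continuous_on K b \<and> (\<forall>l<k. b (p l) = (if l = j then 1 else 0))"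

sublocale simplex_attractor \<subseteq> glued_cells
proof
  show "3 \<le> k" by (rule k3)
  show "compact K" "K = (\<Union>i<k. F i ` K)" by (rule K_compact K_cover)+
  show "i < k \<Longrightarrow> continuous_on K (F i)" "i < k \<Longrightarrow> inj_on (F i) K" "i < k \<Longrightarrow> p i \<in> K" for i
    by (rule continuous_on_F inj_on_F vertex_in_K; assumption)+
  show "i < k \<Longrightarrow> F i (p i) = p i" for i using maps by (simp add: cell_maps_def)
  show "\<lbrakk>i < k; l < k; j < k; j \<noteq> i; j \<noteq> l\<rbrakk> \<Longrightarrow> F i (p j) = F l (p j)" for i l j
    using maps by (simp add: cell_maps_def)
  show "\<lbrakk>i < k; l < k; i \<noteq> l; y \<in> K; z \<in> K; F i y = F l z\<rbrakk>
      \<Longrightarrow> \<exists>j<k. j \<noteq> i \<and> j \<noteq> l \<and> y = p j \<and> z = p j" for i l y z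
    by (rule cells_meet)
  show "\<exists>n. \<forall>w\<in>words k n. \<forall>x\<in>K. \<forall>y\<in>K. dist (cell F w x) (cell F w y) < e" if "0 < e" for e :: real
    using cells_shrink[OF that] by (meson insertI2)
  show "\<exists>b::'a \<Rightarrow> real. continuous_on K b \<and> (\<forall>l<k. b (p l) = (if l = j then 1 else 0))" if "j < k" for j
    using that by (intro exI[of _ "\<lambda>x. bary k p x j"]) (auto simp: continuous_on_bary bary_vertex)
qed

context glued_cells
begin

abbreviation r :: real where "r \<equiv> resistance_ratio k"

lemma r_pos: "0 < r" and r_less_1: "r < 1"
  using resistance_ratio_bounds[OF k3] by auto

lemma F_in_K: "i < k \<Longrightarrow> x \<in> K \<Longrightarrow> F i x \<in> K"
  using K_cover by blast

lemma K_cases: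
  assumes "x \<in> K"
  obtains i y where "i < k" "y \<in> K" "x = F i y"
  using assms K_cover by blast

lemma cell_in_K: "w \<in> words k n \<Longrightarrow> x \<in> K \<Longrightarrow> cell F w x \<in> K"
  by (induction w arbitrary: n) (auto simp: words_def F_in_K)

lemma K_cell_cases: "x \<in> K \<Longrightarrow> \<exists>w\<in>words k n. \<exists>y\<in>K. x = cell F w y"
proof (induction n arbitrary: x)
  case (Suc n)
  obtain i y where iy: "i < k" "y \<in> K" "x = F i y" using Suc.prems by (rule K_cases)
  obtain w z where "w \<in> words k n" "z \<in> K" "y = cell F w z" using Suc.IH[OF iy(2)] by blast
  with iy show ?case by (intro bexI[of _ "i # w"] bexI[of _ z]) (auto simp: words_Suc)
qed auto

abbreviation E :: "nat \<Rightarrow> ('a \<Rightarrow> real) \<Rightarrow> real" where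
  "E \<equiv> level_energy k p F (simplex_matrix k) r"

lemma E_0: "E 0 u = simplex_form k (\<lambda>j. u (p j))"
proof -
  have "(\<Sum>j<k. u (p i) * simplex_matrix k i j * u (p j)) = u (p i) * (\<Sum>j<k. u (p j)) - real k * (u (p i))\<^sup>2"
    if "i < k" for i
  proof -
    have "(\<Sum>j<k. u (p i) * simplex_matrix k i j * u (p j))
      = (\<Sum>j<k. u (p i) * u (p j) - (if j = i then real k * (u (p i))\<^sup>2 else 0))"
      by (rule sum.cong) (auto simp: simplex_matrix_def power2_eq_square algebra_simps)
    then show ?thesis using that by (simp add: sum_subtractf flip: sum_distrib_left)
  qed
  then show ?thesis
    by (simp add: simplex_form_def sum_subtractf power2_eq_square flip: sum_distrib_left sum_distrib_right)
qed

lemma E_cong: "(\<And>x. x \<in> K \<Longrightarrow> u x = v x) \<Longrightarrow> E m u = E m v"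
proof (induction m arbitrary: u v)
  case 0
  then show ?case by (simp add: E_0 simplex_form_def vertex_in_K)
next
  case (Suc m)
  have "E m (u \<circ> F i) = E m (v \<circ> F i)" if "i < k" for i
    using Suc that by (intro Suc.IH) (auto simp: F_in_K)
  then show ?case by simp
qed

lemma E_nonneg: "0 \<le> E m u"
proof (induction m arbitrary: u)
  case 0
  then show ?case using k3 by (simp only: E_0) (simp add: simplex_form_nonneg)
next
  case (Suc m)
  then show ?case using r_pos by (simp add: sum_nonneg)
qed

lemma vertex_values_of_cell:
  obtains Q where "\<And>i. i < k \<Longrightarrow> E 0 (u \<circ> F i) = simplex_form k (\<lambda>j. if j = i then u (p j) else Q j)"
proof
  (* the point opposite to p j lies in every cell but j; cells 0 and 1 suffice to reach it *)
  define Q where "Q j = u (F (if j = 0 then 1 else 0) (p j))" for j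
  fix i assume i: "i < k"
  have "u (F i (p j)) = (if j = i then u (p j) else Q j)" if "j < k" for j
    using F_shared[of i "if j = 0 then 1 else 0" j] F_fixed[of i] that i k3 by (auto simp: Q_def)
  then show "E 0 (u \<circ> F i) = simplex_form k (\<lambda>j. if j = i then u (p j) else Q j)"
    unfolding E_0 simplex_form_def by simp
qed

lemma E_mono_Suc: "E m u \<le> E (Suc m) u"
proof (induction m arbitrary: u)
  case 0
  obtain Q where Q: "\<And>i. i < k \<Longrightarrow> E 0 (u \<circ> F i) = simplex_form k (\<lambda>j. if j = i then u (p j) else Q j)"
    using vertex_values_of_cell[of u] by blast
  have "r * E 0 u \<le> (\<Sum>i<k. E 0 (u \<circ> F i))"
    using cell_form_sum_ge[OF k3, of "\<lambda>j. u (p j)" Q] Q by (simp only: E_0[of u]) simp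
  then have "E 0 u \<le> inverse r * (\<Sum>i<k. E 0 (u \<circ> F i))"
    using r_pos by (simp add: field_simps)
  then show ?case by (simp only: level_energy.simps(2))
next
  case (Suc m)
  have "E (Suc m) u = inverse r * (\<Sum>i<k. E m (u \<circ> F i))" by simp
  also have "\<dots> \<le> inverse r * (\<Sum>i<k. E (Suc m) (u \<circ> F i))"
    using Suc r_pos by (intro mult_left_mono sum_mono) auto
  finally show ?case by (simp only: level_energy.simps(2))
qed

lemma E_incseq: "incseq (\<lambda>m. E m u)"
  by (rule incseq_SucI) (rule E_mono_Suc)

lemma E_cell_le:
  assumes "i < k"
  shows "E m (u \<circ> F i) \<le> r * E (Suc m) u"
proof -
  have "E m (u \<circ> F i) \<le> (\<Sum>i<k. E m (u \<circ> F i))"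
    using assms E_nonneg by (intro member_le_sum) auto
  then show ?thesis using r_pos by (simp add: field_simps)
qed

primrec bilinear :: "nat \<Rightarrow> ('a \<Rightarrow> real) \<Rightarrow> ('a \<Rightarrow> real) \<Rightarrow> real" where
  "bilinear 0 u v = real k * (\<Sum>i<k. u (p i) * v (p i)) - (\<Sum>i<k. u (p i)) * (\<Sum>i<k. v (p i))"
| "bilinear (Suc m) u v = inverse r * (\<Sum>i<k. bilinear m (u \<circ> F i) (v \<circ> F i))"

lemma bilinear_self: "bilinear m u u = E m u"
proof (induction m arbitrary: u)
  case 0
  then show ?case by (simp only: E_0) (simp add: simplex_form_def power2_eq_square)
qed simp

lemma bilinear_commute: "bilinear m u v = bilinear m v u"
  by (induction m arbitrary: u v) (simp_all add: mult.commute)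

lemma bilinear_linear_left:
  "bilinear m (\<lambda>x. a * u x + b * v x) w = a * bilinear m u w + b * bilinear m v w"
proof (induction m arbitrary: u v w)
  case 0
  then show ?case
    by (simp add: sum.distrib distrib_right mult.assoc flip: sum_distrib_left) (simp add: algebra_simps)
next
  case (Suc m)
  have "(\<lambda>x. a * u x + b * v x) \<circ> F i = (\<lambda>x. a * (u \<circ> F i) x + b * (v \<circ> F i) x)" for i
    by auto
  then have "bilinear m ((\<lambda>x. a * u x + b * v x) \<circ> F i) (w \<circ> F i)
      = a * bilinear m (u \<circ> F i) (w \<circ> F i) + b * bilinear m (v \<circ> F i) (w \<circ> F i)" for i
    by (simp only: Suc)
  then show ?case
    by (simp add: sum.distrib distrib_left mult.left_commute flip: sum_distrib_left)
qed

lemma bilinear_linear_right: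
  "bilinear m w (\<lambda>x. a * u x + b * v x) = a * bilinear m w u + b * bilinear m w v"
  by (simp add: bilinear_commute[of m w] bilinear_linear_left)

lemma E_linear_combination:
  "E m (\<lambda>x. a * u x + b * v x) = a\<^sup>2 * E m u + 2 * a * b * bilinear m u v + b\<^sup>2 * E m v"
  by (simp add: bilinear_linear_left bilinear_linear_right bilinear_commute[of m v u]
      power2_eq_square algebra_simps flip: bilinear_self)

lemma E_combination_le: "E m (\<lambda>x. a * u x + b * v x) \<le> 2 * a\<^sup>2 * E m u + 2 * b\<^sup>2 * E m v"
  using E_nonneg[of m "\<lambda>x. a * u x + (- b) * v x"]
  by (simp only: E_linear_combination) simp

text \<open>For \<open>i \<noteq> 0\<close> the points \<open>p 0\<close> and \<open>F i (p 0)\<close> lie in no common cell of level one. They are joined through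
  \<open>F 0 (p l) = F i (p l)\<close> with a third index \<open>l\<close>, by one step in cell \<open>0\<close> and one step in cell \<open>i\<close>.\<close>

lemma cell_step_bound:
  assumes i: "i < k"
  shows "\<bar>u (F i (p 0)) - u (p 0)\<bar> \<le> 2 * sqrt r * sqrt (E 1 u)"
proof (cases "i = 0")
  case True
  then show ?thesis using i F_fixed r_pos E_nonneg[of 1 u] by simp
next
  case False
  have gap: "\<bar>u (F s (p j)) - u (F s (p l))\<bar> \<le> sqrt r * sqrt (E 1 u)" if "s < k" "j < k" "l < k" for s j l
  proof -
    have "(u (F s (p j)) - u (F s (p l)))\<^sup>2 \<le> E 0 (u \<circ> F s)"
      unfolding E_0 using simplex_form_ge_gap[of j k l "\<lambda>j. (u \<circ> F s) (p j)"] that by simp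
    also have "\<dots> \<le> r * E 1 u" using E_cell_le[OF that(1), of 0 u] by simp
    finally show ?thesis
      by (metis real_sqrt_abs real_sqrt_le_iff real_sqrt_mult)
  qed
  (* a third vertex exists because k is at least 3 *)
  define l where "l = (if i = 1 then 2 else 1 :: nat)"
  have l: "l < k" "l \<noteq> 0" "l \<noteq> i" using k3 by (auto simp: l_def)
  have "F 0 (p l) = F i (p l)" using F_shared[of 0 i l] l i k3 by simp
  moreover have "F 0 (p 0) = p 0" using F_fixed k3 by simp
  ultimately show ?thesis
    using gap[of 0 0 l] gap[of i l 0] l i k3 by simp
qed

text \<open>The constant is the solution \<open>B\<close> of \<open>B = B sqrt r + 2 sqrt r\<close>, the recursion in the induction below.\<close>

definition osc_const :: real where "osc_const = 2 * sqrt r / (1 - sqrt r)"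

lemma osc_const_nonneg: "0 \<le> osc_const"
  using r_pos r_less_1 by (simp add: osc_const_def)

lemma E_1_le: "E 1 u \<le> E (Suc m) u"
  using incseqD[OF E_incseq, of 1 "Suc m"] by simp

text \<open>Passing to a cell multiplies the energy by at most \<open>r\<close>, so the steps of the chain leading from \<open>p 0\<close> to a
  vertex of a small cell are bounded by a geometric series with ratio \<open>sqrt r\<close>.\<close>

lemma vertex_chain_bound:
  "w \<in> words k n \<Longrightarrow> \<bar>u (cell F w (p 0)) - u (p 0)\<bar> \<le> osc_const * sqrt (E n u)"
proof (induction n arbitrary: w u)
  case 0
  then show ?case using osc_const_nonneg E_nonneg[of 0 u] by simp
next
  case (Suc n)
  then obtain i v where w: "w = i # v" "i < k" "v \<in> words k n" by (auto simp: words_Suc)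
  have "\<bar>(u \<circ> F i) (cell F v (p 0)) - (u \<circ> F i) (p 0)\<bar> \<le> osc_const * sqrt (E n (u \<circ> F i))"
    using w by (intro Suc.IH)
  also have "\<dots> \<le> osc_const * (sqrt r * sqrt (E (Suc n) u))"
    using E_cell_le[OF w(2), of n u] osc_const_nonneg
    by (intro mult_left_mono) (simp_all only: real_sqrt_mult[symmetric] real_sqrt_le_iff)
  finally have 1: "\<bar>u (cell F w (p 0)) - u (F i (p 0))\<bar> \<le> osc_const * (sqrt r * sqrt (E (Suc n) u))"
    by (simp add: w)
  have "\<bar>u (F i (p 0)) - u (p 0)\<bar> \<le> 2 * sqrt r * sqrt (E 1 u)"
    by (rule cell_step_bound[OF w(2)])
  also have "\<dots> \<le> 2 * sqrt r * sqrt (E (Suc n) u)"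
    using r_pos E_1_le by (intro mult_left_mono) (auto simp only: real_sqrt_le_iff, auto)
  finally have 2: "\<bar>u (F i (p 0)) - u (p 0)\<bar> \<le> 2 * sqrt r * sqrt (E (Suc n) u)" .
  have "osc_const * sqrt r + 2 * sqrt r = osc_const"
    using r_less_1 by (simp add: osc_const_def field_simps)
  then have "osc_const * sqrt (E (Suc n) u)
      = osc_const * (sqrt r * sqrt (E (Suc n) u)) + 2 * sqrt r * sqrt (E (Suc n) u)"
    by (metis distrib_right mult.assoc)
  with 1 2 show ?case by linarith
qed

definition finite_energy :: "('a \<Rightarrow> real) set" where
  "finite_energy = {u. continuous_on K u \<and> bdd_above (range (\<lambda>m. E m u))}"

definition limit_energy :: "('a \<Rightarrow> real) \<Rightarrow> real" where
  "limit_energy u = lim (\<lambda>m. E m u)"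

lemma limit_energy_tendsto:
  assumes "u \<in> finite_energy"
  shows "(\<lambda>m. E m u) \<longlonglongrightarrow> limit_energy u"
proof -
  have "convergent (\<lambda>m. E m u)"
    using assms LIMSEQ_incseq_SUP[OF _ E_incseq] by (auto simp: finite_energy_def convergent_def)
  then show ?thesis by (simp add: limit_energy_def convergent_LIMSEQ_iff)
qed

lemma finite_energy_continuous: "u \<in> finite_energy \<Longrightarrow> continuous_on K u"
  by (simp add: finite_energy_def)

lemma E_le_limit_energy: "u \<in> finite_energy \<Longrightarrow> E m u \<le> limit_energy u"
  using incseq_le[OF E_incseq limit_energy_tendsto] .

lemma limit_energy_nonneg: "u \<in> finite_energy \<Longrightarrow> 0 \<le> limit_energy u"
  using E_le_limit_energy[of u 0] E_nonneg[of 0 u] by linarith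

lemma finite_energyI:
  assumes "continuous_on K u" "\<And>m. E m u \<le> C"
  shows "u \<in> finite_energy"
  using assms by (auto simp: finite_energy_def simp del: level_energy.simps intro!: bdd_aboveI2[of _ _ C])

lemma finite_energy_convergentI:
  assumes "continuous_on K u" "(\<lambda>m. E m u) \<longlonglongrightarrow> c"
  shows "u \<in> finite_energy" "limit_energy u = c"
  using assms incseq_le[OF E_incseq] by (auto intro: finite_energyI simp: limit_energy_def limI)

lemma finite_energy_combination:
  assumes "u \<in> finite_energy" "v \<in> finite_energy"
  shows "(\<lambda>x. a * u x + b * v x) \<in> finite_energy"
proof (rule finite_energyI)
  show "continuous_on K (\<lambda>x. a * u x + b * v x)"
    using assms by (intro continuous_intros finite_energy_continuous)
  fix m
  have "2 * a\<^sup>2 * E m u + 2 * b\<^sup>2 * E m v \<le> 2 * a\<^sup>2 * limit_energy u + 2 * b\<^sup>2 * limit_energy v"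
    using assms by (intro add_mono mult_left_mono E_le_limit_energy) auto
  then show "E m (\<lambda>x. a * u x + b * v x) \<le> 2 * a\<^sup>2 * limit_energy u + 2 * b\<^sup>2 * limit_energy v"
    using E_combination_le[of m a u b v] by linarith
qed

lemma finite_energy_0: "(\<lambda>_. 0) \<in> finite_energy"
proof (rule finite_energyI)
  show "E m (\<lambda>_. 0) \<le> 0" for m
    using E_combination_le[of m 0 "\<lambda>_. 0" 0 "\<lambda>_. 0"] by simp
qed auto

lemma finite_energy_sum:
  assumes "finite A" "\<And>i. i \<in> A \<Longrightarrow> u i \<in> finite_energy"
  shows "(\<lambda>x. \<Sum>i\<in>A. c i * u i x) \<in> finite_energy"
  using assms
proof (induction A rule: finite_induct)
  case empty
  then show ?case using finite_energy_0 by simp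
next
  case (insert i A)
  then show ?case
    using finite_energy_combination[of "u i" "\<lambda>x. \<Sum>i\<in>A. c i * u i x" "c i" 1] by simp
qed

definition energy_form :: "('a \<Rightarrow> real) \<Rightarrow> ('a \<Rightarrow> real) \<Rightarrow> real" where
  "energy_form u v = lim (\<lambda>m. bilinear m u v)"

lemma energy_form_tendsto:
  assumes "u \<in> finite_energy" "v \<in> finite_energy"
  shows "(\<lambda>m. bilinear m u v) \<longlonglongrightarrow> energy_form u v"
proof -
  have "(\<lambda>x. 1 * u x + 1 * v x) \<in> finite_energy"
    using assms by (rule finite_energy_combination)
  then have "(\<lambda>m. (E m (\<lambda>x. 1 * u x + 1 * v x) - E m u - E m v) / 2) \<longlonglongrightarrow>
      (limit_energy (\<lambda>x. 1 * u x + 1 * v x) - limit_energy u - limit_energy v) / 2"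
    using assms by (intro tendsto_intros limit_energy_tendsto) auto
  moreover have "(E m (\<lambda>x. 1 * u x + 1 * v x) - E m u - E m v) / 2 = bilinear m u v" for m
    by (simp only: E_linear_combination) simp
  ultimately have "convergent (\<lambda>m. bilinear m u v)"
    by (auto simp: convergent_def)
  then show ?thesis by (simp add: energy_form_def convergent_LIMSEQ_iff)
qed

lemma energy_form_self: "u \<in> finite_energy \<Longrightarrow> energy_form u u = limit_energy u"
  by (simp add: energy_form_def limit_energy_def bilinear_self)

lemma energy_form_commute: "energy_form u v = energy_form v u"
  by (simp add: energy_form_def bilinear_commute)

lemma energy_form_linear_left:
  assumes "u \<in> finite_energy" "v \<in> finite_energy" "w \<in> finite_energy"
  shows "energy_form (\<lambda>x. a * u x + b * v x) w = a * energy_form u w + b * energy_form v w"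
proof -
  have "(\<lambda>m. a * bilinear m u w + b * bilinear m v w) \<longlonglongrightarrow> a * energy_form u w + b * energy_form v w"
    using assms by (intro tendsto_intros energy_form_tendsto)
  then show ?thesis by (simp add: energy_form_def bilinear_linear_left limI)
qed

lemma energy_form_sum_left:
  assumes "finite A" "\<And>i. i \<in> A \<Longrightarrow> u i \<in> finite_energy" "w \<in> finite_energy"
  shows "energy_form (\<lambda>x. \<Sum>i\<in>A. c i * u i x) w = (\<Sum>i\<in>A. c i * energy_form (u i) w)"
  using assms
proof (induction A rule: finite_induct)
  case empty
  then show ?case
    using energy_form_linear_left[OF finite_energy_0 finite_energy_0, of w 0 0] by simp
next
  case (insert i A)
  then show ?case
    using energy_form_linear_left[of "u i" "\<lambda>x. \<Sum>i\<in>A. c i * u i x" w "c i" 1]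
      finite_energy_sum[of A u c] by simp
qed

lemma limit_energy_combination:
  assumes "u \<in> finite_energy" "v \<in> finite_energy"
  shows "limit_energy (\<lambda>x. a * u x + b * v x)
    = a\<^sup>2 * limit_energy u + 2 * a * b * energy_form u v + b\<^sup>2 * limit_energy v"
proof -
  have "(\<lambda>m. a\<^sup>2 * E m u + 2 * a * b * bilinear m u v + b\<^sup>2 * E m v) \<longlonglongrightarrow>
      a\<^sup>2 * limit_energy u + 2 * a * b * energy_form u v + b\<^sup>2 * limit_energy v"
    using assms by (intro tendsto_intros energy_form_tendsto limit_energy_tendsto)
  then show ?thesis by (simp add: limit_energy_def E_linear_combination limI)
qed

text \<open>The images of \<open>p 0\<close> in small cells approximate every point of \<open>K\<close>, so the bound along chains extends to \<open>K\<close> by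
  continuity.\<close>

lemma oscillation_bound:
  assumes u: "u \<in> finite_energy" and x: "x \<in> K"
  shows "\<bar>u x - u (p 0)\<bar> \<le> osc_const * sqrt (limit_energy u)"
proof (rule field_le_epsilon)
  fix e :: real assume e: "0 < e"
  have "continuous_on K u" using u by (rule finite_energy_continuous)
  then obtain d where d: "d > 0" "\<And>y. y \<in> K \<Longrightarrow> dist y x < d \<Longrightarrow> dist (u y) (u x) < e"
    using x e unfolding continuous_on_iff by metis
  obtain n where n: "\<forall>w\<in>words k n. \<forall>x\<in>K. \<forall>y\<in>K. dist (cell F w x) (cell F w y) < d"
    using cells_shrink[OF d(1)] by blast
  obtain w y where wy: "w \<in> words k n" "y \<in> K" "x = cell F w y" using K_cell_cases[OF x] by blast
  have p0: "p 0 \<in> K" using vertex_in_K k3 by simp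
  have "dist (cell F w (p 0)) x < d" using n wy p0 by simp
  then have "\<bar>u (cell F w (p 0)) - u x\<bar> < e"
    using d(2) cell_in_K[OF wy(1) p0] by (simp add: dist_real_def)
  moreover have "\<bar>u (cell F w (p 0)) - u (p 0)\<bar> \<le> osc_const * sqrt (E n u)"
    by (rule vertex_chain_bound[OF wy(1)])
  moreover have "osc_const * sqrt (E n u) \<le> osc_const * sqrt (limit_energy u)"
    using osc_const_nonneg E_le_limit_energy[OF u] by (intro mult_left_mono) auto
  ultimately show "\<bar>u x - u (p 0)\<bar> \<le> osc_const * sqrt (limit_energy u) + e" by linarith
qed

lemma continuous_on_comp_F:
  assumes "continuous_on K u" "i < k"
  shows "continuous_on K (u \<circ> F i)"
  by (rule continuous_on_compose2[OF assms(1) F_continuous[OF assms(2)], folded comp_def])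
    (use assms F_in_K in auto)

lemma finite_energy_comp_F:
  assumes "u \<in> finite_energy" "i < k"
  shows "u \<circ> F i \<in> finite_energy"
proof (rule finite_energyI)
  show "continuous_on K (u \<circ> F i)"
    using assms by (intro continuous_on_comp_F finite_energy_continuous)
  fix m
  have "E m (u \<circ> F i) \<le> r * E (Suc m) u" by (rule E_cell_le[OF assms(2)])
  also have "\<dots> \<le> r * limit_energy u"
    using r_pos assms by (intro mult_left_mono E_le_limit_energy) auto
  finally show "E m (u \<circ> F i) \<le> r * limit_energy u" .
qed

text \<open>Self-similarity passes to the limit. Membership follows from the cells, which is how glued functions are
  recognised as functions of finite energy.\<close>

lemma finite_energy_from_cells:
  assumes u: "continuous_on K u" and fin: "\<And>i. i < k \<Longrightarrow> u \<circ> F i \<in> finite_energy"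
  shows "u \<in> finite_energy" "limit_energy u = inverse r * (\<Sum>i<k. limit_energy (u \<circ> F i))"
proof -
  have "(\<lambda>m. inverse r * (\<Sum>i<k. E m (u \<circ> F i))) \<longlonglongrightarrow> inverse r * (\<Sum>i<k. limit_energy (u \<circ> F i))"
    using fin by (intro tendsto_intros limit_energy_tendsto) auto
  then have "(\<lambda>m. E (Suc m) u) \<longlonglongrightarrow> inverse r * (\<Sum>i<k. limit_energy (u \<circ> F i))" by simp
  then have lim: "(\<lambda>m. E m u) \<longlonglongrightarrow> inverse r * (\<Sum>i<k. limit_energy (u \<circ> F i))"
    by (rule LIMSEQ_imp_Suc)
  show "u \<in> finite_energy" "limit_energy u = inverse r * (\<Sum>i<k. limit_energy (u \<circ> F i))"
    using finite_energy_convergentI[OF u lim] by auto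
qed

lemma limit_energy_cells:
  assumes "u \<in> finite_energy"
  shows "limit_energy u = inverse r ^ m * (\<Sum>w\<in>words k m. limit_energy (u \<circ> cell F w))"
  using assms
proof (induction m arbitrary: u)
  case (Suc m)
  have "limit_energy u = inverse r * (\<Sum>i<k. limit_energy (u \<circ> F i))"
    by (rule finite_energy_from_cells(2)[OF finite_energy_continuous[OF Suc.prems]
          finite_energy_comp_F[OF Suc.prems]])
  also have "\<dots> = inverse r * (\<Sum>i<k. inverse r ^ m * (\<Sum>w\<in>words k m. limit_energy (u \<circ> F i \<circ> cell F w)))"
    using Suc.IH[OF finite_energy_comp_F[OF Suc.prems]]
    by (intro arg_cong[of _ _ "(*) (inverse r)"] sum.cong) (auto simp: comp_def)
  finally show ?case by (simp add: sum_words_Suc comp_def sum_distrib_left mult.assoc)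
qed simp

lemma finite_energy_comp_cell:
  "u \<in> finite_energy \<Longrightarrow> w \<in> words k m \<Longrightarrow> u \<circ> cell F w \<in> finite_energy"
proof (induction m arbitrary: u w)
  case (Suc m)
  then obtain i v where w: "w = i # v" "i < k" "v \<in> words k m" by (auto simp: words_Suc)
  show ?case
    using Suc.IH[OF finite_energy_comp_F[OF Suc.prems(1) w(2)] w(3)] by (simp add: w comp_assoc)
qed simp

lemma finite_energy_cong:
  assumes "\<And>x. x \<in> K \<Longrightarrow> u x = v x"
  shows "u \<in> finite_energy \<longleftrightarrow> v \<in> finite_energy" "limit_energy u = limit_energy v"
proof -
  have "E m u = E m v" for m using assms by (rule E_cong)
  moreover have "continuous_on K u = continuous_on K v" using assms by (rule continuous_on_cong[OF refl])
  ultimately show "u \<in> finite_energy \<longleftrightarrow> v \<in> finite_energy" "limit_energy u = limit_energy v"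
    by (simp_all add: finite_energy_def limit_energy_def)
qed

lemma limit_energy_cell_le:
  assumes "u \<in> finite_energy" "w \<in> words k m"
  shows "limit_energy (u \<circ> cell F w) \<le> r ^ m * limit_energy u"
proof -
  have "limit_energy (u \<circ> cell F w) \<le> (\<Sum>w\<in>words k m. limit_energy (u \<circ> cell F w))"
    using assms limit_energy_nonneg finite_energy_comp_cell by (intro member_le_sum) auto
  also have "\<dots> = r ^ m * limit_energy u"
    using r_pos by (simp add: limit_energy_cells[OF assms(1), of m] power_inverse)
  finally show ?thesis .
qed

lemma cell_oscillation_bound:
  assumes u: "u \<in> finite_energy" and w: "w \<in> words k m" and xy: "x \<in> K" "y \<in> K"
  shows "\<bar>u (cell F w x) - u (cell F w y)\<bar> \<le> 2 * osc_const * sqrt (r ^ m * limit_energy u)"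
proof -
  define v where "v = u \<circ> cell F w"
  have v: "v \<in> finite_energy" using finite_energy_comp_cell[OF u w] by (simp add: v_def)
  have "\<bar>v x - v y\<bar> \<le> 2 * (osc_const * sqrt (limit_energy v))"
    using oscillation_bound[OF v xy(1)] oscillation_bound[OF v xy(2)] by linarith
  also have "\<dots> \<le> 2 * (osc_const * sqrt (r ^ m * limit_energy u))"
    using osc_const_nonneg limit_energy_cell_le[OF u w] unfolding v_def
    by (intro mult_left_mono) auto
  finally show ?thesis by (simp add: v_def mult.assoc)
qed

end

section \<open>Gluing and harmonic functions\<close>

context glued_cells
begin

definition compatible :: "(nat \<Rightarrow> 'a \<Rightarrow> real) \<Rightarrow> bool" where
  "compatible g \<longleftrightarrow> (\<forall>i<k. \<forall>l<k. \<forall>j<k. j \<noteq> i \<longrightarrow> j \<noteq> l \<longrightarrow> g i (p j) = g l (p j))"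

text \<open>A point of several cells takes its value from the first of them; for compatible families the choice is immaterial.\<close>

definition glue :: "(nat \<Rightarrow> 'a \<Rightarrow> real) \<Rightarrow> 'a \<Rightarrow> real" where
  "glue g x = (let i = (LEAST i. i < k \<and> x \<in> F i ` K) in g i (the_inv_into K (F i) x))"

lemma glue_F:
  assumes g: "compatible g" and i: "i < k" and y: "y \<in> K"
  shows "glue g (F i y) = g i y"
proof -
  define l where "l = (LEAST l. l < k \<and> F i y \<in> F l ` K)"
  have "l < k \<and> F i y \<in> F l ` K"
    unfolding l_def by (rule LeastI[of _ i]) (use i y in auto)
  then obtain z where l: "l < k" and z: "z \<in> K" "F i y = F l z" by blast
  have "glue g (F i y) = g l (the_inv_into K (F l) (F i y))"
    by (simp add: glue_def Let_def l_def)
  also have "the_inv_into K (F l) (F i y) = z"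
    unfolding z(2) by (rule the_inv_into_f_f[OF F_inj[OF l] z(1)])
  also have "g l z = g i y"
  proof (cases "l = i")
    case True
    then have "z = y" using inj_onD[OF F_inj[OF i] _ z(1) y] z(2) by simp
    with True show ?thesis by simp
  next
    case False
    then obtain j where j: "j < k" "j \<noteq> i" "j \<noteq> l" "y = p j" "z = p j"
      using F_meet[OF i l _ y z(1) z(2)] by blast
    then have "g i (p j) = g l (p j)" using g i l unfolding compatible_def by blast
    with j show ?thesis by simp
  qed
  finally show ?thesis .
qed

lemma continuous_on_glue:
  assumes g: "compatible g" and cont: "\<And>i. i < k \<Longrightarrow> continuous_on K (g i)"
  shows "continuous_on K (glue g)"
proof -
  have "continuous_on (\<Union>i\<in>{..<k}. F i ` K) (glue g)"
  proof (rule continuous_on_closed_Union)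
    fix i assume "i \<in> {..<k}"
    then have i: "i < k" by simp
    show "closed (F i ` K)"
      by (intro compact_imp_closed compact_continuous_image F_continuous i K_compact)
    have "continuous_on (F i ` K) (\<lambda>x. g i (the_inv_into K (F i) x))"
      using i by (intro continuous_on_compose2[OF cont[OF i]] continuous_on_inv_into F_continuous F_inj K_compact)
        (auto simp: the_inv_into_f_f F_inj)
    then show "continuous_on (F i ` K) (glue g)"
      by (rule continuous_on_eq) (use i g F_inj in \<open>auto simp: glue_F the_inv_into_f_f\<close>)
  qed simp
  then show ?thesis using K_cover by simp
qed

lemma glue_vertex: "compatible g \<Longrightarrow> i < k \<Longrightarrow> glue g (p i) = g i (p i)"
  using glue_F[of g i "p i"] by (simp add: F_fixed vertex_in_K)

lemma glue_finite_energy: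
  assumes g: "compatible g" and fin: "\<And>i. i < k \<Longrightarrow> g i \<in> finite_energy"
  shows "glue g \<in> finite_energy" "limit_energy (glue g) = inverse r * (\<Sum>i<k. limit_energy (g i))"
proof -
  have cong: "(glue g \<circ> F i) \<in> finite_energy" "limit_energy (glue g \<circ> F i) = limit_energy (g i)" if "i < k" for i
    using finite_energy_cong[of "glue g \<circ> F i" "g i"] fin[OF that] g that by (auto simp: glue_F)
  have cont: "continuous_on K (glue g)"
    using g fin by (intro continuous_on_glue finite_energy_continuous)
  show "glue g \<in> finite_energy"
    using finite_energy_from_cells(1)[OF cont] cong by blast
  show "limit_energy (glue g) = inverse r * (\<Sum>i<k. limit_energy (g i))"
    using finite_energy_from_cells(2)[OF cont] cong by simp
qed

definition vertex_peak :: "nat \<Rightarrow> 'a \<Rightarrow> real" where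
  "vertex_peak j = (SOME b. continuous_on K b \<and> (\<forall>l<k. b (p l) = (if l = j then 1 else 0)))"

lemma vertex_peak:
  assumes "j < k"
  shows "continuous_on K (vertex_peak j)" "\<And>l. l < k \<Longrightarrow> vertex_peak j (p l) = (if l = j then 1 else 0)"
  using someI_ex[OF peak[OF assms]] by (auto simp: vertex_peak_def)

text \<open>The harmonic function with vertex values \<open>a\<close> is, in cell \<open>i\<close>, the harmonic function with vertex values
  \<open>harmonic_step k a i\<close>. Iterating this requirement from a continuous interpolation of \<open>a\<close> gives continuous
  approximations that already have the right vertex values.\<close>

primrec harmonic_approx :: "nat \<Rightarrow> (nat \<Rightarrow> real) \<Rightarrow> 'a \<Rightarrow> real" where
  "harmonic_approx 0 a = (\<lambda>x. a 0 + (\<Sum>j<k. (a j - a 0) * vertex_peak j x))"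
| "harmonic_approx (Suc n) a = glue (\<lambda>i. harmonic_approx n (harmonic_step k a i))"

lemma harmonic_approx_vertex: "j < k \<Longrightarrow> harmonic_approx n a (p j) = a j"
  and harmonic_approx_compatible: "compatible (\<lambda>i. harmonic_approx n (harmonic_step k a i))"
proof -
  have vertex: "harmonic_approx n a (p j) = a j" if "j < k" for n a j
    using that
  proof (induction n arbitrary: a j)
    case 0
    then show ?case by (simp add: vertex_peak if_distrib[of "\<lambda>c. _ * c"] cong: if_cong)
  next
    case (Suc n)
    have "compatible (\<lambda>i. harmonic_approx n (harmonic_step k a i))"
      using Suc.IH by (auto simp: compatible_def harmonic_step_def)
    then show ?case using Suc by (simp add: glue_vertex) (simp add: harmonic_step_def)
  qed
  then show "j < k \<Longrightarrow> harmonic_approx n a (p j) = a j" .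
  show "compatible (\<lambda>i. harmonic_approx n (harmonic_step k a i))"
    using vertex by (auto simp: compatible_def harmonic_step_def)
qed

lemma continuous_on_harmonic_approx: "continuous_on K (harmonic_approx n a)"
proof (induction n arbitrary: a)
  case 0
  then show ?case by (auto intro!: continuous_intros vertex_peak(1))
next
  case (Suc n)
  then show ?case by (simp add: continuous_on_glue harmonic_approx_compatible)
qed

lemma harmonic_approx_Suc_F:
  "i < k \<Longrightarrow> y \<in> K \<Longrightarrow> harmonic_approx (Suc n) a (F i y) = harmonic_approx n (harmonic_step k a i) y"
  by (simp add: glue_F harmonic_approx_compatible)

lemma harmonic_step_form_le:
  assumes "i < k"
  shows "simplex_form k (harmonic_step k a i) \<le> r * simplex_form k a"
  unfolding cell_form_sum_harmonic[OF k3, symmetric]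
  using assms k3 by (intro member_le_sum) (auto simp: simplex_form_nonneg)

lemma harmonic_approx_0_bound:
  "\<exists>C\<ge>0. \<forall>a. \<forall>i<k. \<forall>x\<in>K. \<bar>harmonic_approx 0 a x - a i\<bar> \<le> C * sqrt (simplex_form k a)"
proof -
  have "\<exists>M. \<forall>x\<in>K. \<bar>vertex_peak j x\<bar> \<le> M" if "j < k" for j
  proof -
    have "bounded (vertex_peak j ` K)"
      using that by (intro compact_imp_bounded compact_continuous_image vertex_peak K_compact)
    then show ?thesis by (auto simp: bounded_iff)
  qed
  then obtain M where M: "\<And>j x. j < k \<Longrightarrow> x \<in> K \<Longrightarrow> \<bar>vertex_peak j x\<bar> \<le> M j" by metis
  have M0: "M j \<ge> 0" if "j < k" for j
    using M[OF that vertex_in_K[OF that]] by linarith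
  define C where "C = 1 + (\<Sum>j<k. M j)"
  have "\<bar>harmonic_approx 0 a x - a i\<bar> \<le> C * sqrt (simplex_form k a)" if "i < k" "x \<in> K" for a i x
  proof -
    have gap: "\<bar>a j - a l\<bar> \<le> sqrt (simplex_form k a)" if "j < k" "l < k" for j l
      using simplex_form_ge_gap[OF that, of a] real_le_rsqrt[of "\<bar>a j - a l\<bar>"] by simp
    have "harmonic_approx 0 a x - a i = (a 0 - a i) + (\<Sum>j<k. (a j - a 0) * vertex_peak j x)" by simp
    also have "\<bar>\<dots>\<bar> \<le> \<bar>a 0 - a i\<bar> + (\<Sum>j<k. \<bar>(a j - a 0) * vertex_peak j x\<bar>)"
      by (intro order_trans[OF abs_triangle_ineq] add_mono sum_abs order_refl)
    also have "\<dots> \<le> sqrt (simplex_form k a) + (\<Sum>j<k. sqrt (simplex_form k a) * M j)"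
      unfolding abs_mult using that k3 M gap
      by (intro add_mono sum_mono mult_mono) (auto simp: simplex_form_nonneg)
    also have "\<dots> = C * sqrt (simplex_form k a)"
      by (simp add: C_def distrib_right sum_distrib_right mult.commute[of "sqrt _"])
    finally show ?thesis .
  qed
  moreover have "C \<ge> 0" using M0 by (auto simp: C_def intro!: add_nonneg_nonneg sum_nonneg)
  ultimately show ?thesis by blast
qed

text \<open>Successive approximations inside a cell of level \<open>n\<close> differ by what the first two differ for the vertex
  values of that cell, and the square root of the form of these values has shrunk by \<open>sqrt r ^ n\<close>.\<close>

lemma harmonic_approx_step_bound:
  "\<exists>C\<ge>0. \<forall>n a. \<forall>x\<in>K. \<bar>harmonic_approx (Suc n) a x - harmonic_approx n a x\<bar>
      \<le> C * sqrt r ^ n * sqrt (simplex_form k a)"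
proof -
  obtain C where C: "C \<ge> 0"
    "\<And>a i x. i < k \<Longrightarrow> x \<in> K \<Longrightarrow> \<bar>harmonic_approx 0 a x - a i\<bar> \<le> C * sqrt (simplex_form k a)"
    using harmonic_approx_0_bound by blast
  have step: "sqrt (simplex_form k (harmonic_step k a i)) \<le> sqrt r * sqrt (simplex_form k a)"
    if "i < k" for a i
    using harmonic_step_form_le[OF that] by (simp flip: real_sqrt_mult)
  have "\<bar>harmonic_approx (Suc n) a x - harmonic_approx n a x\<bar> \<le> 2 * C * sqrt r ^ n * sqrt (simplex_form k a)"
    if "x \<in> K" for n a x
    using that
  proof (induction n arbitrary: a x)
    case 0
    obtain i y where iy: "i < k" "y \<in> K" "x = F i y" using 0 by (rule K_cases)
    have "harmonic_step k a i i = a i" by (simp add: harmonic_step_def)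
    then have "\<bar>harmonic_approx (Suc 0) a x - a i\<bar> \<le> C * sqrt (simplex_form k (harmonic_step k a i))"
      using C(2)[OF iy(1,2), of "harmonic_step k a i"] harmonic_approx_Suc_F[OF iy(1,2), of 0 a]
      by (simp only: iy(3))
    also have "\<dots> \<le> C * (sqrt r * sqrt (simplex_form k a))"
      using C(1) step[OF iy(1)] by (rule mult_left_mono[rotated])
    also have "\<dots> \<le> C * (1 * sqrt (simplex_form k a))"
      using C(1) r_less_1 k3 by (intro mult_left_mono mult_right_mono) (auto simp: simplex_form_nonneg)
    finally show ?case using C(2)[OF iy(1) 0, of a] unfolding power_0 by linarith
  next
    case (Suc n)
    obtain i y where iy: "i < k" "y \<in> K" "x = F i y" using Suc.prems by (rule K_cases)
    have "\<bar>harmonic_approx (Suc (Suc n)) a x - harmonic_approx (Suc n) a x\<bar>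
        \<le> 2 * C * sqrt r ^ n * sqrt (simplex_form k (harmonic_step k a i))"
      unfolding iy(3) harmonic_approx_Suc_F[OF iy(1,2)] by (rule Suc.IH[OF iy(2)])
    also have "\<dots> \<le> 2 * C * sqrt r ^ n * (sqrt r * sqrt (simplex_form k a))"
      using step[OF iy(1)] C(1) r_pos by (intro mult_left_mono) auto
    finally show ?case by (simp add: mult_ac)
  qed
  with C(1) show ?thesis by (intro exI[of _ "2 * C"]) auto
qed

definition harmonic :: "(nat \<Rightarrow> real) \<Rightarrow> 'a \<Rightarrow> real" where
  "harmonic a x = lim (\<lambda>n. harmonic_approx n a x)"

lemma harmonic_uniform_limit: "uniform_limit K (\<lambda>n. harmonic_approx n a) (harmonic a) sequentially"
proof -
  obtain C where C: "\<And>n x. x \<in> K \<Longrightarrow> \<bar>harmonic_approx (Suc n) a x - harmonic_approx n a x\<bar>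
      \<le> C * sqrt r ^ n * sqrt (simplex_form k a)"
    using harmonic_approx_step_bound by blast
  have "summable (\<lambda>n. C * sqrt r ^ n * sqrt (simplex_form k a))"
    using r_pos r_less_1 by (intro summable_mult2 summable_mult summable_geometric) simp
  then have "uniformly_convergent_on K (\<lambda>n x. \<Sum>i<n. harmonic_approx (Suc i) a x - harmonic_approx i a x)"
    using C by (intro Weierstrass_m_test') auto
  moreover have "(\<Sum>i<n. harmonic_approx (Suc i) a x - harmonic_approx i a x)
      = harmonic_approx n a x - harmonic_approx 0 a x" for n x
    by (rule sum_lessThan_telescope)
  ultimately have "uniformly_convergent_on K (\<lambda>n x. harmonic_approx n a x - harmonic_approx 0 a x)"
    by (simp only:)
  then obtain l where "uniform_limit K (\<lambda>n x. harmonic_approx n a x - harmonic_approx 0 a x) l sequentially"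
    by (auto simp: uniformly_convergent_on_def)
  then have "uniform_limit K (\<lambda>n x. (harmonic_approx n a x - harmonic_approx 0 a x) + harmonic_approx 0 a x)
      (\<lambda>x. l x + harmonic_approx 0 a x) sequentially"
    by (rule uniform_limit_add) (rule uniform_limit_const)
  then
  have lim: "uniform_limit K (\<lambda>n. harmonic_approx n a) (\<lambda>x. l x + harmonic_approx 0 a x) sequentially"
    by (simp del: harmonic_approx.simps)
  have "harmonic a x = l x + harmonic_approx 0 a x" if "x \<in> K" for x
    using tendsto_uniform_limitI[OF lim that] by (simp only: harmonic_def limI)
  then show ?thesis
    using lim by (subst uniform_limit_cong'[where g = "\<lambda>n. harmonic_approx n a" and i = "\<lambda>x. l x + harmonic_approx 0 a x"]) auto
qed

lemma harmonic_tendsto: "x \<in> K \<Longrightarrow> (\<lambda>n. harmonic_approx n a x) \<longlonglongrightarrow> harmonic a x"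
  by (rule tendsto_uniform_limitI[OF harmonic_uniform_limit])

lemma continuous_on_harmonic: "continuous_on K (harmonic a)"
  by (rule uniform_limit_theorem[OF _ harmonic_uniform_limit])
    (auto simp: continuous_on_harmonic_approx simp del: harmonic_approx.simps)

lemma harmonic_vertex: "j < k \<Longrightarrow> harmonic a (p j) = a j"
  by (simp add: harmonic_def harmonic_approx_vertex limI del: harmonic_approx.simps)

lemma harmonic_F:
  assumes "i < k" "y \<in> K"
  shows "harmonic a (F i y) = harmonic (harmonic_step k a i) y"
proof -
  have "(\<lambda>n. harmonic_approx (Suc n) a (F i y)) \<longlonglongrightarrow> harmonic a (F i y)"
    using harmonic_tendsto[OF F_in_K[OF assms]] by (rule LIMSEQ_Suc)
  then have "(\<lambda>n. harmonic_approx n (harmonic_step k a i) y) \<longlonglongrightarrow> harmonic a (F i y)"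
    by (simp only: harmonic_approx_Suc_F[OF assms])
  then show ?thesis using harmonic_tendsto[OF assms(2)] LIMSEQ_unique by blast
qed

text \<open>All levels have the same energy because \<open>harmonic_step\<close> attains equality in the one-step inequality.\<close>

lemma E_harmonic: "E m (harmonic a) = simplex_form k a"
proof (induction m arbitrary: a)
  case 0
  then show ?case by (simp only: E_0) (simp add: simplex_form_def harmonic_vertex)
next
  case (Suc m)
  have "E m (harmonic a \<circ> F i) = simplex_form k (harmonic_step k a i)" if "i < k" for i
    using E_cong[of "harmonic a \<circ> F i" "harmonic (harmonic_step k a i)" m] that Suc
    by (simp add: harmonic_F)
  then show ?case using r_pos by (simp add: cell_form_sum_harmonic k3)
qed

lemma harmonic_finite_energy: "harmonic a \<in> finite_energy"
  by (rule finite_energyI[OF continuous_on_harmonic, of _ "simplex_form k a"]) (simp add: E_harmonic)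

section \<open>Bump functions on cells\<close>

text \<open>Harmonic in each cell, with value \<open>1\<close> at the common image of \<open>p 0\<close> under the maps \<open>F i\<close>, \<open>i \<noteq> 0\<close>, and value \<open>0\<close>
  at all other images of vertices, in particular at all vertices of the cell \<open>0\<close>.\<close>

definition bump :: "'a \<Rightarrow> real" where
  "bump = glue (\<lambda>i. if i = 0 then (\<lambda>_. 0) else harmonic (\<lambda>j. if j = 0 then 1 else 0))"

lemma bump_finite_energy: "bump \<in> finite_energy"
  and bump_vertex: "i < k \<Longrightarrow> bump (p i) = 0"
  and bump_nonzero: "\<exists>x\<in>K. bump x \<noteq> 0"
proof -
  have comp: "compatible (\<lambda>i. if i = 0 then (\<lambda>_. 0) else harmonic (\<lambda>j. if j = 0 then 1 else 0))"
    by (auto simp: compatible_def harmonic_vertex)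
  show "bump \<in> finite_energy"
    unfolding bump_def using comp
    by (rule glue_finite_energy) (simp add: finite_energy_0 harmonic_finite_energy)
  show "i < k \<Longrightarrow> bump (p i) = 0"
    using comp by (simp add: bump_def glue_vertex harmonic_vertex)
  have "bump (F 1 (p 0)) = 1"
    using comp k3 by (simp add: bump_def glue_F vertex_in_K harmonic_vertex)
  then show "\<exists>x\<in>K. bump x \<noteq> 0"
    using F_in_K[of 1 "p 0"] vertex_in_K k3 by (intro bexI[of _ "F 1 (p 0)"]) auto
qed

text \<open>In the cell of the word \<open>w\<close>, a copy of the bump multiplied by \<open>c w\<close>. Vanishing at the vertices makes every
  choice of coefficients compatible.\<close>

primrec bumps :: "nat \<Rightarrow> (nat list \<Rightarrow> real) \<Rightarrow> 'a \<Rightarrow> real" where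
  "bumps 0 c = (\<lambda>x. c [] * bump x)"
| "bumps (Suc m) c = glue (\<lambda>i. bumps m (\<lambda>w. c (i # w)))"

lemma bumps_vertex: "i < k \<Longrightarrow> bumps m c (p i) = 0"
proof (induction m arbitrary: c i)
  case (Suc m)
  then have "compatible (\<lambda>i. bumps m (\<lambda>w. c (i # w)))" by (auto simp: compatible_def)
  with Suc show ?case by (simp add: glue_vertex)
qed (simp add: bump_vertex)

lemma bumps_compatible: "compatible (\<lambda>i. bumps m (\<lambda>w. c (i # w)))"
  by (simp add: compatible_def bumps_vertex)

lemma bumps_cell: "w \<in> words k m \<Longrightarrow> x \<in> K \<Longrightarrow> bumps m c (cell F w x) = c w * bump x"
proof (induction m arbitrary: c w)
  case (Suc m)
  then obtain i v where w: "w = i # v" "i < k" "v \<in> words k m" by (auto simp: words_Suc)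
  then show ?case
    using Suc.prems(2) Suc.IH[OF w(3)] by (simp add: glue_F bumps_compatible cell_in_K)
qed simp

lemma bumps_finite_energy: "bumps m c \<in> finite_energy"
proof (induction m arbitrary: c)
  case 0
  then show ?case
    using finite_energy_combination[OF bump_finite_energy finite_energy_0, of "c []" 0] by simp
next
  case (Suc m)
  then show ?case by (simp add: glue_finite_energy bumps_compatible)
qed

lemma limit_energy_bumps:
  "limit_energy (bumps m c) = inverse r ^ m * limit_energy bump * (\<Sum>w\<in>words k m. (c w)\<^sup>2)"
proof -
  have "limit_energy (bumps m c \<circ> cell F w) = (c w)\<^sup>2 * limit_energy bump" if "w \<in> words k m" for w
  proof -
    have "limit_energy (bumps m c \<circ> cell F w) = limit_energy (\<lambda>x. c w * bump x + 0 * bump x)"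
      by (rule finite_energy_cong) (simp add: bumps_cell that)
    then show ?thesis
      by (simp only: limit_energy_combination[OF bump_finite_energy bump_finite_energy]) simp
  qed
  then show ?thesis
    by (simp add: limit_energy_cells[OF bumps_finite_energy, of m c m] mult.assoc sum_distrib_left)
      (simp add: mult_ac)
qed

end

section \<open>Rayleigh quotients\<close>

locale glued_cells_measure = glued_cells k p F K
  for k :: nat and p :: "nat \<Rightarrow> 'a::euclidean_space" and F :: "nat \<Rightarrow> 'a \<Rightarrow> 'a" and K :: "'a set" +
  fixes \<mu> :: "'a measure"
  assumes bernoulli: "standard_bernoulli_measure k F K \<mu>"
begin

sublocale prob_space \<mu>
  using bernoulli by (simp add: standard_bernoulli_measure_def)

lemma space_\<mu> [simp]: "space \<mu> = K" and sets_\<mu>: "sets \<mu> = sets (restrict_space borel K)"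
  using bernoulli by (auto simp: standard_bernoulli_measure_def)

lemma prob_K [simp]: "prob K = 1"
  using prob_space by simp

lemma measurable_continuous:
  fixes f :: "'a \<Rightarrow> 'b::topological_space"
  shows "continuous_on K f \<Longrightarrow> f \<in> borel_measurable \<mu>"
  using borel_measurable_continuous_on_restrict measurable_cong_sets[OF sets_\<mu> refl] by blast

lemma measurable_F: "i < k \<Longrightarrow> F i \<in> measurable \<mu> \<mu>"
  using measurable_restrict_space2[of "F i" \<mu> K borel] measurable_continuous[OF F_continuous, of i]
    measurable_cong_sets[OF refl sets_\<mu>, of \<mu>] F_in_K by auto

text \<open>The defining equation of the measure is this statement for indicator functions; it extends by linearity and
  monotone convergence.\<close>

lemma nn_integral_cells:
  assumes "f \<in> borel_measurable \<mu>"
  shows "(\<integral>\<^sup>+x. f x \<partial>\<mu>) = ennreal (1 / real k) * (\<Sum>i<k. \<integral>\<^sup>+x. f (F i x) \<partial>\<mu>)"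
  using assms
proof (induction rule: borel_measurable_induct)
  case (cong f g)
  have "(\<integral>\<^sup>+x. f (F i x) \<partial>\<mu>) = (\<integral>\<^sup>+x. g (F i x) \<partial>\<mu>)" if "i < k" for i
    using cong(3) that F_in_K by (intro nn_integral_cong) auto
  moreover have "(\<integral>\<^sup>+x. f x \<partial>\<mu>) = (\<integral>\<^sup>+x. g x \<partial>\<mu>)"
    using cong(3) by (intro nn_integral_cong) auto
  ultimately show ?case using cong(4) by simp
next
  case (set A)
  have pre: "(\<integral>\<^sup>+x. indicator A (F i x) \<partial>\<mu>) = ennreal (measure \<mu> (F i -` A \<inter> K))" if "i < k" for i
  proof -
    have "F i -` A \<inter> K \<in> sets \<mu>" using measurable_sets[OF measurable_F[OF that] set] by simp
    moreover have "(\<integral>\<^sup>+x. indicator A (F i x) \<partial>\<mu>) = (\<integral>\<^sup>+x. indicator (F i -` A \<inter> K) x \<partial>\<mu>)"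
      by (intro nn_integral_cong) (auto simp: indicator_def)
    ultimately show ?thesis by (simp add: emeasure_eq_measure)
  qed
  have "measure \<mu> A = (1 / real k) * (\<Sum>i<k. measure \<mu> (F i -` A \<inter> K))"
    using bernoulli set by (simp add: standard_bernoulli_measure_def)
  then show ?case
    using set by (simp add: pre emeasure_eq_measure ennreal_mult sum_nonneg del: times_divide_eq_left)
next
  case (mult u c)
  then show ?case
    by (simp add: nn_integral_cmult measurable_compose[OF measurable_F] mult.left_commute flip: sum_distrib_left)
next
  case (add u v)
  then show ?case
    by (simp add: nn_integral_add measurable_compose[OF measurable_F] sum.distrib distrib_left)
next
  case (seq U)
  have inc: "incseq (\<lambda>j. \<integral>\<^sup>+x. U j (F i x) \<partial>\<mu>)" for i
    using seq.hyps(3) by (auto simp: incseq_def le_fun_def intro!: nn_integral_mono)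
  have "(\<integral>\<^sup>+x. (SUP j. U j) (F i x) \<partial>\<mu>) = (SUP j. \<integral>\<^sup>+x. U j (F i x) \<partial>\<mu>)" if "i < k" for i
    using seq.hyps(1,3) that measurable_compose[OF measurable_F[OF that] seq.hyps(1)]
    by (subst nn_integral_monotone_convergence_SUP[symmetric]) (auto simp: incseq_def le_fun_def image_comp)
  moreover have "(\<integral>\<^sup>+x. (SUP j. U j) x \<partial>\<mu>) = (SUP j. \<integral>\<^sup>+x. U j x \<partial>\<mu>)"
  proof -
    have "(\<lambda>x. (SUP j. U j) x) = (\<lambda>x. SUP j. U j x)" by (rule ext) (rule SUP_apply)
    then show ?thesis
      using nn_integral_monotone_convergence_SUP[OF seq.hyps(3,1)] by (simp only:)
  qed
  ultimately show ?case
    by (simp add: ennreal_SUP_sum[OF inc, symmetric] SUP_mult_left_ennreal seq.IH)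
qed

lemma continuous_bounded:
  fixes u :: "'a \<Rightarrow> real"
  assumes "continuous_on K u"
  obtains M where "0 \<le> M" "\<And>x. x \<in> K \<Longrightarrow> \<bar>u x\<bar> \<le> M"
proof -
  have "bounded (u ` K)" using assms by (intro compact_imp_bounded compact_continuous_image K_compact)
  then obtain M where "\<And>x. x \<in> K \<Longrightarrow> \<bar>u x\<bar> \<le> M" by (auto simp: bounded_iff)
  then show thesis using that[of "\<bar>M\<bar>"] by force
qed

lemma integrable_continuous:
  fixes u :: "'a \<Rightarrow> real"
  assumes "continuous_on K u"
  shows "integrable \<mu> u"
proof -
  obtain M where "\<And>x. x \<in> K \<Longrightarrow> \<bar>u x\<bar> \<le> M" using continuous_bounded[OF assms] by blast
  then show ?thesis
    using measurable_continuous[OF assms] by (intro integrable_const_bound[where B = M]) auto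
qed

text \<open>A bounded function is made nonnegative by adding a constant, to which the formula applies trivially.\<close>

lemma integral_cells:
  fixes u :: "'a \<Rightarrow> real"
  assumes u: "continuous_on K u"
  shows "(LINT x|\<mu>. u x) = (1 / real k) * (\<Sum>i<k. LINT x|\<mu>. u (F i x))"
proof -
  obtain M where M: "0 \<le> M" "\<And>x. x \<in> K \<Longrightarrow> \<bar>u x\<bar> \<le> M" using continuous_bounded[OF u] by blast
  define g where "g x = u x + M" for x
  have g: "continuous_on K g" unfolding g_def by (intro continuous_intros u)
  have g0: "0 \<le> g x" if "x \<in> K" for x using M(2)[OF that] by (simp add: g_def)
  have gF: "continuous_on K (\<lambda>x. g (F i x))" if "i < k" for i
    using continuous_on_comp_F[OF g that] by (simp add: comp_def)
  have int: "(\<integral>\<^sup>+x. ennreal (g (F i x)) \<partial>\<mu>) = ennreal (LINT x|\<mu>. g (F i x))" if "i < k" for i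
    using that g0 F_in_K by (intro nn_integral_eq_integral integrable_continuous gF) auto
  have nonneg: "0 \<le> (LINT x|\<mu>. g (F i x))" if "i < k" for i
    using that g0 F_in_K by (intro integral_nonneg_AE) auto
  have "ennreal (LINT x|\<mu>. g x) = (\<integral>\<^sup>+x. ennreal (g x) \<partial>\<mu>)"
    using g0 by (intro nn_integral_eq_integral[symmetric] integrable_continuous g) auto
  also have "\<dots> = ennreal (1 / real k) * (\<Sum>i<k. \<integral>\<^sup>+x. ennreal (g (F i x)) \<partial>\<mu>)"
    using measurable_continuous[OF g] by (intro nn_integral_cells) simp
  also have "\<dots> = ennreal (1 / real k) * (\<Sum>i<k. ennreal (LINT x|\<mu>. g (F i x)))"
    by (simp add: int)
  also have "\<dots> = ennreal ((1 / real k) * (\<Sum>i<k. LINT x|\<mu>. g (F i x)))"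
  proof -
    have "0 \<le> (\<Sum>i<k. LINT x|\<mu>. g (F i x))" by (intro sum_nonneg nonneg) simp
    moreover have "(\<Sum>i<k. ennreal (LINT x|\<mu>. g (F i x))) = ennreal (\<Sum>i<k. LINT x|\<mu>. g (F i x))"
      by (intro sum_ennreal nonneg) simp
    ultimately show ?thesis by (simp only: ennreal_mult divide_nonneg_nonneg zero_le_one of_nat_0_le_iff)
  qed
  finally have "(LINT x|\<mu>. g x) = (1 / real k) * (\<Sum>i<k. LINT x|\<mu>. g (F i x))"
  proof (subst (asm) ennreal_inj)
    show "0 \<le> (LINT x|\<mu>. g x)" using g0 by (intro integral_nonneg_AE AE_I2) simp
    show "0 \<le> (1 / real k) * (\<Sum>i<k. LINT x|\<mu>. g (F i x))"
      by (intro mult_nonneg_nonneg sum_nonneg nonneg) auto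
  qed
  moreover have "(LINT x|\<mu>. g x) = (LINT x|\<mu>. u x) + M"
    using integrable_continuous[OF u] by (simp add: g_def prob_space)
  moreover have "(LINT x|\<mu>. g (F i x)) = (LINT x|\<mu>. u (F i x)) + M" if "i < k" for i
    using integrable_continuous[OF continuous_on_comp_F[OF u that]] by (simp add: g_def prob_space comp_def)
  ultimately show ?thesis using k3 by (simp add: sum.distrib distrib_left)
qed

definition inner_L2 :: "('a \<Rightarrow> real) \<Rightarrow> ('a \<Rightarrow> real) \<Rightarrow> real" where
  "inner_L2 u v = (LINT x|\<mu>. u x * v x)"

lemma inner_L2_commute: "inner_L2 u v = inner_L2 v u"
  by (simp add: inner_L2_def mult.commute)

lemma inner_L2_linear_left:
  assumes "continuous_on K u" "continuous_on K v" "continuous_on K w"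
  shows "inner_L2 (\<lambda>x. a * u x + b * v x) w = a * inner_L2 u w + b * inner_L2 v w"
proof -
  have "integrable \<mu> (\<lambda>x. u x * w x)" "integrable \<mu> (\<lambda>x. v x * w x)"
    using assms by (auto intro!: integrable_continuous continuous_intros)
  then show ?thesis by (simp add: inner_L2_def distrib_right mult.assoc)
qed

lemma inner_L2_sum_left:
  assumes "finite A" "\<And>i. i \<in> A \<Longrightarrow> continuous_on K (u i)" "continuous_on K w"
  shows "inner_L2 (\<lambda>x. \<Sum>i\<in>A. c i * u i x) w = (\<Sum>i\<in>A. c i * inner_L2 (u i) w)"
proof -
  have "integrable \<mu> (\<lambda>x. c i * u i x * w x)" if "i \<in> A" for i
    using assms that by (auto intro!: integrable_continuous continuous_intros)
  then show ?thesis by (simp add: inner_L2_def sum_distrib_right mult.assoc)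
qed

lemma inner_L2_self_nonneg: "0 \<le> inner_L2 u u"
  by (simp add: inner_L2_def)

lemma inner_L2_combination_self:
  assumes "continuous_on K u" "continuous_on K v"
  shows "inner_L2 (\<lambda>x. a * u x + b * v x) (\<lambda>x. a * u x + b * v x)
    = a\<^sup>2 * inner_L2 u u + 2 * a * b * inner_L2 u v + b\<^sup>2 * inner_L2 v v"
proof -
  have c: "continuous_on K (\<lambda>x. a * u x + b * v x)" using assms by (intro continuous_intros)
  show ?thesis
    unfolding inner_L2_linear_left[OF assms c]
      inner_L2_commute[of u "\<lambda>x. a * u x + b * v x"] inner_L2_commute[of v "\<lambda>x. a * u x + b * v x"]
      inner_L2_linear_left[OF assms assms(1)] inner_L2_linear_left[OF assms assms(2)] inner_L2_commute[of v u]
    by (simp add: power2_eq_square algebra_simps)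
qed

lemma continuous_on_comp_cell:
  "continuous_on K u \<Longrightarrow> w \<in> words k m \<Longrightarrow> continuous_on K (u \<circ> cell F w)"
proof (induction m arbitrary: u w)
  case (Suc m)
  then obtain i v where w: "w = i # v" "i < k" "v \<in> words k m" by (auto simp: words_Suc)
  show ?case
    using Suc.IH[OF continuous_on_comp_F[OF Suc.prems(1) w(2)] w(3)] by (simp add: w comp_def)
qed simp

lemma integral_words:
  fixes u :: "'a \<Rightarrow> real"
  assumes "continuous_on K u"
  shows "(LINT x|\<mu>. u x) = (1 / real k) ^ m * (\<Sum>w\<in>words k m. LINT x|\<mu>. u (cell F w x))"
  using assms
proof (induction m arbitrary: u)
  case (Suc m)
  have "(LINT x|\<mu>. u (F i x)) = (1 / real k) ^ m * (\<Sum>w\<in>words k m. LINT x|\<mu>. u (F i (cell F w x)))"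
    if "i < k" for i
    using Suc.IH[OF continuous_on_comp_F[OF Suc.prems that]] by (simp add: comp_def)
  then show ?case
    by (simp add: integral_cells[OF Suc.prems] sum_words_Suc comp_def sum_distrib_left)
qed simp

lemma inner_L2_words:
  assumes "continuous_on K u" "continuous_on K v"
  shows "inner_L2 u v = (1 / real k) ^ m * (\<Sum>w\<in>words k m. inner_L2 (u \<circ> cell F w) (v \<circ> cell F w))"
  unfolding inner_L2_def comp_def
  using assms by (intro integral_words continuous_intros)

text \<open>The measure has full support: near \<open>x\<close> the function is bounded away from \<open>0\<close> on a whole cell, and the integral
  over \<open>K\<close> is a positive multiple of the sum of the integrals over the cells of that level.\<close>

lemma inner_L2_pos:
  assumes u: "continuous_on K u" and x: "x \<in> K" "u x \<noteq> 0"
  shows "0 < inner_L2 u u"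
proof -
  define e where "e = \<bar>u x\<bar> / 2"
  have e: "e > 0" using x by (simp add: e_def)
  obtain d where d: "d > 0" "\<And>y. y \<in> K \<Longrightarrow> dist y x < d \<Longrightarrow> dist (u y) (u x) < e"
    using u x(1) e unfolding continuous_on_iff by metis
  obtain n where n: "\<forall>w\<in>words k n. \<forall>x\<in>K. \<forall>y\<in>K. dist (cell F w x) (cell F w y) < d"
    using cells_shrink[OF d(1)] by blast
  obtain w y where wy: "w \<in> words k n" "y \<in> K" "x = cell F w y" using K_cell_cases[OF x(1)] by blast
  have far: "e \<le> \<bar>u (cell F w z)\<bar>" if "z \<in> K" for z
  proof -
    have "dist (u (cell F w z)) (u x) < e"
      using n wy that by (intro d(2) cell_in_K) auto
    then have "\<bar>u (cell F w z) - u x\<bar> < \<bar>u x\<bar> / 2" by (simp add: dist_real_def e_def)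
    then show ?thesis unfolding e_def by linarith
  qed
  have sq: "e\<^sup>2 \<le> u (cell F w z) * u (cell F w z)" if "z \<in> K" for z
    using power_mono[OF far[OF that], of 2] e by (simp add: power2_eq_square)
  have "continuous_on K (\<lambda>z. u (cell F w z) * u (cell F w z))"
    using continuous_on_comp_cell[OF u wy(1)] by (auto simp: comp_def intro!: continuous_intros)
  then have "e\<^sup>2 \<le> inner_L2 (u \<circ> cell F w) (u \<circ> cell F w)"
    unfolding inner_L2_def comp_def
    using sq by (intro integral_ge_const integrable_continuous) auto
  also have "\<dots> \<le> (\<Sum>w\<in>words k n. inner_L2 (u \<circ> cell F w) (u \<circ> cell F w))"
    using wy(1) inner_L2_self_nonneg by (intro member_le_sum) auto
  finally have "0 < (\<Sum>w\<in>words k n. inner_L2 (u \<circ> cell F w) (u \<circ> cell F w))"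
    using e by (meson less_le_trans zero_less_power)
  then show ?thesis
    using k3 by (simp add: inner_L2_words[OF u u, of n])
qed

text \<open>Rayleigh quotients grow by this factor from one level to the next: energies by \<open>1 / r\<close>, and \<open>L\<^sup>2\<close> norms
  squared shrink by \<open>1 / k\<close>.\<close>

definition scaling :: real where "scaling = real k / r"

lemma scaling_gt_1: "1 < scaling"
  using r_pos r_less_1 k3 by (simp add: scaling_def)

text \<open>In each cell the function vanishes at the image of \<open>p 0\<close>, so the oscillation bound controls its supremum there by
  its energy there.\<close>

lemma rayleigh_lower_bound:
  assumes u: "u \<in> finite_energy" and zero: "\<And>w. w \<in> words k m \<Longrightarrow> u (cell F w (p 0)) = 0"
  shows "scaling ^ m * inner_L2 u u \<le> osc_const\<^sup>2 * limit_energy u"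
proof -
  have cont: "continuous_on K u" using u by (rule finite_energy_continuous)
  have "inner_L2 (u \<circ> cell F w) (u \<circ> cell F w) \<le> osc_const\<^sup>2 * limit_energy (u \<circ> cell F w)"
    if w: "w \<in> words k m" for w
  proof -
    define v where "v = u \<circ> cell F w"
    have v: "v \<in> finite_energy" "v (p 0) = 0"
      using finite_energy_comp_cell[OF u w] zero[OF w] by (simp_all add: v_def)
    have "v x * v x \<le> osc_const\<^sup>2 * limit_energy v" if "x \<in> K" for x
    proof -
      have "(v x)\<^sup>2 \<le> (osc_const * sqrt (limit_energy v))\<^sup>2"
        using power_mono[OF oscillation_bound[OF v(1) that], of 2] v(2) by simp
      then show ?thesis
        using limit_energy_nonneg[OF v(1)] by (simp add: power_mult_distrib power2_eq_square[of "v x"])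
    qed
    then have "inner_L2 v v \<le> osc_const\<^sup>2 * limit_energy v"
      unfolding inner_L2_def using v(1)
      by (intro integral_le_const integrable_continuous continuous_intros finite_energy_continuous) auto
    then show ?thesis by (simp add: v_def)
  qed
  then have "(\<Sum>w\<in>words k m. inner_L2 (u \<circ> cell F w) (u \<circ> cell F w))
      \<le> (\<Sum>w\<in>words k m. osc_const\<^sup>2 * limit_energy (u \<circ> cell F w))"
    by (rule sum_mono)
  also have "\<dots> = osc_const\<^sup>2 * (r ^ m * limit_energy u)"
    using r_pos by (simp add: limit_energy_cells[OF u, of m] power_inverse flip: sum_distrib_left)
  finally have "scaling ^ m * inner_L2 u u \<le> scaling ^ m * ((1 / real k) ^ m * (osc_const\<^sup>2 * (r ^ m * limit_energy u)))"
    using scaling_gt_1 by (simp add: inner_L2_words[OF cont cont, of m] divide_right_mono mult_left_mono)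
  also have "\<dots> = osc_const\<^sup>2 * limit_energy u"
    using r_pos k3 by (simp add: scaling_def power_divide)
  finally show ?thesis .
qed

definition bump_rayleigh :: real where
  "bump_rayleigh = limit_energy bump / inner_L2 bump bump"

lemma continuous_on_bump: "continuous_on K bump" and continuous_on_bumps: "continuous_on K (bumps m c)"
  by (rule finite_energy_continuous bump_finite_energy bumps_finite_energy)+

lemma inner_L2_bump_pos: "0 < inner_L2 bump bump"
  using bump_nonzero inner_L2_pos[OF continuous_on_bump] by blast

lemma inner_L2_bumps:
  assumes v: "continuous_on K v"
  shows "inner_L2 (bumps m c) v = (1 / real k) ^ m * (\<Sum>w\<in>words k m. c w * inner_L2 bump (v \<circ> cell F w))"
proof -
  have "inner_L2 (bumps m c \<circ> cell F w) (v \<circ> cell F w) = c w * inner_L2 bump (v \<circ> cell F w)"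
    if w: "w \<in> words k m" for w
  proof -
    have "inner_L2 (bumps m c \<circ> cell F w) (v \<circ> cell F w) = (LINT x|\<mu>. c w * (bump x * v (cell F w x)))"
      unfolding inner_L2_def using w by (intro Bochner_Integration.integral_cong) (auto simp: bumps_cell)
    then show ?thesis by (simp add: inner_L2_def)
  qed
  then have "(\<Sum>w\<in>words k m. inner_L2 (bumps m c \<circ> cell F w) (v \<circ> cell F w))
      = (\<Sum>w\<in>words k m. c w * inner_L2 bump (v \<circ> cell F w))"
    by (rule sum.cong[OF refl])
  then show ?thesis using inner_L2_words[OF continuous_on_bumps v, of m c m] by (simp only:)
qed

lemma inner_L2_bumps_self:
  "inner_L2 (bumps m c) (bumps m c) = (1 / real k) ^ m * inner_L2 bump bump * (\<Sum>w\<in>words k m. (c w)\<^sup>2)"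
proof -
  have "inner_L2 bump (bumps m c \<circ> cell F w) = c w * inner_L2 bump bump" if w: "w \<in> words k m" for w
  proof -
    have "inner_L2 bump (bumps m c \<circ> cell F w) = (LINT x|\<mu>. c w * (bump x * bump x))"
      unfolding inner_L2_def using w by (intro Bochner_Integration.integral_cong) (auto simp: bumps_cell)
    then show ?thesis by (simp add: inner_L2_def)
  qed
  then show ?thesis
    by (simp add: inner_L2_bumps[OF continuous_on_bumps] mult.assoc sum_distrib_left power2_eq_square)
      (simp add: mult_ac)
qed

lemma limit_energy_bumps_rayleigh:
  "limit_energy (bumps m c) = bump_rayleigh * scaling ^ m * inner_L2 (bumps m c) (bumps m c)"
  using inner_L2_bump_pos r_pos k3
  by (simp add: limit_energy_bumps inner_L2_bumps_self bump_rayleigh_def scaling_def power_divide power_inverse field_simps)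

lemma inner_L2_bumps_pos:
  assumes "w \<in> words k m" "c w \<noteq> 0"
  shows "0 < inner_L2 (bumps m c) (bumps m c)"
proof -
  have "(c w)\<^sup>2 \<le> (\<Sum>w\<in>words k m. (c w)\<^sup>2)"
    using assms by (intro member_le_sum) auto
  then have "0 < (\<Sum>w\<in>words k m. (c w)\<^sup>2)"
    using assms by (meson less_le_trans zero_less_power2)
  then show ?thesis using inner_L2_bump_pos k3 by (simp add: inner_L2_bumps_self)
qed

section \<open>Compactness\<close>

lemma E_tendsto_pointwise:
  assumes "\<And>x. x \<in> K \<Longrightarrow> (\<lambda>n. v n x) \<longlonglongrightarrow> g x"
  shows "(\<lambda>n. E m (v n)) \<longlonglongrightarrow> E m g"
  using assms
proof (induction m arbitrary: v g)
  case 0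
  then show ?case unfolding E_0 simplex_form_def
    by (intro tendsto_intros) (auto simp: vertex_in_K)
next
  case (Suc m)
  have "(\<lambda>n. E m (v n \<circ> F i)) \<longlonglongrightarrow> E m (g \<circ> F i)" if "i < k" for i
    by (rule Suc.IH) (simp add: Suc.prems F_in_K that)
  then show ?case by (auto intro!: tendsto_intros)
qed

text \<open>If the value at \<open>p 0\<close> exceeded \<open>1\<close> by more than the oscillation, the function would exceed \<open>1\<close> in absolute value
  everywhere, and its norm would be larger than \<open>1\<close>.\<close>

lemma normalized_sup_bound:
  assumes v: "v \<in> finite_energy" "inner_L2 v v \<le> 1" "limit_energy v \<le> C" and x: "x \<in> K"
  shows "\<bar>v x\<bar> \<le> 1 + 2 * (osc_const * sqrt C)"
proof -
  define D where "D = osc_const * sqrt C"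
  have osc: "\<bar>v x - v (p 0)\<bar> \<le> D" if "x \<in> K" for x
    using oscillation_bound[OF v(1) that] osc_const_nonneg v(3) unfolding D_def
    by (meson mult_left_mono order_trans real_sqrt_le_mono)
  have "\<bar>v (p 0)\<bar> \<le> 1 + D"
  proof (rule ccontr)
    assume big: "\<not> \<bar>v (p 0)\<bar> \<le> 1 + D"
    define c where "c = \<bar>v (p 0)\<bar> - D"
    have c: "c > 1" using big by (simp add: c_def)
    have "c\<^sup>2 \<le> v x * v x" if "x \<in> K" for x
    proof -
      have "c \<le> \<bar>v x\<bar>" using osc[OF that] unfolding c_def by linarith
      then show ?thesis using power_mono[of c "\<bar>v x\<bar>" 2] c by (simp add: power2_eq_square)
    qed
    then have "c\<^sup>2 \<le> inner_L2 v v"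
      unfolding inner_L2_def using v(1)
      by (intro integral_ge_const integrable_continuous continuous_intros finite_energy_continuous) auto
    moreover have "c\<^sup>2 > 1" using c by (simp add: power2_eq_square less_1_mult)
    ultimately show False using v(2) by linarith
  qed
  then show ?thesis using osc[OF x] unfolding D_def by linarith
qed

text \<open>Equicontinuity. The cells of level \<open>m\<close> that miss \<open>x\<close> form a closed set, so every point close to \<open>x\<close> shares a
  cell of level \<open>m\<close> with \<open>x\<close>, and in such a cell the oscillation is small.\<close>

lemma local_modulus:
  assumes x: "x \<in> K" and e: "0 < e"
  shows "\<exists>d>0. \<forall>v\<in>finite_energy. limit_energy v \<le> C \<longrightarrow> (\<forall>y\<in>K. dist x y < d \<longrightarrow> \<bar>v x - v y\<bar> < e)"
proof -
  have "(\<lambda>m. 2 * osc_const * sqrt (r ^ m * C)) \<longlonglongrightarrow> 2 * osc_const * sqrt (0 * C)"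
    using r_pos r_less_1 by (intro tendsto_intros LIMSEQ_realpow_zero) auto
  then have "eventually (\<lambda>m. 2 * osc_const * sqrt (r ^ m * C) < e) sequentially"
    using e by (auto intro: order_tendstoD)
  then obtain m where m: "2 * osc_const * sqrt (r ^ m * C) < e" by (auto simp: eventually_sequentially)
  define far where "far = (\<Union>w\<in>{w \<in> words k m. x \<notin> cell F w ` K}. cell F w ` K)"
  have cont_cell: "continuous_on K (cell F w)" if "w \<in> words k m" for w m
    using that
  proof (induction m arbitrary: w)
    case (Suc m)
    then obtain i v where w: "w = i # v" "i < k" "v \<in> words k m" by (auto simp: words_Suc)
    have "continuous_on K (\<lambda>x. F i (cell F v x))"
      by (rule continuous_on_compose2[OF F_continuous[OF w(2)] Suc.IH[OF w(3)]])
        (use cell_in_K w in auto)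
    then show ?case by (simp add: w comp_def)
  qed simp
  have "closed far"
    unfolding far_def
    by (rule closed_UN) (auto intro!: compact_imp_closed compact_continuous_image K_compact cont_cell)
  moreover have "x \<notin> far" by (auto simp: far_def)
  ultimately obtain d where d: "d > 0" "\<And>y. dist x y < d \<Longrightarrow> y \<notin> far"
    using open_contains_ball[of "- far"] by (auto simp: open_Compl subset_iff)
  have "\<bar>v x - v y\<bar> < e" if v: "v \<in> finite_energy" "limit_energy v \<le> C" and y: "y \<in> K" "dist x y < d" for v y
  proof -
    obtain w z where w: "w \<in> words k m" "z \<in> K" "y = cell F w z" using K_cell_cases[OF y(1)] by blast
    have "x \<in> cell F w ` K" using d(2)[OF y(2)] w by (auto simp: far_def)
    then obtain z' where z': "z' \<in> K" "x = cell F w z'" by blast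
    have "\<bar>v x - v y\<bar> \<le> 2 * osc_const * sqrt (r ^ m * limit_energy v)"
      using cell_oscillation_bound[OF v(1) w(1) z'(1) w(2)] z' w by simp
    also have "\<dots> \<le> 2 * osc_const * sqrt (r ^ m * C)"
      using v(2) r_pos osc_const_nonneg by (intro mult_left_mono) auto
    finally show ?thesis using m by simp
  qed
  with d(1) show ?thesis by blast
qed

text \<open>A uniformly convergent subsequence exists by the theorem of Arzela and Ascoli. The energies \<open>E m\<close> involve finitely
  many values, so they pass to the limit, and their supremum over \<open>m\<close> is lower semicontinuous.\<close>

lemma compactness:
  assumes v: "\<And>n. v n \<in> finite_energy" "\<And>n. inner_L2 (v n) (v n) = 1"
    and lim: "(\<lambda>n. limit_energy (v n)) \<longlonglongrightarrow> l"
  obtains g and \<kappa> :: "nat \<Rightarrow> nat" where "g \<in> finite_energy" "limit_energy g \<le> l"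
    "\<And>u. continuous_on K u \<Longrightarrow> (\<lambda>n. inner_L2 (v (\<kappa> n)) u) \<longlonglongrightarrow> inner_L2 g u"
    "inner_L2 g g = 1"
proof -
  obtain C where C: "\<And>n. \<bar>limit_energy (v n)\<bar> \<le> C"
    using convergent_imp_Bseq[OF convergentI[OF lim]] by (auto simp: Bseq_def)
  then have C: "limit_energy (v n) \<le> C" for n by (meson abs_le_D1)
  define M where "M = 1 + 2 * (osc_const * sqrt C)"
  have M: "\<bar>v n x\<bar> \<le> M" if "x \<in> K" for n x
    using normalized_sup_bound[OF v(1) _ C that, of n] v(2) by (simp add: M_def)
  have equi: "\<exists>d>0. \<forall>n y. y \<in> K \<and> norm (x - y) < d \<longrightarrow> norm (v n x - v n y) < e" if "x \<in> K" "0 < e" for x e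
    using local_modulus[OF that, of C] v(1) C by (auto simp: dist_norm)
  obtain g and \<kappa> :: "nat \<Rightarrow> nat" where g: "continuous_on K g" "strict_mono \<kappa>"
    "\<And>e. 0 < e \<Longrightarrow> \<exists>N. \<forall>n x. n \<ge> N \<and> x \<in> K \<longrightarrow> norm (v (\<kappa> n) x - g x) < e"
    by (rule Arzela_Ascoli[OF K_compact, of v M]) (use M equi in auto)
  have point: "(\<lambda>n. v (\<kappa> n) x) \<longlonglongrightarrow> g x" if "x \<in> K" for x
    using g(3) that unfolding lim_sequentially dist_norm by blast
  have limk: "(\<lambda>n. limit_energy (v (\<kappa> n))) \<longlonglongrightarrow> l"
    using LIMSEQ_subseq_LIMSEQ[OF lim g(2)] by (simp add: comp_def)
  have Eg: "E m g \<le> l" for m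
    using LIMSEQ_le[OF E_tendsto_pointwise[OF point, of "\<lambda>x. x" m] limk] E_le_limit_energy[OF v(1)] by auto
  have gW: "g \<in> finite_energy" using g(1) Eg by (rule finite_energyI)
  have cv: "continuous_on K (v n)" for n using v(1) by (rule finite_energy_continuous)
  have weak: "(\<lambda>n. inner_L2 (v (\<kappa> n)) u) \<longlonglongrightarrow> inner_L2 g u" if u: "continuous_on K u" for u
    unfolding inner_L2_def
  proof (rule integral_dominated_convergence)
    show "(\<lambda>x. g x * u x) \<in> borel_measurable \<mu>" "(\<lambda>x. v (\<kappa> i) x * u x) \<in> borel_measurable \<mu>" for i
      using g(1) u cv by (auto intro!: measurable_continuous continuous_intros)
    show "integrable \<mu> (\<lambda>x. M * \<bar>u x\<bar>)"
      using u by (intro integrable_continuous continuous_intros)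
    show "AE x in \<mu>. (\<lambda>i. v (\<kappa> i) x * u x) \<longlonglongrightarrow> g x * u x"
      by (intro AE_I2 tendsto_intros point) simp
    show "AE x in \<mu>. norm (v (\<kappa> i) x * u x) \<le> M * \<bar>u x\<bar>" for i
      using M by (intro AE_I2) (auto simp: abs_mult intro!: mult_right_mono)
  qed
  have "(\<lambda>n. inner_L2 (v (\<kappa> n)) (v (\<kappa> n))) \<longlonglongrightarrow> inner_L2 g g"
    unfolding inner_L2_def
  proof (rule integral_dominated_convergence)
    show "(\<lambda>x. g x * g x) \<in> borel_measurable \<mu>" "(\<lambda>x. v (\<kappa> i) x * v (\<kappa> i) x) \<in> borel_measurable \<mu>" for i
      using g(1) cv by (auto intro!: measurable_continuous continuous_intros)
    show "integrable \<mu> (\<lambda>x. M * M)" by simp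
    show "AE x in \<mu>. (\<lambda>i. v (\<kappa> i) x * v (\<kappa> i) x) \<longlonglongrightarrow> g x * g x"
      by (intro AE_I2 tendsto_intros point) auto
    show "AE x in \<mu>. norm (v (\<kappa> i) x * v (\<kappa> i) x) \<le> M * M" for i
    proof (rule AE_I2)
      fix x assume "x \<in> space \<mu>"
      then have "\<bar>v (\<kappa> i) x\<bar> \<le> M" using M by simp
      then show "norm (v (\<kappa> i) x * v (\<kappa> i) x) \<le> M * M"
        using mult_mono[of "\<bar>v (\<kappa> i) x\<bar>" M "\<bar>v (\<kappa> i) x\<bar>" M] by (simp add: abs_mult)
    qed
  qed
  then have "inner_L2 g g = 1" by (simp add: v(2) LIMSEQ_const_iff)
  have "limit_energy g \<le> l"
    using LIMSEQ_le_const2[OF limit_energy_tendsto[OF gW]] Eg by blast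
  show thesis by (rule that) fact+
qed

end

section \<open>Existence of eigenfunctions\<close>

lemma nonneg_quadratic_linear_coeff:
  fixes a b :: real
  assumes "0 \<le> a" "\<And>t. 0 \<le> 2 * t * b + t\<^sup>2 * a"
  shows "b = 0"
proof (rule ccontr)
  assume b: "b \<noteq> 0"
  (* the denominator a + 1 rather than a keeps this choice of t meaningful for a = 0 *)
  have "2 * (- b / (a + 1)) * b + (- b / (a + 1))\<^sup>2 * a = - (b\<^sup>2 * (a + 2)) / (a + 1)\<^sup>2"
    using assms(1) by (simp add: power2_eq_square divide_simps) (simp add: algebra_simps)
  moreover have "- (b\<^sup>2 * (a + 2)) / (a + 1)\<^sup>2 < 0"
    using assms(1) b by (intro divide_neg_pos) auto
  ultimately show False using assms(2)[of "- b / (a + 1)"] by linarith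
qed

context glued_cells_measure
begin

definition eigenfunction :: "real \<Rightarrow> ('a \<Rightarrow> real) \<Rightarrow> bool" where
  "eigenfunction l w \<longleftrightarrow> w \<in> finite_energy \<and> (\<forall>v\<in>finite_energy. energy_form w v = l * inner_L2 w v)"

lemma eigenfunctionD:
  "eigenfunction l w \<Longrightarrow> w \<in> finite_energy" "eigenfunction l w \<Longrightarrow> continuous_on K w"
  "eigenfunction l w \<Longrightarrow> v \<in> finite_energy \<Longrightarrow> energy_form w v = l * inner_L2 w v"
  by (auto simp: eigenfunction_def finite_energy_continuous)

text \<open>A minimising sequence on the unit sphere of the constraint space has a limit by compactness; the norm and the
  constraints pass to the limit, and the energy does not increase.\<close>

lemma constrained_minimiser:
  fixes n :: nat
  assumes z: "\<And>i. i < n \<Longrightarrow> continuous_on K (z i)"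
    and t: "t \<in> finite_energy" "0 < inner_L2 t t" "\<And>i. i < n \<Longrightarrow> inner_L2 t (z i) = 0"
  shows "\<exists>g\<in>finite_energy. inner_L2 g g = 1 \<and> (\<forall>i<n. inner_L2 g (z i) = 0) \<and>
    (\<forall>u\<in>finite_energy. (\<forall>i<n. inner_L2 u (z i) = 0) \<longrightarrow> limit_energy g * inner_L2 u u \<le> limit_energy u)"
proof -
  define S where "S = {u \<in> finite_energy. inner_L2 u u = 1 \<and> (\<forall>i<n. inner_L2 u (z i) = 0)}"
  have scaled: "(\<lambda>x. c * u x + 0 * u x) \<in> finite_energy"
    "limit_energy (\<lambda>x. c * u x + 0 * u x) = c\<^sup>2 * limit_energy u"
    "inner_L2 (\<lambda>x. c * u x + 0 * u x) (\<lambda>x. c * u x + 0 * u x) = c\<^sup>2 * inner_L2 u u"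
    "\<And>v. continuous_on K v \<Longrightarrow> inner_L2 (\<lambda>x. c * u x + 0 * u x) v = c * inner_L2 u v"
    if u: "u \<in> finite_energy" for u c
    using finite_energy_combination[OF u u, of c 0] limit_energy_combination[OF u u, of c 0]
      inner_L2_combination_self[of u u c 0] inner_L2_linear_left[of u u _ c 0] finite_energy_continuous[OF u]
    by simp_all
  have normalise: "\<exists>s\<in>S. limit_energy s * inner_L2 u u = limit_energy u"
    if u: "u \<in> finite_energy" "\<And>i. i < n \<Longrightarrow> inner_L2 u (z i) = 0" "0 < inner_L2 u u" for u
  proof -
    define c where "c = 1 / sqrt (inner_L2 u u)"
    have c: "c\<^sup>2 * inner_L2 u u = 1" using u(3) by (simp add: c_def power_divide)
    have "inner_L2 (\<lambda>x. c * u x + 0 * u x) (z i) = 0" if "i < n" for i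
      unfolding scaled(4)[OF u(1) z[OF that]] using u(2)[OF that] by simp
    then have "(\<lambda>x. c * u x + 0 * u x) \<in> S"
      unfolding S_def mem_Collect_eq using scaled(1,3)[OF u(1), of c] c by simp
    moreover have "c\<^sup>2 * limit_energy u * inner_L2 u u = limit_energy u"
      using c by (simp add: mult.commute mult.left_commute)
    ultimately show ?thesis using scaled(2)[OF u(1), of c] by metis
  qed
  define m where "m = Inf (limit_energy ` S)"
  have bdd: "bdd_below (limit_energy ` S)"
    by (rule bdd_belowI2[of _ 0]) (simp add: S_def limit_energy_nonneg)
  have ne: "limit_energy ` S \<noteq> {}" using normalise[OF t(1,3,2)] by auto
  have "\<exists>v\<in>S. limit_energy v < m + 1 / real (Suc j)" for j
    using cInf_lessD[OF ne, of "m + 1 / real (Suc j)"] by (auto simp: m_def)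
  then obtain v where v: "\<And>j. v j \<in> S" "\<And>j. limit_energy (v j) < m + 1 / real (Suc j)" by metis
  have low: "m \<le> limit_energy s" if "s \<in> S" for s
    using that bdd by (auto simp: m_def intro: cInf_lower)
  have lim: "(\<lambda>j. limit_energy (v j)) \<longlonglongrightarrow> m"
  proof (rule tendsto_sandwich[of "\<lambda>_. m" _ _ "\<lambda>j. m + 1 / real (Suc j)"])
    show "(\<lambda>j. m + 1 / real (Suc j)) \<longlonglongrightarrow> m"
      using tendsto_add[OF tendsto_const LIMSEQ_Suc[OF lim_1_over_n]] by simp
    show "\<forall>\<^sub>F j in sequentially. m \<le> limit_energy (v j)" using low v(1) by simp
    show "\<forall>\<^sub>F j in sequentially. limit_energy (v j) \<le> m + 1 / real (Suc j)"
      using v(2) by (auto intro!: always_eventually less_imp_le)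
  qed simp
  have vS: "v j \<in> finite_energy" "inner_L2 (v j) (v j) = 1" "\<And>i. i < n \<Longrightarrow> inner_L2 (v j) (z i) = 0" for j
    using v(1)[of j] by (auto simp: S_def)
  obtain g and \<kappa> :: "nat \<Rightarrow> nat" where g: "g \<in> finite_energy" "limit_energy g \<le> m"
    "\<And>u. continuous_on K u \<Longrightarrow> (\<lambda>j. inner_L2 (v (\<kappa> j)) u) \<longlonglongrightarrow> inner_L2 g u" "inner_L2 g g = 1"
    using compactness[of v m, OF vS(1,2) lim] by blast
  show ?thesis
  proof (intro bexI[OF _ g(1)] conjI g(4) ballI allI impI)
    show "inner_L2 g (z i) = 0" if "i < n" for i
      using g(3)[OF z[OF that]] vS(3)[OF that] by (simp add: LIMSEQ_const_iff)
    fix u assume "u \<in> finite_energy" "\<forall>i<n. inner_L2 u (z i) = 0"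
    then have u: "u \<in> finite_energy" "\<And>i. i < n \<Longrightarrow> inner_L2 u (z i) = 0" by auto
    show "limit_energy g * inner_L2 u u \<le> limit_energy u"
    proof (cases "inner_L2 u u = 0")
      case True
      then show ?thesis using limit_energy_nonneg[OF u(1)] by simp
    next
      case False
      then have pos: "0 < inner_L2 u u" using inner_L2_self_nonneg[of u] by linarith
      then obtain s where s: "s \<in> S" "limit_energy s * inner_L2 u u = limit_energy u"
        using normalise[OF u] by blast
      have "limit_energy g \<le> limit_energy s" using g(2) low[OF s(1)] by linarith
      then have "limit_energy g * inner_L2 u u \<le> limit_energy s * inner_L2 u u"
        using pos by (intro mult_right_mono) auto
      then show ?thesis by (simp add: s(2))
    qed
  qed
qed

text \<open>The minimiser of the Rayleigh quotient on the orthogonal complement of the given eigenfunctions satisfies the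
  Euler-Lagrange equation for test functions in that complement. A general test function differs from one of these by a
  combination of the given eigenfunctions, on which both sides of the equation vanish. The function \<open>t\<close>
  shows that the complement is nontrivial and bounds the minimum by \<open>x\<close>.\<close>

lemma next_eigenfunction:
  fixes n :: nat
  assumes z: "\<And>i. i < n \<Longrightarrow> eigenfunction (l i) (z i)"
    and ortho: "\<And>i j. i < n \<Longrightarrow> j < n \<Longrightarrow> inner_L2 (z i) (z j) = (if i = j then 1 else 0)"
    and t: "t \<in> finite_energy" "0 < inner_L2 t t" "\<And>i. i < n \<Longrightarrow> inner_L2 t (z i) = 0"
      "limit_energy t \<le> x * inner_L2 t t"
  shows "\<exists>l' g. l' \<le> x \<and> eigenfunction l' g \<and> inner_L2 g g = 1 \<and> (\<forall>i<n. inner_L2 g (z i) = 0)"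
proof -
  have zc: "continuous_on K (z i)" and zW: "z i \<in> finite_energy" if "i < n" for i
    using eigenfunctionD[OF z[OF that]] by auto
  obtain g where g0: "g \<in> finite_energy" "inner_L2 g g = 1" "\<forall>i<n. inner_L2 g (z i) = 0"
    and min0: "\<forall>u\<in>finite_energy. (\<forall>i<n. inner_L2 u (z i) = 0) \<longrightarrow> limit_energy g * inner_L2 u u \<le> limit_energy u"
    using constrained_minimiser[of n z t, OF zc t(1-3)] by blast
  have g: "g \<in> finite_energy" "inner_L2 g g = 1" "\<And>i. i < n \<Longrightarrow> inner_L2 g (z i) = 0"
    using g0 by auto
  have min: "limit_energy g * inner_L2 u u \<le> limit_energy u"
    if "u \<in> finite_energy" "\<And>i. i < n \<Longrightarrow> inner_L2 u (z i) = 0" for u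
    using min0 that by blast
  define l' where "l' = limit_energy g"
  have gc: "continuous_on K g" using g(1) by (rule finite_energy_continuous)
  have "l' * inner_L2 t t \<le> x * inner_L2 t t" using min[OF t(1,3)] t(4) by (simp add: l'_def)
  then have "l' \<le> x" using t(2) by simp
  have variation: "energy_form g u = l' * inner_L2 g u"
    if u: "u \<in> finite_energy" "\<And>i. i < n \<Longrightarrow> inner_L2 u (z i) = 0" for u
  proof -
    have uc: "continuous_on K u" using u(1) by (rule finite_energy_continuous)
    have "energy_form g u - l' * inner_L2 g u = 0"
    proof (rule nonneg_quadratic_linear_coeff)
      show "0 \<le> limit_energy u - l' * inner_L2 u u" using min[OF u] by (simp add: l'_def)
      fix s :: real
      have comb: "(\<lambda>x. 1 * g x + s * u x) \<in> finite_energy"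
        by (rule finite_energy_combination[OF g(1) u(1)])
      have "inner_L2 (\<lambda>x. 1 * g x + s * u x) (z i) = 0" if "i < n" for i
        unfolding inner_L2_linear_left[OF gc uc zc[OF that]] using g(3) u(2) that by simp
      from min[OF comb this]
      have "l' * (1 + 2 * s * inner_L2 g u + s\<^sup>2 * inner_L2 u u)
          \<le> l' + 2 * s * energy_form g u + s\<^sup>2 * limit_energy u"
        unfolding inner_L2_combination_self[OF gc uc] limit_energy_combination[OF g(1) u(1)]
        by (simp add: g(2) l'_def)
      then show "0 \<le> 2 * s * (energy_form g u - l' * inner_L2 g u) + s\<^sup>2 * (limit_energy u - l' * inner_L2 u u)"
        by (simp add: algebra_simps)
    qed
    then show ?thesis by simp
  qed
  have "eigenfunction l' g"
    unfolding eigenfunction_def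
  proof (intro conjI ballI)
    show "g \<in> finite_energy" by (rule g(1))
    fix u assume u: "u \<in> finite_energy"
    have uc: "continuous_on K u" using u by (rule finite_energy_continuous)
    define s where "s x = (\<Sum>i<n. inner_L2 u (z i) * z i x)" for x
    have sW: "s \<in> finite_energy" unfolding s_def using zW by (intro finite_energy_sum) auto
    have sc: "continuous_on K s" using sW by (rule finite_energy_continuous)
    have s_inner: "inner_L2 s v = (\<Sum>i<n. inner_L2 u (z i) * inner_L2 (z i) v)" if "continuous_on K v" for v
      unfolding s_def using zc that by (intro inner_L2_sum_left) auto
    have s_energy: "energy_form s v = (\<Sum>i<n. inner_L2 u (z i) * energy_form (z i) v)" if "v \<in> finite_energy" for v
      unfolding s_def using zW that by (intro energy_form_sum_left) auto
    have g_s: "inner_L2 s g = 0" using s_inner[OF gc] g(3) inner_L2_commute[of g] by simp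
    have "energy_form (z i) g = 0" if "i < n" for i
      using eigenfunctionD(3)[OF z[OF that] g(1)] g(3)[OF that] inner_L2_commute[of g] by simp
    then have e_s: "energy_form s g = 0" using s_energy[OF g(1)] by simp
    have proj: "inner_L2 s (z i) = inner_L2 u (z i)" if "i < n" for i
      using that by (simp add: s_inner[OF zc[OF that]] ortho if_distrib[of "\<lambda>c. _ * c"] cong: if_cong)
    (* combinations are written with both coefficients to match the linearity lemmas *)
    define d where "d x = 1 * u x + (- 1) * s x" for x
    have dW: "d \<in> finite_energy" unfolding d_def by (rule finite_energy_combination[OF u sW])
    have "inner_L2 d (z i) = 0" if "i < n" for i
      unfolding d_def inner_L2_linear_left[OF uc sc zc[OF that]] using proj[OF that] by simp
    then have "energy_form g d = l' * inner_L2 g d" by (rule variation[OF dW])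
    moreover have "energy_form d g = energy_form u g"
      unfolding d_def energy_form_linear_left[OF u sW g(1)] using e_s by simp
    moreover have "inner_L2 d g = inner_L2 u g"
      unfolding d_def inner_L2_linear_left[OF uc sc gc] using g_s by simp
    ultimately show "energy_form g u = l' * inner_L2 g u"
      by (simp add: energy_form_commute[of g] inner_L2_commute[of g])
  qed
  then show ?thesis using \<open>l' \<le> x\<close> g by blast
qed

text \<open>As long as fewer than \<open>k ^ m\<close> eigenfunctions have been found, some nonzero combination of bumps in the cells of
  level \<open>m\<close> is orthogonal to all of them and bounds the next eigenvalue.\<close>

lemma orthonormal_eigenfunctions:
  assumes "n \<le> k ^ m"
  shows "\<exists>l z. (\<forall>i<n. l i \<le> bump_rayleigh * scaling ^ m \<and> eigenfunction (l i) (z i))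
    \<and> (\<forall>i<n. \<forall>j<n. inner_L2 (z i) (z j) = (if i = j then 1 else 0))"
  using assms
proof (induction n)
  case (Suc n)
  have "n \<le> k ^ m" using Suc.prems by simp
  then obtain l z where lz: "\<forall>i<n. l i \<le> bump_rayleigh * scaling ^ m \<and> eigenfunction (l i) (z i)"
    "\<forall>i<n. \<forall>j<n. inner_L2 (z i) (z j) = (if i = j then 1 else 0)"
    using Suc.IH by blast
  have IH: "\<And>i. i < n \<Longrightarrow> l i \<le> bump_rayleigh * scaling ^ m"
    "\<And>i. i < n \<Longrightarrow> eigenfunction (l i) (z i)"
    "\<And>i j. i < n \<Longrightarrow> j < n \<Longrightarrow> inner_L2 (z i) (z j) = (if i = j then 1 else 0)"
    using lz by blast+
  have "\<exists>c. (\<exists>w\<in>words k m. c w \<noteq> 0) \<and>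
      (\<forall>i\<in>{..<n}. (\<Sum>w\<in>words k m. c w * inner_L2 bump (z i \<circ> cell F w)) = 0)"
    using Suc.prems by (intro homogeneous_system_nontrivial_solution) (auto simp: card_words)
  then obtain c w where c: "w \<in> words k m" "c w \<noteq> 0"
    "\<And>i. i < n \<Longrightarrow> (\<Sum>w\<in>words k m. c w * inner_L2 bump (z i \<circ> cell F w)) = 0"
    by auto
  have "inner_L2 (bumps m c) (z i) = 0" if "i < n" for i
    using inner_L2_bumps[OF eigenfunctionD(2)[OF IH(2)[OF that]], of m c] c(3)[OF that] by simp
  then obtain l' g where g: "l' \<le> bump_rayleigh * scaling ^ m" "eigenfunction l' g" "inner_L2 g g = 1"
    "\<And>i. i < n \<Longrightarrow> inner_L2 g (z i) = 0"
    using next_eigenfunction[OF IH(2,3) bumps_finite_energy inner_L2_bumps_pos[where c = c and w = w and m = m, OF c(1,2)],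
        of n "bump_rayleigh * scaling ^ m"] limit_energy_bumps_rayleigh[of m c] by auto
  define l2 z2 where "l2 = l(n := l')" and "z2 = z(n := g)"
  have "\<forall>i<Suc n. l2 i \<le> bump_rayleigh * scaling ^ m \<and> eigenfunction (l2 i) (z2 i)"
    using IH(1,2) g(1,2) by (auto simp: l2_def z2_def less_Suc_eq)
  moreover have "\<forall>i<Suc n. \<forall>j<Suc n. inner_L2 (z2 i) (z2 j) = (if i = j then 1 else 0)"
  proof (intro allI impI)
    fix i j assume "i < Suc n" "j < Suc n"
    moreover have "inner_L2 (z i) g = 0" if "i < n" for i
      unfolding inner_L2_commute[of "z i"] by (rule g(4)[OF that])
    ultimately show "inner_L2 (z2 i) (z2 j) = (if i = j then 1 else 0)"
      using IH(3) g(3,4) by (auto simp: z2_def less_Suc_eq)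
  qed
  ultimately show ?case by blast
qed simp

text \<open>Independence is required within each eigenspace only, and in the almost everywhere sense in which multiplicities are
  defined; distinct eigenspaces are orthogonal. A combination of the eigenfunctions that vanishes at the \<open>k ^ m\<close>
  points \<open>cell F v (p 0)\<close> is therefore nonzero in \<open>L\<^sup>2\<close>, and its energy is bounded by \<open>x\<close> from above and by the
  Rayleigh quotient on cells from below.\<close>

lemma eigenfunction_count_bound:
  assumes B: "finite B" "\<And>b. b \<in> B \<Longrightarrow> eigenfunction (l b) (w b)" "\<And>b. b \<in> B \<Longrightarrow> l b \<le> x"
    and indep: "\<And>c \<nu>. (AE y in \<mu>. (\<Sum>b\<in>{b \<in> B. l b = \<nu>}. c b * w b y) = 0)
      \<Longrightarrow> \<forall>b\<in>{b \<in> B. l b = \<nu>}. c b = 0"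
    and big: "k ^ m < card B"
  shows "scaling ^ m \<le> osc_const\<^sup>2 * x"
proof -
  have "\<exists>c. (\<exists>b\<in>B. c b \<noteq> 0) \<and> (\<forall>v\<in>words k m. (\<Sum>b\<in>B. c b * w b (cell F v (p 0))) = 0)"
    using B(1) big by (intro homogeneous_system_nontrivial_solution) (auto simp: card_words)
  then obtain c b0 where c: "b0 \<in> B" "c b0 \<noteq> 0"
    "\<And>v. v \<in> words k m \<Longrightarrow> (\<Sum>b\<in>B. c b * w b (cell F v (p 0))) = 0" by auto
  define part where "part \<nu> y = (\<Sum>b\<in>{b \<in> B. l b = \<nu>}. c b * w b y)" for \<nu> y
  define L where "L = l ` B"
  define u where "u y = (\<Sum>\<nu>\<in>L. 1 * part \<nu> y)" for y
  have u_eq: "u y = (\<Sum>b\<in>B. c b * w b y)" for y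
    unfolding u_def part_def L_def mult_1 using sum.image_gen[OF B(1), of "\<lambda>b. c b * w b y" l] by simp
  have L: "finite L" "\<And>\<nu>. \<nu> \<in> L \<Longrightarrow> \<nu> \<le> x" using B by (auto simp: L_def)
  have part_W: "part \<nu> \<in> finite_energy" for \<nu>
    unfolding part_def using B by (intro finite_energy_sum) (auto dest: eigenfunctionD)
  have part_c: "continuous_on K (part \<nu>)" for \<nu>
    by (rule finite_energy_continuous[OF part_W])
  have part_energy: "energy_form (part \<nu>) v = \<nu> * inner_L2 (part \<nu>) v" if v: "v \<in> finite_energy" for \<nu> v
  proof -
    have "energy_form (part \<nu>) v = (\<Sum>b\<in>{b \<in> B. l b = \<nu>}. c b * energy_form (w b) v)"
      unfolding part_def using B v by (intro energy_form_sum_left) (auto dest: eigenfunctionD)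
    also have "\<dots> = (\<Sum>b\<in>{b \<in> B. l b = \<nu>}. c b * (\<nu> * inner_L2 (w b) v))"
      using B eigenfunctionD(3)[OF _ v] by (intro sum.cong) auto
    also have "\<dots> = \<nu> * (\<Sum>b\<in>{b \<in> B. l b = \<nu>}. c b * inner_L2 (w b) v)"
      by (simp add: sum_distrib_left mult.left_commute)
    also have "(\<Sum>b\<in>{b \<in> B. l b = \<nu>}. c b * inner_L2 (w b) v) = inner_L2 (part \<nu>) v"
      unfolding part_def using B v
      by (intro inner_L2_sum_left[symmetric]) (auto dest: eigenfunctionD finite_energy_continuous)
    finally show ?thesis .
  qed
  have ortho: "inner_L2 (part \<nu>) (part \<nu>') = 0" if "\<nu> \<noteq> \<nu>'" for \<nu> \<nu>'
    using part_energy[OF part_W, of \<nu> \<nu>'] part_energy[OF part_W, of \<nu>' \<nu>] that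
    by (simp add: energy_form_commute[of "part \<nu>'"] inner_L2_commute[of "part \<nu>'"])
  have uW: "u \<in> finite_energy" unfolding u_def using L part_W by (intro finite_energy_sum) auto
  have uc: "continuous_on K u" by (rule finite_energy_continuous[OF uW])
  have u_inner: "inner_L2 u v = (\<Sum>\<nu>\<in>L. inner_L2 (part \<nu>) v)" if "continuous_on K v" for v
    unfolding u_def using inner_L2_sum_left[OF L(1) part_c that, of "\<lambda>_. 1"] by simp
  have u_energy: "energy_form u v = (\<Sum>\<nu>\<in>L. energy_form (part \<nu>) v)" if "v \<in> finite_energy" for v
    unfolding u_def using energy_form_sum_left[OF L(1) part_W that, of "\<lambda>_. 1"] by simp
  have part_u: "inner_L2 (part \<nu>) u = inner_L2 (part \<nu>) (part \<nu>)" if "\<nu> \<in> L" for \<nu>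
  proof -
    have "inner_L2 u (part \<nu>) = (\<Sum>\<nu>'\<in>L. if \<nu>' = \<nu> then inner_L2 (part \<nu>) (part \<nu>) else 0)"
      unfolding u_inner[OF part_c] by (rule sum.cong) (auto simp: ortho)
    then show ?thesis using that L(1) by (simp add: inner_L2_commute[of u])
  qed
  have norm: "inner_L2 u u = (\<Sum>\<nu>\<in>L. inner_L2 (part \<nu>) (part \<nu>))"
    unfolding u_inner[OF uc] by (rule sum.cong) (auto simp: part_u)
  have "limit_energy u = (\<Sum>\<nu>\<in>L. \<nu> * inner_L2 (part \<nu>) (part \<nu>))"
    unfolding energy_form_self[OF uW, symmetric] u_energy[OF uW]
    by (rule sum.cong) (auto simp: part_energy[OF uW] part_u)
  also have "\<dots> \<le> (\<Sum>\<nu>\<in>L. x * inner_L2 (part \<nu>) (part \<nu>))"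
    using L(2) inner_L2_self_nonneg by (intro sum_mono mult_right_mono) auto
  finally have energy: "limit_energy u \<le> x * inner_L2 u u" by (simp add: norm sum_distrib_left)
  have "\<not> (AE y in \<mu>. part (l b0) y = 0)"
  proof
    assume "AE y in \<mu>. part (l b0) y = 0"
    then have "\<forall>b\<in>{b \<in> B. l b = l b0}. c b = 0"
      unfolding part_def by (rule indep)
    with c(1,2) show False by simp
  qed
  then have "\<exists>y\<in>K. part (l b0) y \<noteq> 0" using AE_I2[of \<mu> "\<lambda>y. part (l b0) y = 0"] unfolding space_\<mu> by blast
  then have "0 < inner_L2 (part (l b0)) (part (l b0))" using inner_L2_pos[OF part_c] by blast
  also have "\<dots> \<le> inner_L2 u u"
    unfolding norm using c(1) L(1) inner_L2_self_nonneg by (intro member_le_sum) (auto simp: L_def)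
  finally have pos: "0 < inner_L2 u u" .
  have "scaling ^ m * inner_L2 u u \<le> osc_const\<^sup>2 * limit_energy u"
    using c(3) by (intro rayleigh_lower_bound uW) (simp add: u_eq)
  also have "\<dots> \<le> osc_const\<^sup>2 * (x * inner_L2 u u)"
    using energy by (intro mult_left_mono) auto
  finally have "scaling ^ m * inner_L2 u u \<le> osc_const\<^sup>2 * x * inner_L2 u u" by simp
  then show ?thesis using pos by simp
qed

end

section \<open>The eigenvalue counting function\<close>

context glued_cells_measure
begin

abbreviation Q :: "('a \<Rightarrow> real) \<Rightarrow> ereal" where
  "Q \<equiv> energy k p F (simplex_matrix k) r"

lemma energy_eq_SUP: "Q u = (SUP m. ereal (E m u))"
proof -
  have "incseq (\<lambda>m. ereal (E m u))" using E_incseq[of u] by (simp add: incseq_def)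
  then show ?thesis unfolding energy_def by (intro limI LIMSEQ_SUP)
qed

lemma energy_finite_energy:
  assumes "u \<in> finite_energy"
  shows "Q u = ereal (limit_energy u)"
  unfolding energy_def using limit_energy_tendsto[OF assms] by (intro limI tendsto_intros)

lemma form_domain_eq: "form_domain K Q = finite_energy"
proof (intro set_eqI iffI)
  fix u assume "u \<in> finite_energy"
  then show "u \<in> form_domain K Q"
    by (simp add: form_domain_def finite_energy_continuous energy_finite_energy)
next
  fix u assume u: "u \<in> form_domain K Q"
  have le: "ereal (E m u) \<le> Q u" for m unfolding energy_eq_SUP by (rule SUP_upper) simp
  obtain C where C: "Q u = ereal C"
    using u le[of 0] by (cases "Q u") (auto simp: form_domain_def)
  show "u \<in> finite_energy"
    using u le by (intro finite_energyI[of u C]) (auto simp: form_domain_def C)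
qed

lemma polarization_eq:
  assumes "u \<in> finite_energy" "v \<in> finite_energy"
  shows "polarization Q u v = energy_form u v"
  using finite_energy_combination[OF assms, of 1 1] finite_energy_combination[OF assms, of 1 "-1"]
    limit_energy_combination[OF assms, of 1 1] limit_energy_combination[OF assms, of 1 "-1"]
  by (simp add: polarization_def energy_finite_energy)

abbreviation laplacian :: "(('a \<Rightarrow> real) \<times> ('a \<Rightarrow> real)) set" where
  "laplacian \<equiv> form_operator \<mu> (form_domain K Q) Q"

lemma eigenfunction_laplacian:
  assumes w: "eigenfunction l w"
  shows "(w, \<lambda>x. l * w x) \<in> laplacian"
proof -
  have c: "continuous_on K w" and W: "w \<in> finite_energy" using w by (auto dest: eigenfunctionD)
  have "w \<in> L2_functions \<mu>" "(\<lambda>x. l * w x) \<in> L2_functions \<mu>"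
    using c by (auto simp: L2_functions_def intro!: measurable_continuous integrable_continuous continuous_intros)
  moreover have "polarization Q w v = (LINT x|\<mu>. l * w x * v x)" if "v \<in> finite_energy" for v
    using eigenfunctionD(3)[OF w that] that W by (simp add: polarization_eq inner_L2_def mult.assoc)
  ultimately show ?thesis
    using W by (auto simp: form_operator_def form_domain_eq)
qed

text \<open>Elements of \<open>L\<^sup>2\<close> are represented by arbitrary functions, so an eigenvector need only agree almost everywhere
  with a continuous function of finite energy.\<close>

lemma laplacian_eigenfunction:
  assumes u: "(u, \<lambda>x. l * u x) \<in> laplacian"
  shows "\<exists>w. eigenfunction l w \<and> (AE x in \<mu>. u x = w x)"
proof -
  obtain w where w: "w \<in> finite_energy" "AE x in \<mu>. u x = w x"
    "\<And>v. v \<in> finite_energy \<Longrightarrow> polarization Q w v = (LINT x|\<mu>. l * u x * v x)"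
    and meas: "u \<in> borel_measurable \<mu>"
    using u by (auto simp: form_operator_def form_domain_eq L2_functions_def)
  have "energy_form w v = l * inner_L2 w v" if v: "v \<in> finite_energy" for v
  proof -
    have "energy_form w v = (LINT x|\<mu>. l * u x * v x)"
      using w(3)[OF v] polarization_eq[OF w(1) v] by simp
    also have "\<dots> = (LINT x|\<mu>. l * w x * v x)"
      using w(1,2) v meas measurable_continuous[OF finite_energy_continuous]
      by (intro integral_cong_AE borel_measurable_times borel_measurable_const) auto
    finally show ?thesis by (simp add: inner_L2_def mult.assoc)
  qed
  with w show ?thesis by (auto simp: eigenfunction_def)
qed

definition multiplicity_at_least :: "real \<Rightarrow> nat \<Rightarrow> bool" where
  "multiplicity_at_least l n \<longleftrightarrow> (\<exists>u. L2_independent \<mu> n u \<and> (\<forall>i<n. (u i, \<lambda>x. l * u i x) \<in> laplacian))"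

lemma eigen_multiplicity_eq: "eigen_multiplicity \<mu> laplacian l = Sup {enat n | n. multiplicity_at_least l n}"
  by (simp add: eigen_multiplicity_def multiplicity_at_least_def)

lemma multiplicity_at_least_0: "multiplicity_at_least l 0"
  by (simp add: multiplicity_at_least_def L2_independent_def)

lemma multiplicity_at_least_eigenfunctions:
  assumes "multiplicity_at_least l n"
  obtains w where "\<And>i. i < n \<Longrightarrow> eigenfunction l (w i)" "L2_independent \<mu> n w"
proof -
  obtain u where u: "L2_independent \<mu> n u" "\<And>i. i < n \<Longrightarrow> (u i, \<lambda>x. l * u i x) \<in> laplacian"
    using assms by (auto simp: multiplicity_at_least_def)
  obtain w where w: "\<And>i. i < n \<Longrightarrow> eigenfunction l (w i)" "\<And>i. i < n \<Longrightarrow> AE x in \<mu>. u i x = w i x"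
    using laplacian_eigenfunction[OF u(2)] by metis
  have eq: "AE x in \<mu>. \<forall>i\<in>{..<n}. u i x = w i x"
    using w(2) by (intro AE_finite_allI) auto
  have "L2_independent \<mu> n w"
    unfolding L2_independent_def
  proof (intro allI impI)
    fix c i assume 0: "AE x in \<mu>. (\<Sum>i<n. c i * w i x) = 0" and i: "i < n"
    have "AE x in \<mu>. (\<Sum>i<n. c i * u i x) = 0"
      using 0 eq by eventually_elim simp
    then show "c i = 0" using u(1) i by (auto simp: L2_independent_def)
  qed
  with w show thesis using that by blast
qed

text \<open>Independent families for finitely many eigenvalues, taken together, satisfy the hypotheses of
  \<open>eigenfunction_count_bound\<close>.\<close>

lemma multiplicity_sum_le:
  assumes x: "osc_const\<^sup>2 * x < scaling ^ m"
    and L: "finite L" "L \<subseteq> {..x}" "\<And>l. l \<in> L \<Longrightarrow> multiplicity_at_least l (n l)"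
  shows "(\<Sum>l\<in>L. n l) \<le> k ^ m"
proof (rule ccontr)
  assume "\<not> (\<Sum>l\<in>L. n l) \<le> k ^ m"
  have "\<exists>w. (\<forall>i<n l. eigenfunction l (w i)) \<and> L2_independent \<mu> (n l) w" if "l \<in> L" for l
    using multiplicity_at_least_eigenfunctions[OF L(3)[OF that]] by metis
  then obtain w where w: "\<And>l i. l \<in> L \<Longrightarrow> i < n l \<Longrightarrow> eigenfunction l (w l i)"
    "\<And>l. l \<in> L \<Longrightarrow> L2_independent \<mu> (n l) (w l)" by metis
  define B where "B = (SIGMA l:L. {..<n l})"
  have "scaling ^ m \<le> osc_const\<^sup>2 * x"
  proof (rule eigenfunction_count_bound[of B fst "\<lambda>b. w (fst b) (snd b)"])
    show "finite B" using L(1) by (simp add: B_def)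
    show "b \<in> B \<Longrightarrow> eigenfunction (fst b) (w (fst b) (snd b))" "b \<in> B \<Longrightarrow> fst b \<le> x" for b
      using w(1) L(2) by (auto simp: B_def)
    show "k ^ m < card B" using \<open>\<not> _\<close> L(1) by (simp add: B_def)
    fix c \<nu> assume 0: "AE y in \<mu>. (\<Sum>b\<in>{b \<in> B. fst b = \<nu>}. c b * w (fst b) (snd b) y) = 0"
    show "\<forall>b\<in>{b \<in> B. fst b = \<nu>}. c b = 0"
    proof (cases "\<nu> \<in> L")
      case True
      have fibre: "{b \<in> B. fst b = \<nu>} = Pair \<nu> ` {..<n \<nu>}" using True by (auto simp: B_def)
      have "AE y in \<mu>. (\<Sum>i<n \<nu>. c (\<nu>, i) * w \<nu> i y) = 0"
        using 0 unfolding fibre by (simp add: sum.reindex inj_on_def)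
      then have "\<forall>i<n \<nu>. c (\<nu>, i) = 0"
        using w(2)[OF True, unfolded L2_independent_def, THEN spec[of _ "\<lambda>i. c (\<nu>, i)"]] by blast
      then show ?thesis by (auto simp: fibre)
    qed (auto simp: B_def)
  qed
  with x show False by simp
qed

lemma eigenvalue_count_SUP:
  "eigenvalue_count \<mu> laplacian x
    = (SUP L\<in>{L. finite L \<and> L \<subseteq> {..x}}. \<Sum>l\<in>L. ennreal_of_enat (eigen_multiplicity \<mu> laplacian l))"
  unfolding eigenvalue_count_def by (rule nonneg_infsum_complete) simp

text \<open>All multiplicities in question are finite by \<open>multiplicity_sum_le\<close>, hence attained as suprema of finite sets.\<close>

lemma eigenvalue_count_le:
  assumes x: "osc_const\<^sup>2 * x < scaling ^ m"
  shows "eigenvalue_count \<mu> laplacian x \<le> of_nat (k ^ m)"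
  unfolding eigenvalue_count_SUP
proof (rule SUP_least)
  fix L assume "L \<in> {L. finite L \<and> L \<subseteq> {..x}}"
  then have L: "finite L" "L \<subseteq> {..x}" by auto
  have "\<exists>n. multiplicity_at_least l n \<and> eigen_multiplicity \<mu> laplacian l = enat n" if l: "l \<in> L" for l
  proof -
    have "n \<le> k ^ m" if "multiplicity_at_least l n" for n
      using multiplicity_sum_le[OF x, of "{l}" "\<lambda>_. n"] l L that by auto
    then have "{enat n | n. multiplicity_at_least l n} \<subseteq> enat ` {..k ^ m}" by auto
    then have fin: "finite {enat n | n. multiplicity_at_least l n}" by (rule finite_subset) simp
    have ne: "{enat n | n. multiplicity_at_least l n} \<noteq> {}" using multiplicity_at_least_0 by blast
    have "Sup {enat n | n. multiplicity_at_least l n} \<in> {enat n | n. multiplicity_at_least l n}"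
      using Max_in[OF fin ne] Max_Sup[OF fin ne] by simp
    then show ?thesis by (auto simp: eigen_multiplicity_eq)
  qed
  then obtain n where n: "\<And>l. l \<in> L \<Longrightarrow> multiplicity_at_least l (n l)"
    "\<And>l. l \<in> L \<Longrightarrow> eigen_multiplicity \<mu> laplacian l = enat (n l)" by metis
  have "(\<Sum>l\<in>L. ennreal_of_enat (eigen_multiplicity \<mu> laplacian l)) = of_nat (\<Sum>l\<in>L. n l)"
    by (simp add: n(2))
  also have "\<dots> \<le> of_nat (k ^ m)"
    using multiplicity_sum_le[OF x L n(1)] by (simp only: of_nat_le_iff)
  finally show "(\<Sum>l\<in>L. ennreal_of_enat (eigen_multiplicity \<mu> laplacian l)) \<le> of_nat (k ^ m)" .
qed

text \<open>Orthonormal eigenfunctions are sorted by eigenvalue; each group bounds one multiplicity from below.\<close>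

lemma eigenvalue_count_ge:
  assumes x: "bump_rayleigh * scaling ^ m \<le> x"
  shows "of_nat (k ^ m) \<le> eigenvalue_count \<mu> laplacian x"
proof -
  define n where "n = k ^ m"
  obtain l z where lz: "\<forall>i<n. l i \<le> bump_rayleigh * scaling ^ m \<and> eigenfunction (l i) (z i)"
    "\<forall>i<n. \<forall>j<n. inner_L2 (z i) (z j) = (if i = j then 1 else 0)"
    using orthonormal_eigenfunctions[of n m] by (auto simp: n_def)
  have z: "continuous_on K (z i)" if "i < n" for i using lz(1) that by (blast dest: eigenfunctionD)
  define I where "I e = {i \<in> {..<n}. l i = e}" for e
  have adm: "multiplicity_at_least e (card (I e))" for e
  proof -
    obtain h where h: "bij_betw h {..<card (I e)} (I e)"
      using ex_bij_betw_nat_finite[of "I e"] by (auto simp: I_def atLeast0LessThan)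
    have hI: "h i < n" "l (h i) = e" if "i < card (I e)" for i
      using bij_betwE[OF h] that by (auto simp: I_def)
    have "L2_independent \<mu> (card (I e)) (\<lambda>i. z (h i))"
      unfolding L2_independent_def
    proof (intro allI impI)
      fix c j assume 0: "AE x in \<mu>. (\<Sum>i<card (I e). c i * z (h i) x) = 0" and j: "j < card (I e)"
      have "inner_L2 (\<lambda>x. \<Sum>i<card (I e). c i * z (h i) x) (z (h j))
          = (\<Sum>i<card (I e). c i * inner_L2 (z (h i)) (z (h j)))"
        using z hI j by (intro inner_L2_sum_left) auto
      also have "\<dots> = (\<Sum>i<card (I e). if i = j then c j else 0)"
      proof (rule sum.cong[OF refl])
        fix i assume "i \<in> {..<card (I e)}"
        then show "c i * inner_L2 (z (h i)) (z (h j)) = (if i = j then c j else 0)"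
          using lz(2) hI j bij_betw_imp_inj_on[OF h] by (auto simp: inj_on_def)
      qed
      also have "\<dots> = c j" using j by simp
      finally have "c j = inner_L2 (\<lambda>x. \<Sum>i<card (I e). c i * z (h i) x) (z (h j))" by simp
      also have "\<dots> = 0"
        unfolding inner_L2_def by (rule integral_eq_zero_AE) (use 0 in \<open>eventually_elim, simp\<close>)
      finally show "c j = 0" .
    qed
    moreover have "(z (h i), \<lambda>x. e * z (h i) x) \<in> laplacian" if "i < card (I e)" for i
      using eigenfunction_laplacian[of "l (h i)" "z (h i)"] lz(1) hI[OF that] by auto
    ultimately show ?thesis by (auto simp: multiplicity_at_least_def)
  qed
  define L where "L = l ` {..<n}"
  have "n = (\<Sum>e\<in>L. card (I e))"
    using sum.image_gen[of "{..<n}" "\<lambda>_. 1::nat" l] by (simp add: L_def I_def)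
  then have "(of_nat n :: ennreal) = (\<Sum>e\<in>L. ennreal_of_enat (enat (card (I e))))"
    by (metis (no_types, lifting) ennreal_of_enat_enat of_nat_sum sum.cong)
  also have "\<dots> \<le> (\<Sum>e\<in>L. ennreal_of_enat (eigen_multiplicity \<mu> laplacian e))"
    using adm by (intro sum_mono) (auto simp: eigen_multiplicity_eq ennreal_of_enat_le_iff simp del: ennreal_of_enat_enat intro!: Sup_upper)
  also have "\<dots> \<le> eigenvalue_count \<mu> laplacian x"
    unfolding eigenvalue_count_SUP
    by (rule SUP_upper) (use lz(1) x in \<open>force simp: L_def\<close>)
  finally show ?thesis by (simp add: n_def)
qed

end

section \<open>From bounds at powers to the spectral dimension\<close>

lemma power_bracket:
  fixes b y :: real
  assumes "1 < b" "1 \<le> y"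
  obtains m where "b ^ m \<le> y" "y < b ^ Suc m"
proof -
  obtain n where "y < b ^ n" using real_arch_pow[OF assms(1)] by blast
  define N where "N = (LEAST n. y < b ^ n)"
  have N: "y < b ^ N" unfolding N_def by (rule LeastI) fact
  obtain m where m: "N = Suc m" using N assms(2) by (cases N) auto
  have "b ^ m \<le> y"
    using not_less_Least[of m "\<lambda>n. y < b ^ n"] m by (simp add: N_def[symmetric] not_less)
  with N m that show thesis by blast
qed

text \<open>Every large \<open>x\<close> lies between consecutive powers of \<open>b\<close>, up to a constant, and \<open>k ^ m = (b ^ m) powr s\<close> for
  \<open>s = ln k / ln b\<close>. So \<open>\<rho> x\<close> is comparable to \<open>x powr s\<close>. With another exponent the quotient tends to \<open>0\<close> or
  \<open>\<infinity>\<close>, which contradicts the positive lower limit or the finite upper limit.\<close>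

lemma spectral_dimension_iff:
  fixes \<rho> :: "real \<Rightarrow> ennreal" and k :: nat
  assumes k: "1 < k" and b: "1 < b" and R: "0 < R" and c: "0 < c"
    and lower: "\<And>m x. R * b ^ m \<le> x \<Longrightarrow> of_nat (k ^ m) \<le> \<rho> x"
    and upper: "\<And>m x. 0 < x \<Longrightarrow> c * x < b ^ m \<Longrightarrow> \<rho> x \<le> of_nat (k ^ m)"
  shows "is_spectral_dimension \<rho> d \<longleftrightarrow> d = 2 * ln (real k) / ln b"
proof -
  define s where "s = ln (real k) / ln b"
  have s: "0 < s" using k b by (simp add: s_def)
  have pow: "real k ^ m = (b ^ m) powr s" for m
    using k b by (simp add: s_def powr_def ln_realpow exp_of_nat2_mult)
  define A where "A = (1 / (R * b)) powr s"
  define B where "B = real k * c powr s"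
  have A: "0 < A" using R b by (simp add: A_def)
  have B: "0 < B" using k c by (simp add: B_def)
  have lo: "ennreal (A * x powr s) \<le> \<rho> x" if x: "R \<le> x" for x
  proof -
    obtain m where m: "b ^ m \<le> x / R" "x / R < b ^ Suc m"
      using power_bracket[OF b, of "x / R"] x R by auto
    have "A * x powr s = (x / (R * b)) powr s"
      using x R b by (simp add: A_def flip: powr_mult)
    also have "\<dots> \<le> (b ^ m) powr s"
      using m(2) x R b s by (intro powr_mono2) (auto simp: field_simps)
    also have "ennreal \<dots> = of_nat (k ^ m)"
      by (simp add: ennreal_of_nat_eq_real_of_nat flip: pow)
    also have "\<dots> \<le> \<rho> x" using m(1) R by (intro lower) (simp add: field_simps)
    finally show ?thesis by (simp add: ennreal_leI)
  qed
  have up: "\<rho> x \<le> ennreal (B * x powr s)" if x: "1 / c \<le> x" for x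
  proof -
    have x0: "0 < x" using x c by (meson less_le_trans zero_less_divide_1_iff)
    obtain m where m: "b ^ m \<le> c * x" "c * x < b ^ Suc m"
      using power_bracket[OF b, of "c * x"] x c by (auto simp: field_simps)
    have "\<rho> x \<le> of_nat (k ^ Suc m)" by (rule upper[OF x0 m(2)])
    also have "\<dots> = ennreal (real k * (b ^ m) powr s)"
      by (simp add: ennreal_of_nat_eq_real_of_nat flip: pow)
    also have "\<dots> \<le> ennreal (real k * (c * x) powr s)"
      using m(1) s b by (intro ennreal_leI mult_left_mono powr_mono2) auto
    also have "real k * (c * x) powr s = B * x powr s"
      using x0 c by (simp add: B_def powr_mult)
    finally show ?thesis .
  qed
  define g where "g d x = \<rho> x * ennreal (x powr (- d / 2))" for d x
  have g_lo: "\<forall>\<^sub>F x in at_top. ennreal (A * x powr (s - d / 2)) \<le> g d x" for d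
    using eventually_ge_at_top[of R] eventually_gt_at_top[of 0]
  proof eventually_elim
    case (elim x)
    have "ennreal (A * x powr (s - d / 2)) = ennreal (A * x powr s) * ennreal (x powr (- d / 2))"
      using A elim by (simp add: mult.assoc flip: ennreal_mult powr_add)
    also have "\<dots> \<le> g d x" unfolding g_def using lo[OF elim(1)] by (rule mult_right_mono) simp
    finally show ?case .
  qed
  have g_up: "\<forall>\<^sub>F x in at_top. g d x \<le> ennreal (B * x powr (s - d / 2))" for d
    using eventually_ge_at_top[of "1 / c"] eventually_gt_at_top[of 0]
  proof eventually_elim
    case (elim x)
    have "g d x \<le> ennreal (B * x powr s) * ennreal (x powr (- d / 2))"
      unfolding g_def using up[OF elim(1)] by (rule mult_right_mono) simp
    also have "\<dots> = ennreal (B * x powr (s - d / 2))"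
      using B elim by (simp add: mult.assoc flip: ennreal_mult powr_add)
    finally show ?case .
  qed
  have dim: "is_spectral_dimension \<rho> d \<longleftrightarrow> 0 < Liminf at_top (g d) \<and> Liminf at_top (g d) \<le> Limsup at_top (g d)
      \<and> Limsup at_top (g d) < \<infinity>" for d
    by (simp add: is_spectral_dimension_def g_def[abs_def])
  show ?thesis
  proof
    assume d: "d = 2 * ln (real k) / ln b"
    then have e: "s - d / 2 = 0" by (simp add: s_def)
    have "\<forall>\<^sub>F x in at_top. ennreal A \<le> g d x"
      using g_lo[of d] eventually_gt_at_top[of 0] by eventually_elim (simp add: e)
    then have "ennreal A \<le> Liminf at_top (g d)" by (rule Liminf_bounded)
    moreover have "\<forall>\<^sub>F x in at_top. g d x \<le> ennreal B"
      using g_up[of d] eventually_gt_at_top[of 0] by eventually_elim (simp add: e)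
    then have "Limsup at_top (g d) \<le> ennreal B" by (rule Limsup_bounded)
    moreover have "Liminf at_top (g d) \<le> Limsup at_top (g d)" by (rule Liminf_le_Limsup) simp
    moreover have "0 < ennreal A" "ennreal B < \<infinity>" using A by simp_all
    ultimately show "is_spectral_dimension \<rho> d"
      unfolding dim by (meson le_less_trans less_le_trans)
  next
    assume "is_spectral_dimension \<rho> d"
    then have inf: "0 < Liminf at_top (g d)" and sup: "Limsup at_top (g d) < \<infinity>" by (auto simp: dim)
    have "\<not> d / 2 < s"
    proof
      assume less: "d / 2 < s"
      obtain C where C: "Limsup at_top (g d) < C" "C < \<infinity>" using sup dense by blast
      have 1: "\<forall>\<^sub>F x in at_top. g d x < C" by (rule Limsup_lessD[OF C(1)])
      obtain C' where C': "C = ennreal C'" using C(2) by (cases C) auto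
      have "filterlim (\<lambda>x. A * x powr (s - d / 2)) at_top at_top"
        using less A by real_asymp
      then have 2: "\<forall>\<^sub>F x in at_top. C' \<le> A * x powr (s - d / 2)" by (simp add: filterlim_at_top)
      have "\<forall>\<^sub>F x::real in at_top. False"
        using 1 2 g_lo[of d]
      proof eventually_elim
        case (elim x)
        have "C \<le> ennreal (A * x powr (s - d / 2))" unfolding C' using elim(2) by (rule ennreal_leI)
        with elim(1,3) show ?case by (meson leD order_trans)
      qed
      then show False by simp
    qed
    moreover have "\<not> s < d / 2"
    proof
      assume less: "s < d / 2"
      obtain C where C: "0 < C" "C < Liminf at_top (g d)" using inf dense by blast
      have 1: "\<forall>\<^sub>F x in at_top. C < g d x" by (rule less_LiminfD[OF C(2)])
      have "C \<noteq> top" using C(2) by (metis top.extremum_strict)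
      then obtain C' where C': "C = ennreal C'" "0 < C'"
        using C(1) by (cases C) auto
      have "((\<lambda>x. B * x powr (s - d / 2)) \<longlongrightarrow> 0) at_top"
        using less by real_asymp
      then have 2: "\<forall>\<^sub>F x in at_top. B * x powr (s - d / 2) < C'"
        using C'(2) by (rule order_tendstoD)
      have "\<forall>\<^sub>F x::real in at_top. False"
        using 1 2 g_up[of d]
      proof eventually_elim
        case (elim x)
        have "ennreal (B * x powr (s - d / 2)) \<le> C"
          unfolding C'(1) using elim(2) by (intro ennreal_leI less_imp_le)
        with elim(1,3) show ?case by (meson leD order_trans)
      qed
      then show False by simp
    qed
    ultimately have "d / 2 = s" by simp
    then show "d = 2 * ln (real k) / ln b" by (simp add: s_def)
  qed
qed

section \<open>The spectral dimension\<close>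

theorem theorem5p4:
  fixes k :: nat
    and p :: "nat \<Rightarrow> 'a::euclidean_space"
    and F :: "nat \<Rightarrow> 'a \<Rightarrow> 'a"
    and K :: "'a set"
    and \<mu> :: "'a measure"
    and r :: real
    and Q :: "('a \<Rightarrow> real) \<Rightarrow> ereal"
    and d :: real
  assumes "k \<ge> 3"
    and "DIM('a) = k - 1"
    and "regular_simplex_vertices k p"
    and "cell_maps k p F"
    and "attractor k F K"
    and "standard_bernoulli_measure k F K \<mu>"
    and "r = real k * (real k - 2) / ((real k)\<^sup>2 - real k - 1)"
    and "Q = energy k p F (simplex_matrix k) r"
  shows "is_spectral_dimension (eigenvalue_count \<mu> (form_operator \<mu> (form_domain K Q) Q)) d \<longleftrightarrow>
    d = 2 * ln (real k) / (ln ((real k)\<^sup>2 - real k - 1) - ln (real k - 2))"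
proof -
  interpret S: simplex_attractor k p F K
    using assms by unfold_locales
  interpret M: glued_cells_measure k p F K \<mu>
    using assms by unfold_locales
  have Q: "Q = M.Q" using assms(7,8) by (simp add: resistance_ratio_def)
  have k: "real k - 2 > 0" "real k > 0" using assms(1) by auto
  have scaling: "M.scaling = ((real k)\<^sup>2 - real k - 1) / (real k - 2)"
    using k resistance_denominator_pos[OF assms(1)] by (simp add: M.scaling_def resistance_ratio_def)
  define R where "R = max 1 M.bump_rayleigh"
  define c where "c = S.osc_const\<^sup>2 + 1"
  have "is_spectral_dimension (eigenvalue_count \<mu> M.laplacian) d \<longleftrightarrow> d = 2 * ln (real k) / ln M.scaling"
  proof (rule spectral_dimension_iff)
    show "1 < k" "1 < M.scaling" "0 < R" "0 < c"
      using assms(1) M.scaling_gt_1 by (auto simp: R_def c_def add_nonneg_pos)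
    show "of_nat (k ^ m) \<le> eigenvalue_count \<mu> M.laplacian x" if "R * M.scaling ^ m \<le> x" for m x
    proof (rule M.eigenvalue_count_ge)
      have "M.bump_rayleigh * M.scaling ^ m \<le> R * M.scaling ^ m"
        using M.scaling_gt_1 by (intro mult_right_mono) (auto simp: R_def)
      with that show "M.bump_rayleigh * M.scaling ^ m \<le> x" by linarith
    qed
    show "eigenvalue_count \<mu> M.laplacian x \<le> of_nat (k ^ m)" if "0 < x" "c * x < M.scaling ^ m" for m x
      using that by (intro M.eigenvalue_count_le) (simp add: c_def distrib_right)
  qed
  then show ?thesis
    using k resistance_denominator_pos[OF assms(1)] by (simp add: Q scaling ln_div)
qed

end
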